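(* Let $\mathbf{oMDP}=\mathrm{Int}(\mathbf{roMDP})$ and $\mathbb{S}=\mathrm{Int}(\mathbb{S}_{\to})$, and let $\mathcal{S}=\mathrm{Int}(\mathcal{S}_{\to})\colon \mathbf{oMDP}\to\mathbb{S}$ be the functor that is the identity on objects and sends an arrow $\mathcal{A}\colon(\vec m,\overleftarrow m)\to(\vec n,\overleftarrow n)$ of $\mathbf{oMDP}$ (that is, an roMDP $\mathcal{A}\colon \vec m+\overleftarrow n\to \vec n+\overleftarrow m$) to $\mathcal{S}_{\to}(\mathcal{A})$. Then $\mathcal{S}$ is a compact closed functor. In particular, for all composable arrows $\mathcal{A},\mathcal{B}$ of $\mathbf{oMDP}$ and all arrows $\mathcal{A}',\mathcal{B}'$ of $\mathbf{oMDP}$, $$\mathcal{S}(\mathcal{A}\,;\,\mathcal{B})=\mathcal{S}(\mathcal{A})\,;\,\mathcal{S}(\mathcal{B}),\qquad \mathcal{S}(\mathcal{A}'\oplus\mathcal{B}')=\mathcal{S}(\mathcal{A}')\oplus\mathcal{S}(\mathcal{B}'),$$ where $;$ and $\oplus$ on each side are the composition and monoidal product of the respective $\mathrm{Int}$ categories.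
   Context: Notation: for $k\in\mathbb{N}$, $[k]=\{1,\dots,k\}$ ($[0]=\emptyset$), $[a,b]=\{a,\dots,b\}$; $X+Y$ is disjoint union. Fix a nonempty finite set $A$ of actions. Rightward open MDPs. An roMDP $\mathcal{A}\colon m\to n$ is a tuple $(m,n,Q,A,E,P,R)$ where $Q$ is a finite set of positions; $E\colon[m]\to Q+[n]$ (elements of $[m]$ are entrances, elements of $[n]$ exits); $P\colon Q\times A\times(Q+[n])\to\mathbb{R}_{\ge0}$ with $\sum_{s'}P(s,a,s')\in\{0,1\}$ for all $s\in Q,a\in A$; $R\colon Q\to\mathbb{R}_{\ge0}$; and the unique-access condition holds: with $\mathrm{exits}(s)=\{t\in[n]\mid\exists a.\,P(s,a,t)>0\}$ for $s\in Q$ and $\mathrm{exits}(i)=\{E(i)\}$ if $E(i)\in[n]$, $\emptyset$ otherwise, for $i\in[m]$, we require that for $s,s'\in[m]+Q$, $\mathrm{exits}(s)\cap\mathrm{exits}(s')\neq\emptyset$ implies $s=s'$, and that $P(s,a,t)>0$ and $P(s,b,t)>0$ with $t\in[n]$ imply $a=b$. Two roMDPs $m\to n$ are isomorphic if a bijection $\eta$ between their position sets (extended by the identity on exits) preserves $E$, $P$ and $R$. $\mathbf{roMDP}$ is the category with objects natural numbers and arrows isomorphism classes of roMDPs, with operations: - Sequential composition of $\mathcal{A}\colon m\to k$, $\mathcal{B}\colon k\to n$: positions $Q^{\mathcal A}+Q^{\mathcal B}$; $E(i)=E^{\mathcal A}(i)$ if $E^{\mathcal A}(i)\in Q^{\mathcal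 A}$, else $E^{\mathcal B}(E^{\mathcal A}(i))$; for $s\in Q^{\mathcal A}$: $P(s,a,s')=P^{\mathcal A}(s,a,s')$ if $s'\in Q^{\mathcal A}$, and $\sum_{i\in[k]}P^{\mathcal A}(s,a,i)\cdot[E^{\mathcal B}(i)=s']$ if $s'\in Q^{\mathcal B}+[n]$; for $s\in Q^{\mathcal B}$: $P(s,a,s')=P^{\mathcal B}(s,a,s')$ if $s'\in Q^{\mathcal B}+[n]$, $0$ otherwise; rewards combined by case distinction. - Sum $\mathcal{A}\oplus\mathcal{B}\colon m+k\to n+l$ for $\mathcal A\colon m\to n$, $\mathcal B\colon k\to l$: disjoint union of positions, entrances of $\mathcal B$ shifted by $m$, exits of $\mathcal B$ shifted by $n$. - Identity $\mathcal I_m$: no positions, $E(i)=i$. Swap $\mathcal S_{m,n}\colon m+n\to n+m$: no positions, $E(i)=i+n$ for $i\le m$, $E(i)=i-m$ for $i>m$. - Trace: for $\mathcal{A}\colon l+m\to l+n$, $\mathrm{tr}^l_{m,n}(\mathcal A)\colon m\to n$ has positions $Q^{\mathcal A}$ and rewards $R^{\mathcal A}$. For $i\in[m]$ let $i_0=i+l$, $i_j=E^{\mathcal A}(i_{j-1})$, and $k$ the first index with $i_k\in[l+1,l+n]+Q^{\mathcal A}$ (exits in $[l]$ are fed back as entrances in $[l]$); $E(i)=i_k-l$ if $i_k$ is an exit, else $i_k$. For $t\in[l+1,l+n]+Q^{\mathcal A}$ let $\mathrm{prec}(t)$ be the set of $i\in[l]$ such that the sequence $i_0=i$, $i_{j+1}=E^{\mathcal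 A}(i_j)$ stays in $[l]$ until it reaches $t$. Then $P(q,a,q')=P^{\mathcal A}(q,a,q'+l)+\sum_{i\in\mathrm{prec}(q'+l)}P^{\mathcal A}(q,a,i)$ for $q'\in[n]$ and $P(q,a,q')=P^{\mathcal A}(q,a,q')+\sum_{i\in\mathrm{prec}(q')}P^{\mathcal A}(q,a,i)$ for $q'\in Q^{\mathcal A}$. $\mathbf{roMDP}$ is a traced symmetric monoidal category with these operations (tensor on objects is addition). Semantic categories. $\mathbb{S}^{\mathrm{MC}}_{\to}$ has objects natural numbers; an arrow $f\colon m\to n$ assigns to each $(i,j)\in[m]\times[n]$ a pair $(p_{i,j},r_{i,j})\in\mathbb{R}_{\ge0}^2$ with $\sum_j p_{i,j}\le1$ for each $i$ and $p_{i,j}=0\Rightarrow r_{i,j}=0$. Composition of $f\colon m\to l$, $g\colon l\to n$: with matrices $P^f=[p^f_{i,k}]$ etc., $P^{f;g}=P^fP^g$ and $R^{f;g}=P^fR^g+R^fP^g$. Sum $f\oplus g$ is block-diagonal (pairs $(0,0)$ off the blocks); identity $\mathrm{id}_m(i,j)=(\delta_{ij},0)$; swap $m+n\to n+m$ has $(1,0)$ exactly at $(i,i+n)$ for $i\le m$ and $(i,i-m)$ for $i>m$, $(0,0)$ elsewhere. Trace of $h\colon l+m\to l+n$: $p^{\mathrm{tr}(h)}_{i,j}=p^h_{l+i,l+j}+\sum_{d\in\mathbb N}(A_pB_p^dC_p)_{i,j}$ with $A_p=[p^h_{l+i,k}]_{i\in[m],k\in[l]}$, $B_p=[p^h_{k,k'}]_{k,k'\in[l]}$,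 $C_p=[p^h_{k',l+j}]_{k'\in[l],j\in[n]}$; and $r^{\mathrm{tr}(h)}_{i,j}=r^h_{l+i,l+j}+\sum_{d}(AB^dC)_{i,j}$ with $A=(A_p\ \ A_r)$, $B=\begin{pmatrix}B_p&B_r\\0&B_p\end{pmatrix}$, $C=\begin{pmatrix}C_r\\C_p\end{pmatrix}$, where $A_r,B_r,C_r$ are the same matrices with $r^h$ in place of $p^h$. $\mathbb{S}_{\to}$ has objects natural numbers and arrows $m\to n$ the sets of arrows $m\to n$ of $\mathbb{S}^{\mathrm{MC}}_{\to}$; $;,\oplus,\mathrm{tr}$ are applied elementwise ($F;G=\{f;g\mid f\in F,g\in G\}$ etc.), identities and swaps are singletons of those of $\mathbb{S}^{\mathrm{MC}}_{\to}$. Solution functor on roMDPs. For an roMDP $\mathcal{A}$ and a memoryless scheduler $\tau\colon Q\to A$, the induced rightward open Markov chain $\mathcal{A}_\tau$ has the same data but action set $\{\star\}$ and $P(s,\star,t)=P^{\mathcal A}(s,\tau(s),t)$. For a Markov chain (single action), a path from entrance $i$ to exit $j$ is a sequence $i,s_1,\dots,s_k,j$ of positions $s_1,\dots,s_k$ whose first element after $i$ is $E(i)$; its probability is $\prod_{t=1}^kP(s_t,\star,s_{t+1})$ ($s_{k+1}=j$) and its reward $\sum_tR(s_t)$. $\mathrm{RPr}_{i,j}$ is the sum of path probabilities from $i$ to $j$, and $\mathrm{ERw}_{i,j}$ the sum of probability times reward over those paths. $\mathcal{S}^{\mathrm{MC}}_{\to}(\mathcal C)(i,j)=(\mathrm{RPr}^{\mathcal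 C}_{i,j},\mathrm{ERw}^{\mathcal C}_{i,j})$, and $\mathcal{S}_{\to}(\mathcal A)=\{\mathcal{S}^{\mathrm{MC}}_{\to}(\mathcal A_\tau)\mid\tau\colon Q^{\mathcal A}\to A\}$. Int construction (Joyal–Street–Verity) of a traced symmetric monoidal category $\mathbb C$ with objects natural numbers: objects are pairs $(\vec m,\overleftarrow m)$; arrows $(\vec m,\overleftarrow m)\to(\vec n,\overleftarrow n)$ are arrows $\vec m+\overleftarrow n\to\vec n+\overleftarrow m$ of $\mathbb C$; the composite of $f\colon(\vec m,\overleftarrow m)\to(\vec l,\overleftarrow l)$ and $g\colon(\vec l,\overleftarrow l)\to(\vec n,\overleftarrow n)$ is $\mathrm{tr}^{\overleftarrow l}\big((\sigma_{\overleftarrow l,\vec m}\oplus\mathrm{id}_{\overleftarrow n});(f\oplus\mathrm{id}_{\overleftarrow n});(\mathrm{id}_{\vec l}\oplus\sigma_{\overleftarrow m,\overleftarrow n});(g\oplus\mathrm{id}_{\overleftarrow m});(\sigma_{\vec n,\overleftarrow l}\oplus\mathrm{id}_{\overleftarrow m})\big)$, where $\sigma$ are swaps; the monoidal product, units and counits are those of the standard Int construction, making $\mathrm{Int}(\mathbb C)$ compact closed; a traced symmetric monoidal functor $F$ induces $\mathrm{Int}(F)$ acting as $F$ on arrows. *)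

theory Defs
  imports "Jordan_Normal_Form.Matrix" "HOL-Analysis.Infinite_Sum"
begin

text \<open>
  The \<open>k\<close>-element set of entrances or exits is \<open>{..<k}\<close>, i.e. indices start at \<open>0\<close>, as in the
  matrix library; the shifts by \<open>l\<close>, \<open>m\<close>, \<open>n\<close> below are unaffected by this. The nonempty finite
  set of actions is a type of class \<open>finite\<close>.
\<close>

section \<open>Rightward open MDPs\<close>

text \<open>
  In values of type \<open>'q + nat\<close>, \<open>Inl q\<close> is a position and \<open>Inr j\<close> an exit. The components
  \<open>entr\<close>, \<open>trans_prob\<close>, \<open>reward\<close> are relevant only on entrances below \<open>n_ents\<close>, on \<open>positions\<close>, and
  on exits below \<open>n_exits\<close>.
\<close>

record ('q, 'a) romdp =
  n_ents :: nat
  n_exits :: nat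
  positions :: "'q set"
  entr :: "nat \<Rightarrow> 'q + nat"
  trans_prob :: "'q \<Rightarrow> 'a \<Rightarrow> 'q + nat \<Rightarrow> real"
  reward :: "'q \<Rightarrow> real"

definition targets :: "('q, 'a) romdp \<Rightarrow> ('q + nat) set" where
  "targets A = positions A <+> {..<n_exits A}"

text \<open>The argument is an element of \<open>[m] + Q\<close>: \<open>Inl i\<close> is an entrance, \<open>Inr s\<close> a position.\<close>

fun exits :: "('q, 'a) romdp \<Rightarrow> nat + 'q \<Rightarrow> nat set" where
  "exits A (Inl i) = {t. t < n_exits A \<and> entr A i = Inr t}"
| "exits A (Inr s) = {t. t < n_exits A \<and> (\<exists>a. trans_prob A s a (Inr t) > 0)}"

definition unique_access :: "('q, 'a) romdp \<Rightarrow> bool" where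
  "unique_access A \<longleftrightarrow>
     (\<forall>s \<in> {..<n_ents A} <+> positions A. \<forall>s' \<in> {..<n_ents A} <+> positions A.
        exits A s \<inter> exits A s' \<noteq> {} \<longrightarrow> s = s') \<and>
     (\<forall>s \<in> positions A. \<forall>a b. \<forall>t < n_exits A.
        trans_prob A s a (Inr t) > 0 \<and> trans_prob A s b (Inr t) > 0 \<longrightarrow> a = b)"

definition is_romdp :: "('q, 'a) romdp \<Rightarrow> bool" where
  "is_romdp A \<longleftrightarrow>
     finite (positions A) \<and>
     (\<forall>i < n_ents A. entr A i \<in> targets A) \<and>
     (\<forall>s \<in> positions A. \<forall>a. \<forall>t \<in> targets A. trans_prob A s a t \<ge> 0) \<and>
     (\<forall>s \<in> positions A. \<forall>a. (\<Sum>t \<in> targets A. trans_prob A s a t) \<in> {0, 1}) \<and>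
     (\<forall>s \<in> positions A. reward A s \<ge> 0) \<and>
     unique_access A"

definition romdp_iso :: "('q, 'a) romdp \<Rightarrow> ('r, 'a) romdp \<Rightarrow> bool" where
  "romdp_iso A B \<longleftrightarrow>
     n_ents A = n_ents B \<and> n_exits A = n_exits B \<and>
     (\<exists>\<eta>. bij_betw \<eta> (positions A) (positions B) \<and>
        (\<forall>i < n_ents A. entr B i = map_sum \<eta> id (entr A i)) \<and>
        (\<forall>s \<in> positions A. \<forall>a. \<forall>t \<in> targets A.
           trans_prob B (\<eta> s) a (map_sum \<eta> id t) = trans_prob A s a t) \<and>
        (\<forall>s \<in> positions A. reward B (\<eta> s) = reward A s))"

subsection \<open>Operations\<close>

fun seq_prob :: "('q, 'a) romdp \<Rightarrow> ('r, 'a) romdp \<Rightarrow> 'q + 'r \<Rightarrow> 'a \<Rightarrow> ('q + 'r) + nat \<Rightarrow> real" where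
  "seq_prob A B (Inl s) a (Inl (Inl s')) = trans_prob A s a (Inl s')"
| "seq_prob A B (Inl s) a (Inl (Inr s')) =
     (\<Sum>i<n_exits A. trans_prob A s a (Inr i) * of_bool (entr B i = Inl s'))"
| "seq_prob A B (Inl s) a (Inr j) =
     (\<Sum>i<n_exits A. trans_prob A s a (Inr i) * of_bool (entr B i = Inr j))"
| "seq_prob A B (Inr s) a (Inl (Inl s')) = 0"
| "seq_prob A B (Inr s) a (Inl (Inr s')) = trans_prob B s a (Inl s')"
| "seq_prob A B (Inr s) a (Inr j) = trans_prob B s a (Inr j)"

definition romdp_seq :: "('q, 'a) romdp \<Rightarrow> ('r, 'a) romdp \<Rightarrow> ('q + 'r, 'a) romdp" where
  "romdp_seq A B =
     \<lparr> n_ents = n_ents A, n_exits = n_exits B, positions = positions A <+> positions B,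
       entr = (\<lambda>i. case entr A i of Inl s \<Rightarrow> Inl (Inl s) | Inr k \<Rightarrow> map_sum Inr id (entr B k)),
       trans_prob = seq_prob A B,
       reward = case_sum (reward A) (reward B) \<rparr>"

fun sum_prob :: "('q, 'a) romdp \<Rightarrow> ('r, 'a) romdp \<Rightarrow> 'q + 'r \<Rightarrow> 'a \<Rightarrow> ('q + 'r) + nat \<Rightarrow> real" where
  "sum_prob A B (Inl s) a (Inl (Inl s')) = trans_prob A s a (Inl s')"
| "sum_prob A B (Inl s) a (Inl (Inr s')) = 0"
| "sum_prob A B (Inl s) a (Inr j) =
     (if j < n_exits A then trans_prob A s a (Inr j) else 0)"
| "sum_prob A B (Inr s) a (Inl (Inl s')) = 0"
| "sum_prob A B (Inr s) a (Inl (Inr s')) = trans_prob B s a (Inl s')"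
| "sum_prob A B (Inr s) a (Inr j) =
     (if j < n_exits A then 0 else trans_prob B s a (Inr (j - n_exits A)))"

definition romdp_sum :: "('q, 'a) romdp \<Rightarrow> ('r, 'a) romdp \<Rightarrow> ('q + 'r, 'a) romdp" where
  "romdp_sum A B =
     \<lparr> n_ents = n_ents A + n_ents B, n_exits = n_exits A + n_exits B,
       positions = positions A <+> positions B,
       entr = (\<lambda>i. if i < n_ents A then map_sum Inl id (entr A i)
                   else map_sum Inr (\<lambda>j. j + n_exits A) (entr B (i - n_ents A))),
       trans_prob = sum_prob A B,
       reward = case_sum (reward A) (reward B) \<rparr>"

definition romdp_id :: "nat \<Rightarrow> ('q, 'a) romdp" where
  "romdp_id m =
     \<lparr> n_ents = m, n_exits = m, positions = {}, entr = Inr,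
       trans_prob = (\<lambda>_ _ _. 0), reward = (\<lambda>_. 0) \<rparr>"

definition romdp_swap :: "nat \<Rightarrow> nat \<Rightarrow> ('q, 'a) romdp" where
  "romdp_swap m n =
     \<lparr> n_ents = m + n, n_exits = n + m, positions = {},
       entr = (\<lambda>i. Inr (if i < m then i + n else i - m)),
       trans_prob = (\<lambda>_ _ _. 0), reward = (\<lambda>_. 0) \<rparr>"

text \<open>
  \<open>trace_seq A i j\<close> is the \<open>j\<close>-th element of the sequence started at the entrance \<open>i\<close>, each exit
  being fed back as the entrance with the same index. The initial \<open>Inr i\<close> stands for the entrance
  \<open>i\<close>; from index \<open>1\<close> on, \<open>Inr k\<close> is the exit \<open>k\<close>. Values after the sequence has left the exits
  in \<open>{..<l}\<close> are never used.
\<close>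

primrec trace_seq :: "('q, 'a) romdp \<Rightarrow> nat \<Rightarrow> nat \<Rightarrow> 'q + nat" where
  "trace_seq A i 0 = Inr i"
| "trace_seq A i (Suc j) = (case trace_seq A i j of Inl s \<Rightarrow> Inl s | Inr k \<Rightarrow> entr A k)"

definition trace_prec :: "nat \<Rightarrow> ('q, 'a) romdp \<Rightarrow> 'q + nat \<Rightarrow> nat set" where
  "trace_prec l A t =
     {i. i < l \<and> (\<exists>k. trace_seq A i k = t \<and> (\<forall>j<k. trace_seq A i j \<in> Inr ` {..<l}))}"

definition trace_entr :: "nat \<Rightarrow> ('q, 'a) romdp \<Rightarrow> nat \<Rightarrow> 'q + nat" where
  "trace_entr l A i =
     (let k = (LEAST k. k \<ge> 1 \<and> trace_seq A (i + l) k \<notin> Inr ` {..<l})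
      in map_sum id (\<lambda>j. j - l) (trace_seq A (i + l) k))"

definition romdp_trace :: "nat \<Rightarrow> ('q, 'a) romdp \<Rightarrow> ('q, 'a) romdp" where
  "romdp_trace l A =
     \<lparr> n_ents = n_ents A - l, n_exits = n_exits A - l, positions = positions A,
       entr = trace_entr l A,
       trans_prob = (\<lambda>q a t. let t' = map_sum id (\<lambda>j. j + l) t
                      in trans_prob A q a t' + (\<Sum>i \<in> trace_prec l A t'. trans_prob A q a (Inr i))),
       reward = reward A \<rparr>"

section \<open>Traced symmetric monoidal structures on the natural numbers\<close>

text \<open>
  Objects are the natural numbers, the tensor on objects is addition, and the structural
  isomorphisms other than the symmetry are identities.
\<close>

record 'f tsmc =
  hom :: "nat \<Rightarrow> nat \<Rightarrow> 'f set"
  cmp :: "'f \<Rightarrow> 'f \<Rightarrow> 'f"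
  ident :: "nat \<Rightarrow> 'f"
  tens :: "'f \<Rightarrow> 'f \<Rightarrow> 'f"
  swp :: "nat \<Rightarrow> nat \<Rightarrow> 'f"
  tr :: "nat \<Rightarrow> 'f \<Rightarrow> 'f"

subsection \<open>The category of roMDPs\<close>

text \<open>
  As position sets are finite, every isomorphism class has representatives whose positions are
  natural numbers; an arrow is the set of all these representatives.
\<close>

type_synonym 'a romdp_arrow = "(nat, 'a) romdp set"

definition iso_class :: "('q, 'a) romdp \<Rightarrow> 'a romdp_arrow" where
  "iso_class A = {B. is_romdp B \<and> romdp_iso A B}"

definition roMDP :: "('a::finite) romdp_arrow tsmc" where
  "roMDP =
     \<lparr> hom = (\<lambda>m n. {iso_class A | A :: (nat, 'a) romdp.
                       is_romdp A \<and> n_ents A = m \<and> n_exits A = n}),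
       cmp = (\<lambda>X Y. \<Union>A\<in>X. \<Union>B\<in>Y. iso_class (romdp_seq A B)),
       ident = (\<lambda>m. iso_class (romdp_id m :: (nat, 'a) romdp)),
       tens = (\<lambda>X Y. \<Union>A\<in>X. \<Union>B\<in>Y. iso_class (romdp_sum A B)),
       swp = (\<lambda>m n. iso_class (romdp_swap m n :: (nat, 'a) romdp)),
       tr = (\<lambda>l X. \<Union>A\<in>X. iso_class (romdp_trace l A)) \<rparr>"

subsection \<open>The semantic categories\<close>

text \<open>An arrow of the semantic category of Markov chains is a matrix of pairs \<open>(p, r)\<close>.\<close>

type_synonym mc_arrow = "(real \<times> real) mat"

definition mc_hom :: "nat \<Rightarrow> nat \<Rightarrow> mc_arrow set" where
  "mc_hom m n =
     {f \<in> carrier_mat m n.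
        (\<forall>i<m. \<forall>j<n. fst (f $$ (i,j)) \<ge> 0 \<and> snd (f $$ (i,j)) \<ge> 0) \<and>
        (\<forall>i<m. (\<Sum>j<n. fst (f $$ (i,j))) \<le> 1) \<and>
        (\<forall>i<m. \<forall>j<n. fst (f $$ (i,j)) = 0 \<longrightarrow> snd (f $$ (i,j)) = 0)}"

abbreviation p_mat :: "mc_arrow \<Rightarrow> real mat" where
  "p_mat f \<equiv> map_mat fst f"

abbreviation r_mat :: "mc_arrow \<Rightarrow> real mat" where
  "r_mat f \<equiv> map_mat snd f"

definition pair_mat :: "real mat \<Rightarrow> real mat \<Rightarrow> mc_arrow" where
  "pair_mat P R = mat (dim_row P) (dim_col P) (\<lambda>ij. (P $$ ij, R $$ ij))"

definition mc_comp :: "mc_arrow \<Rightarrow> mc_arrow \<Rightarrow> mc_arrow" where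
  "mc_comp f g = pair_mat (p_mat f * p_mat g) (p_mat f * r_mat g + r_mat f * p_mat g)"

definition mc_sum :: "mc_arrow \<Rightarrow> mc_arrow \<Rightarrow> mc_arrow" where
  "mc_sum f g =
     four_block_mat f (0\<^sub>m (dim_row f) (dim_col g)) (0\<^sub>m (dim_row g) (dim_col f)) g"

definition mc_id :: "nat \<Rightarrow> mc_arrow" where
  "mc_id m = mat m m (\<lambda>(i,j). (of_bool (i = j), 0))"

definition mc_swap :: "nat \<Rightarrow> nat \<Rightarrow> mc_arrow" where
  "mc_swap m n =
     mat (m + n) (n + m) (\<lambda>(i,j). (of_bool (j = (if i < m then i + n else i - m)), 0))"

definition submat :: "real mat \<Rightarrow> nat \<Rightarrow> nat \<Rightarrow> nat \<Rightarrow> nat \<Rightarrow> real mat" where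
  "submat M r c nr nc = mat nr nc (\<lambda>(i,j). M $$ (r + i, c + j))"

definition mc_trace :: "nat \<Rightarrow> mc_arrow \<Rightarrow> mc_arrow" where
  "mc_trace l h =
     (let m = dim_row h - l; n = dim_col h - l; P = p_mat h; R = r_mat h;
          A\<^sub>p = submat P l 0 m l; B\<^sub>p = submat P 0 0 l l; C\<^sub>p = submat P 0 l l n;
          A\<^sub>r = submat R l 0 m l; B\<^sub>r = submat R 0 0 l l; C\<^sub>r = submat R 0 l l n;
          A = four_block_mat A\<^sub>p A\<^sub>r (0\<^sub>m 0 l) (0\<^sub>m 0 l);
          B = four_block_mat B\<^sub>p B\<^sub>r (0\<^sub>m l l) B\<^sub>p;
          C = C\<^sub>r @\<^sub>r C\<^sub>p
      in mat m n (\<lambda>(i,j).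
           (P $$ (l + i, l + j) + (\<Sum>d. (A\<^sub>p * B\<^sub>p ^\<^sub>m d * C\<^sub>p) $$ (i,j)),
            R $$ (l + i, l + j) + (\<Sum>d. (A * B ^\<^sub>m d * C) $$ (i,j)))))"

definition semR :: "mc_arrow set tsmc" where
  "semR =
     \<lparr> hom = (\<lambda>m n. Pow (mc_hom m n)),
       cmp = (\<lambda>F G. {mc_comp f g | f g. f \<in> F \<and> g \<in> G}),
       ident = (\<lambda>m. {mc_id m}),
       tens = (\<lambda>F G. {mc_sum f g | f g. f \<in> F \<and> g \<in> G}),
       swp = (\<lambda>m n. {mc_swap m n}),
       tr = (\<lambda>l F. mc_trace l ` F) \<rparr>"

section \<open>The solution functor on roMDPs\<close>

definition induced_mc :: "('q, 'a) romdp \<Rightarrow> ('q \<Rightarrow> 'a) \<Rightarrow> ('q, unit) romdp" where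
  "induced_mc A \<tau> =
     \<lparr> n_ents = n_ents A, n_exits = n_exits A, positions = positions A, entr = entr A,
       trans_prob = (\<lambda>s _ t. trans_prob A s (\<tau> s) t), reward = reward A \<rparr>"

text \<open>A path \<open>i, s\<^sub>1, \<dots>, s\<^sub>k, j\<close> is represented by the list of the positions \<open>s\<^sub>1, \<dots>, s\<^sub>k\<close>.\<close>

definition paths :: "('q, unit) romdp \<Rightarrow> nat \<Rightarrow> nat \<Rightarrow> 'q list set" where
  "paths C i j = {ss. set ss \<subseteq> positions C \<and> hd (map Inl ss @ [Inr j]) = entr C i}"

definition path_prob :: "('q, unit) romdp \<Rightarrow> nat \<Rightarrow> 'q list \<Rightarrow> real" where
  "path_prob C j ss =
     (\<Prod>t<length ss. trans_prob C (ss ! t) () ((map Inl ss @ [Inr j]) ! Suc t))"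

definition path_reward :: "('q, unit) romdp \<Rightarrow> 'q list \<Rightarrow> real" where
  "path_reward C ss = (\<Sum>t<length ss. reward C (ss ! t))"

definition RPr :: "('q, unit) romdp \<Rightarrow> nat \<Rightarrow> nat \<Rightarrow> real" where
  "RPr C i j = (\<Sum>\<^sub>\<infinity>ss \<in> paths C i j. path_prob C j ss)"

definition ERw :: "('q, unit) romdp \<Rightarrow> nat \<Rightarrow> nat \<Rightarrow> real" where
  "ERw C i j = (\<Sum>\<^sub>\<infinity>ss \<in> paths C i j. path_prob C j ss * path_reward C ss)"

definition mc_solution :: "('q, unit) romdp \<Rightarrow> mc_arrow" where
  "mc_solution C = mat (n_ents C) (n_exits C) (\<lambda>(i,j). (RPr C i j, ERw C i j))"

definition romdp_solution :: "('q, 'a) romdp \<Rightarrow> mc_arrow set" where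
  "romdp_solution A = {mc_solution (induced_mc A \<tau>) | \<tau>. True}"

text \<open>Isomorphic roMDPs have the same solution, so this union is over equal sets.\<close>

definition solR :: "'a romdp_arrow \<Rightarrow> mc_arrow set" where
  "solR X = (\<Union>A\<in>X. romdp_solution A)"

section \<open>The Int construction and compact closed functors\<close>

text \<open>
  Structure of a strict compact closed category whose objects are all elements of \<open>'o\<close>. An arrow
  does not determine its source and target, so these are passed explicitly:
  \<open>cc_comp X Y Z f g\<close> is the composite of \<open>f: X \<rightarrow> Y\<close> and \<open>g: Y \<rightarrow> Z\<close>, and
  \<open>cc_tens X Y X' Y' f g\<close> is the monoidal product of \<open>f: X \<rightarrow> Y\<close> and \<open>g: X' \<rightarrow> Y'\<close>. With
  \<open>X\<^sup>*\<close> for \<open>cc_dual X\<close>, the unit \<open>cc_eta X\<close> is an arrow \<open>I \<rightarrow> X \<otimes> X\<^sup>*\<close> and the counit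
  \<open>cc_eps X\<close> an arrow \<open>X\<^sup>* \<otimes> X \<rightarrow> I\<close>.
\<close>

record ('o, 'f) compact_closed =
  cc_hom :: "'o \<Rightarrow> 'o \<Rightarrow> 'f set"
  cc_comp :: "'o \<Rightarrow> 'o \<Rightarrow> 'o \<Rightarrow> 'f \<Rightarrow> 'f \<Rightarrow> 'f"
  cc_id :: "'o \<Rightarrow> 'f"
  cc_I :: 'o
  cc_tens_obj :: "'o \<Rightarrow> 'o \<Rightarrow> 'o"
  cc_tens :: "'o \<Rightarrow> 'o \<Rightarrow> 'o \<Rightarrow> 'o \<Rightarrow> 'f \<Rightarrow> 'f \<Rightarrow> 'f"
  cc_sym :: "'o \<Rightarrow> 'o \<Rightarrow> 'f"
  cc_dual :: "'o \<Rightarrow> 'o"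
  cc_eta :: "'o \<Rightarrow> 'f"
  cc_eps :: "'o \<Rightarrow> 'f"

fun int_comp :: "'f tsmc \<Rightarrow> nat \<times> nat \<Rightarrow> nat \<times> nat \<Rightarrow> nat \<times> nat \<Rightarrow> 'f \<Rightarrow> 'f \<Rightarrow> 'f" where
  "int_comp C (m, m') (l, l') (n, n') f g =
     tr C l'
       (cmp C (tens C (swp C l' m) (ident C n'))
       (cmp C (tens C f (ident C n'))
       (cmp C (tens C (ident C l) (swp C m' n'))
       (cmp C (tens C g (ident C m'))
              (tens C (swp C n l') (ident C m'))))))"

text \<open>
  For \<open>f: m + n' \<rightarrow> n + m'\<close> and \<open>g: k + l' \<rightarrow> l + k'\<close>, the monoidal product is the arrow
  \<open>(m + k) + (n' + l') \<rightarrow> (n + l) + (m' + k')\<close> obtained by permuting the middle wires.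
\<close>

fun int_tens ::
  "'f tsmc \<Rightarrow> nat \<times> nat \<Rightarrow> nat \<times> nat \<Rightarrow> nat \<times> nat \<Rightarrow> nat \<times> nat \<Rightarrow> 'f \<Rightarrow> 'f \<Rightarrow> 'f" where
  "int_tens C (m, m') (n, n') (k, k') (l, l') f g =
     cmp C (tens C (tens C (ident C m) (swp C k n')) (ident C l'))
       (cmp C (tens C f g)
              (tens C (tens C (ident C n) (swp C m' l)) (ident C k')))"

definition Int_cat :: "'f tsmc \<Rightarrow> (nat \<times> nat, 'f) compact_closed" where
  "Int_cat C =
     \<lparr> cc_hom = (\<lambda>(m, m') (n, n'). hom C (m + n') (n + m')),
       cc_comp = int_comp C,
       cc_id = (\<lambda>(m, m'). ident C (m + m')),
       cc_I = (0, 0),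
       cc_tens_obj = (\<lambda>(m, m') (k, k'). (m + k, m' + k')),
       cc_tens = int_tens C,
       cc_sym = (\<lambda>(m, m') (k, k'). tens C (swp C m k) (swp C k' m')),
       cc_dual = (\<lambda>(m, m'). (m', m)),
       cc_eta = (\<lambda>(m, m'). swp C m' m),
       cc_eps = (\<lambda>(m, m'). swp C m' m) \<rparr>"

record ('o, 'f, 'p, 'g) functor_data =
  fobj :: "'o \<Rightarrow> 'p"
  farr :: "'o \<Rightarrow> 'o \<Rightarrow> 'f \<Rightarrow> 'g"

definition Int_functor :: "('f \<Rightarrow> 'g) \<Rightarrow> (nat \<times> nat, 'f, nat \<times> nat, 'g) functor_data" where
  "Int_functor F = \<lparr> fobj = (\<lambda>X. X), farr = (\<lambda>X Y f. F f) \<rparr>"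

text \<open>
  A functor that strictly preserves the symmetric monoidal structure, the duals, the units and the
  counits.
\<close>

definition compact_closed_functor ::
  "('o, 'f) compact_closed \<Rightarrow> ('p, 'g) compact_closed \<Rightarrow> ('o, 'f, 'p, 'g) functor_data \<Rightarrow> bool" where
  "compact_closed_functor C D F \<longleftrightarrow>
     (\<forall>X Y. \<forall>f \<in> cc_hom C X Y. farr F X Y f \<in> cc_hom D (fobj F X) (fobj F Y)) \<and>
     (\<forall>X. farr F X X (cc_id C X) = cc_id D (fobj F X)) \<and>
     (\<forall>X Y Z. \<forall>f \<in> cc_hom C X Y. \<forall>g \<in> cc_hom C Y Z.
        farr F X Z (cc_comp C X Y Z f g) =
        cc_comp D (fobj F X) (fobj F Y) (fobj F Z) (farr F X Y f) (farr F Y Z g)) \<and>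
     fobj F (cc_I C) = cc_I D \<and>
     (\<forall>X Y. fobj F (cc_tens_obj C X Y) = cc_tens_obj D (fobj F X) (fobj F Y)) \<and>
     (\<forall>X Y X' Y'. \<forall>f \<in> cc_hom C X Y. \<forall>g \<in> cc_hom C X' Y'.
        farr F (cc_tens_obj C X X') (cc_tens_obj C Y Y') (cc_tens C X Y X' Y' f g) =
        cc_tens D (fobj F X) (fobj F Y) (fobj F X') (fobj F Y') (farr F X Y f) (farr F X' Y' g)) \<and>
     (\<forall>X Y. farr F (cc_tens_obj C X Y) (cc_tens_obj C Y X) (cc_sym C X Y) =
        cc_sym D (fobj F X) (fobj F Y)) \<and>
     (\<forall>X. fobj F (cc_dual C X) = cc_dual D (fobj F X)) \<and>
     (\<forall>X. farr F (cc_I C) (cc_tens_obj C X (cc_dual C X)) (cc_eta C X) = cc_eta D (fobj F X)) \<and>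
     (\<forall>X. farr F (cc_tens_obj C (cc_dual C X) X) (cc_I C) (cc_eps C X) = cc_eps D (fobj F X))"

definition oMDP :: "(nat \<times> nat, ('a::finite) romdp_arrow) compact_closed" where
  "oMDP = Int_cat roMDP"

definition Sem :: "(nat \<times> nat, mc_arrow set) compact_closed" where
  "Sem = Int_cat semR"

definition Sol :: "(nat \<times> nat, ('a::finite) romdp_arrow, nat \<times> nat, mc_arrow set) functor_data" where
  "Sol = Int_functor solR"

end

theory Submission
  imports Defs
begin

text \<open>
  A path of probability \<open>p\<close> and reward \<open>r\<close> gets as weight the dual number \<open>p + p r \<epsilon>\<close> with
  \<open>\<epsilon>\<^sup>2 = 0\<close>, the product of the weights \<open>P(s, t) (1 + R(s) \<epsilon>)\<close> of its steps. Under this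
  reading, composition and trace in the semantic category of Markov chains are matrix product and
  \<open>D + \<Sum>\<^sub>d A B\<^sup>d C\<close> over the dual numbers. Prescribing values \<open>c\<close> at the exits of a chain, the
  expected values at its positions are the least nonnegative solution of the linear system
  \<open>v(s) = (1 + R(s) \<epsilon>) \<Sum>\<^sub>t P(s, t) v(t)\<close>. Sequential composition, sum and trace of chains merge,
  juxtapose and close such systems, and in each case the two sides of the required identity are
  compared by leastness in both directions. Unique access ensures that wires fed back by the trace
  form no cycle that a position or a remaining entrance leads into, so no probability is lost.
\<close>

section \<open>Dual numbers\<close>

text \<open>Leastness takes the place of uniqueness because the systems have many solutions: on a
  closed set of positions where every step has total mass 1, any constant multiple of \<epsilon>
  satisfies the equations, whatever the rewards. The least nonnegative solution has no such spurious
  part, and it is the one that path sums produce. Each identity then splits into two inequalities: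
  gluing solutions of the components gives a supersolution for the composite, and restricting the
  solution of the composite gives supersolutions for the components.

  The analytic obstacle is finiteness of the least solution. Infinitely many steps may be spent
  among recurrent positions, so expected running times give no bound; but only reward along paths
  that do reach the exit counts, and this is what \<open>hit_bounded\<close> estimates.

  For the trace, the unknowns are the values on the \<open>l\<close> fed-back wires. They form the
  least solution of a system \<open>y = b + L y\<close> of size \<open>l\<close>, and iterating from
  0 turns it into the series of \<open>mc_trace\<close>.\<close>

datatype dnum = Dn (dre: real) (dep: real)

lemma dnum_eqI: "dre x = dre y \<Longrightarrow> dep x = dep y \<Longrightarrow> x = y"
  by (cases x; cases y) simp

instantiation dnum :: comm_ring_1
begin

definition "0 = Dn 0 0"
definition "1 = Dn 1 0"
definition "x + y = Dn (dre x + dre y) (dep x + dep y)"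
definition "- x = Dn (- dre x) (- dep x)"
definition "x - y = Dn (dre x - dre y) (dep x - dep y)"
definition "x * y = Dn (dre x * dre y) (dre x * dep y + dep x * dre y)"

instance
  by standard
    (auto simp: zero_dnum_def one_dnum_def plus_dnum_def uminus_dnum_def minus_dnum_def
      times_dnum_def algebra_simps intro: dnum_eqI)

end

text \<open>The componentwise order is only partial, but products of nonnegative elements have
  nonnegative components. One inequality thus controls probability and reward together.\<close>

instantiation dnum :: ordered_comm_ring
begin

definition "x \<le> y \<longleftrightarrow> dre x \<le> dre y \<and> dep x \<le> dep y"
definition "x < y \<longleftrightarrow> x \<le> y \<and> \<not> y \<le> (x :: dnum)"

instance
  by standard
    (auto simp: less_eq_dnum_def less_dnum_def zero_dnum_def plus_dnum_def times_dnum_def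
      intro!: dnum_eqI add_mono mult_left_mono mult_right_mono)

end

instantiation dnum :: real_vector
begin

definition "c *\<^sub>R x = Dn (c * dre x) (c * dep x)"

instance
  by standard (auto simp: scaleR_dnum_def plus_dnum_def algebra_simps)

end

lemma dnum_sel [simp]:
  "dre 0 = 0" "dep 0 = 0" "dre 1 = 1" "dep 1 = 0"
  "dre (x + y) = dre x + dre y" "dep (x + y) = dep x + dep y"
  "dre (x - y) = dre x - dre y" "dep (x - y) = dep x - dep y"
  "dre (x * y) = dre x * dre y" "dep (x * y) = dre x * dep y + dep x * dre y"
  "dre (c *\<^sub>R x) = c * dre x" "dep (c *\<^sub>R x) = c * dep x"
  by (auto simp: zero_dnum_def one_dnum_def plus_dnum_def minus_dnum_def times_dnum_def
      scaleR_dnum_def)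

lemma dre_sum [simp]: "dre (sum f S) = (\<Sum>x\<in>S. dre (f x))"
  and dep_sum [simp]: "dep (sum f S) = (\<Sum>x\<in>S. dep (f x))"
  by (induction S rule: infinite_finite_induct) auto

lemma dre_of_bool [simp]: "dre (of_bool b) = of_bool b"
  and dep_of_bool [simp]: "dep (of_bool b) = 0"
  by (cases b; simp)+

lemma of_bool_dnum_nonneg [simp]: "0 \<le> (of_bool b :: dnum)"
  by (cases b) (auto simp: less_eq_dnum_def)

lemma scaleR_mult_dnum: "(c *\<^sub>R x) * y = c *\<^sub>R (x * y)" "x * (c *\<^sub>R y) = c *\<^sub>R (x * (y :: dnum))"
  by (auto intro!: dnum_eqI simp: algebra_simps)

lemma scaleR_mono_dnum: "0 \<le> c \<Longrightarrow> x \<le> y \<Longrightarrow> c *\<^sub>R x \<le> c *\<^sub>R (y :: dnum)"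
  by (auto simp: less_eq_dnum_def mult_left_mono)

lemma scaleR_nonneg_dnum: "0 \<le> c \<Longrightarrow> 0 \<le> x \<Longrightarrow> 0 \<le> c *\<^sub>R (x :: dnum)"
  by (auto simp: less_eq_dnum_def)

text \<open>Convergence is componentwise; the type carries an algebraic structure and an order, and
  no topology is put on it.\<close>

definition dlim :: "(nat \<Rightarrow> dnum) \<Rightarrow> dnum \<Rightarrow> bool" where
  "dlim f L \<longleftrightarrow> (\<lambda>k. dre (f k)) \<longlonglongrightarrow> dre L \<and> (\<lambda>k. dep (f k)) \<longlonglongrightarrow> dep L"

lemma dlim_unique: "dlim f L \<Longrightarrow> dlim f M \<Longrightarrow> L = M"
  unfolding dlim_def by (auto intro!: dnum_eqI intro: LIMSEQ_unique)

lemma dlim_const: "dlim (\<lambda>_. c) c"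
  unfolding dlim_def by auto

lemma dlim_Suc: "dlim f L \<Longrightarrow> dlim (\<lambda>k. f (Suc k)) L"
  unfolding dlim_def by (auto intro: LIMSEQ_Suc)

lemma dlim_add: "dlim f L \<Longrightarrow> dlim g M \<Longrightarrow> dlim (\<lambda>k. f k + g k) (L + M)"
  unfolding dlim_def by (auto intro!: tendsto_intros)

lemma dlim_mult: "dlim f L \<Longrightarrow> dlim g M \<Longrightarrow> dlim (\<lambda>k. f k * g k) (L * M)"
  unfolding dlim_def by (auto intro!: tendsto_intros)

lemma dlim_scaleR: "dlim f L \<Longrightarrow> dlim (\<lambda>k. c *\<^sub>R f k) (c *\<^sub>R L)"
  unfolding dlim_def by (auto intro!: tendsto_intros)

lemma dlim_sum:
  "(\<And>x. x \<in> S \<Longrightarrow> dlim (f x) (L x)) \<Longrightarrow> dlim (\<lambda>k. \<Sum>x\<in>S. f x k) (\<Sum>x\<in>S. L x)"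
  unfolding dlim_def by (auto intro!: tendsto_intros)

lemma dlim_le: "dlim f L \<Longrightarrow> (\<And>k. f k \<le> b) \<Longrightarrow> L \<le> b"
  unfolding dlim_def less_eq_dnum_def by (auto intro: LIMSEQ_le_const2)

lemma dlim_ge: "dlim f L \<Longrightarrow> (\<And>k. b \<le> f k) \<Longrightarrow> b \<le> L"
  unfolding dlim_def less_eq_dnum_def by (auto intro: LIMSEQ_le_const)

lemma dlim_bounded_monotone:
  assumes "incseq f" "\<And>k. f k \<le> b"
  shows "\<exists>L. dlim f L"
proof -
  have "incseq (\<lambda>k. dre (f k))" "incseq (\<lambda>k. dep (f k))"
    using assms(1) by (auto simp: incseq_def less_eq_dnum_def)
  moreover have "\<And>k. dre (f k) \<le> dre b" "\<And>k. dep (f k) \<le> dep b"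
    using assms(2) by (auto simp: less_eq_dnum_def)
  ultimately obtain x y where "(\<lambda>k. dre (f k)) \<longlonglongrightarrow> x" "(\<lambda>k. dep (f k)) \<longlonglongrightarrow> y"
    by (metis incseq_convergent)
  then show ?thesis
    by (intro exI[of _ "Dn x y"]) (auto simp: dlim_def)
qed

section \<open>Expected values of one step\<close>

text \<open>Values lie in any real vector space: reals serve for masses and probabilities, dual
  numbers for weights.\<close>

definition ev :: "('q, 'a) romdp \<Rightarrow> 'a \<Rightarrow> 'q \<Rightarrow> ('q + nat \<Rightarrow> 'v::real_vector) \<Rightarrow> 'v" where
  "ev A a s v = (\<Sum>t\<in>targets A. trans_prob A s a t *\<^sub>R v t)"

lemma targets_simps [simp]:
  "Inl s \<in> targets A \<longleftrightarrow> s \<in> positions A" "Inr j \<in> targets A \<longleftrightarrow> j < n_exits A"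
  by (auto simp: targets_def)

lemma is_romdpD:
  assumes "is_romdp A"
  shows "finite (positions A)" "finite (targets A)"
    "\<And>i. i < n_ents A \<Longrightarrow> entr A i \<in> targets A"
    "\<And>s a t. s \<in> positions A \<Longrightarrow> t \<in> targets A \<Longrightarrow> 0 \<le> trans_prob A s a t"
    "\<And>s a. s \<in> positions A \<Longrightarrow> (\<Sum>t\<in>targets A. trans_prob A s a t) \<in> {0, 1}"
    "\<And>s. s \<in> positions A \<Longrightarrow> 0 \<le> reward A s"
    "unique_access A"
  using assms by (auto simp: is_romdp_def targets_def)

lemma ev_cong: "(\<And>t. t \<in> targets A \<Longrightarrow> v t = w t) \<Longrightarrow> ev A a s v = ev A a s w"
  unfolding ev_def by (auto intro: sum.cong)

lemma ev_diff: "ev A a s (\<lambda>t. v t - w t) = ev A a s v - ev A a s w"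
  unfolding ev_def by (simp add: scaleR_diff_right sum_subtractf)

lemma ev_scaleR: "ev A a s (\<lambda>t. c *\<^sub>R v t) = c *\<^sub>R ev A a s v"
  unfolding ev_def by (simp add: scaleR_sum_right mult.commute)

lemma ev_sum: "ev A a s (\<lambda>t. \<Sum>k\<in>S. v k t) = (\<Sum>k\<in>S. ev A a s (v k))"
  unfolding ev_def by (simp add: scaleR_sum_right sum.swap[of _ _ S])

lemma ev_dnum_mult_right: "ev A a s (\<lambda>t. v t * c) = ev A a s v * (c :: dnum)"
  unfolding ev_def by (simp add: scaleR_mult_dnum sum_distrib_right)

lemma dre_ev: "dre (ev A a s v) = ev A a s (\<lambda>t. dre (v t))"
  and dep_ev: "dep (ev A a s v) = ev A a s (\<lambda>t. dep (v t))"
  unfolding ev_def by simp_all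

lemma ev_mono:
  assumes "is_romdp A" "s \<in> positions A" "\<And>t. t \<in> targets A \<Longrightarrow> v t \<le> (w t :: real)"
  shows "ev A a s v \<le> ev A a s w"
  unfolding ev_def using assms by (auto intro!: sum_mono mult_left_mono is_romdpD)

lemma ev_mono_dnum:
  assumes "is_romdp A" "s \<in> positions A" "\<And>t. t \<in> targets A \<Longrightarrow> v t \<le> (w t :: dnum)"
  shows "ev A a s v \<le> ev A a s w"
  unfolding ev_def using assms by (auto intro!: sum_mono scaleR_mono_dnum is_romdpD)

lemma ev_one:
  assumes "is_romdp A" "s \<in> positions A"
  shows "ev A a s (\<lambda>_. 1 :: real) \<in> {0, 1}"
  using is_romdpD(5)[OF assms] unfolding ev_def by simp

lemma dlim_ev: "(\<And>t. t \<in> targets A \<Longrightarrow> dlim (v t) (L t)) \<Longrightarrow> dlim (\<lambda>k. ev A a s (\<lambda>t. v t k)) (ev A a s L)"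
  unfolding ev_def by (intro dlim_sum dlim_scaleR)

lemma tendsto_ev:
  fixes L :: "_ \<Rightarrow> real"
  assumes "\<And>t. t \<in> targets A \<Longrightarrow> v t \<longlonglongrightarrow> L t"
  shows "(\<lambda>k. ev A a s (\<lambda>t. v t k)) \<longlonglongrightarrow> ev A a s L"
  unfolding ev_def using assms by (auto intro!: tendsto_intros)

abbreviation rstep :: "('q, unit) romdp \<Rightarrow> 'q \<Rightarrow> ('q + nat \<Rightarrow> dnum) \<Rightarrow> dnum" where
  "rstep C s v \<equiv> Dn 1 (reward C s) * ev C () s v"

lemma Dn_nonneg: "0 \<le> x \<Longrightarrow> 0 \<le> y \<Longrightarrow> 0 \<le> Dn x y"
  by (simp add: less_eq_dnum_def)

lemma rstep_mono:
  assumes "is_romdp C" "s \<in> positions C" "\<And>t. t \<in> targets C \<Longrightarrow> v t \<le> w t"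
  shows "rstep C s v \<le> rstep C s w"
  using assms by (intro mult_left_mono ev_mono_dnum Dn_nonneg) (auto intro: is_romdpD)

section \<open>Reaching an exit\<close>

text \<open>Iterates of the linear system with exit value 1 at \<open>j\<close> and 0 at the other
  exits, started from 0 on all positions. Stage \<open>K\<close> collects the paths with at most
  \<open>K\<close> positions, see \<open>hit_eq_sum_paths\<close>.\<close>

primrec hit :: "('q, unit) romdp \<Rightarrow> nat \<Rightarrow> nat \<Rightarrow> 'q + nat \<Rightarrow> dnum" where
  "hit C j 0 = (\<lambda>t. of_bool (t = Inr j))"
| "hit C j (Suc K) = (\<lambda>t. case t of Inl s \<Rightarrow> rstep C s (hit C j K) | Inr i \<Rightarrow> of_bool (i = j))"

lemma hit_Inr [simp]: "hit C j K (Inr i) = of_bool (i = j)"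
  by (cases K) auto

lemma hit_step:
  assumes "is_romdp C" "t \<in> targets C"
  shows "0 \<le> hit C j K t \<and> hit C j K t \<le> hit C j (Suc K) t"
  using assms(2)
proof (induction K arbitrary: t)
  case 0
  have "0 \<le> rstep C s (hit C j 0)" if "s \<in> positions C" for s
    using rstep_mono[OF assms(1) that, of "\<lambda>_. 0" "hit C j 0"] by (simp add: ev_def)
  then show ?case using 0 by (cases t) (auto simp del: of_bool_eq)
next
  case (Suc K)
  show ?case
  proof (cases t)
    case (Inl s)
    then have s: "s \<in> positions C" using Suc.prems by simp
    have "0 \<le> rstep C s (hit C j K)"
      using rstep_mono[OF assms(1) s, of "\<lambda>_. 0" "hit C j K"] Suc.IH by (simp add: ev_def)
    moreover have "rstep C s (hit C j K) \<le> rstep C s (hit C j (Suc K))"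
      using Suc.IH s by (intro rstep_mono[OF assms(1)]) auto
    ultimately show ?thesis using Inl by simp
  qed simp
qed

text \<open>Leastness before the limit. By linearity of \<open>rstep\<close>, the combination of the
  iterates with the exit values of \<open>v\<close> obeys the recursion of \<open>hit\<close>; it
  starts below \<open>v\<close> since it vanishes on positions, and a step keeps it below
  \<open>rstep C s v\<close>, hence below \<open>v\<close>.\<close>

lemma hit_le_of_super:
  assumes C: "is_romdp C"
    and nn: "\<And>t. t \<in> targets C \<Longrightarrow> 0 \<le> v t"
    and super: "\<And>s. s \<in> positions C \<Longrightarrow> rstep C s v \<le> v (Inl s)"
    and t: "t \<in> targets C"
  shows "(\<Sum>j<n_exits C. hit C j K t * v (Inr j)) \<le> v t"
  using t
proof (induction K arbitrary: t)
  case 0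
  then show ?case
    by (cases t) (auto simp: nn of_bool_def if_distribR if_distrib[of "\<lambda>x. x * _"] cong: if_cong)
next
  case (Suc K)
  show ?case
  proof (cases t)
    case (Inl s)
    then have s: "s \<in> positions C" using Suc.prems by simp
    have "(\<Sum>j<n_exits C. hit C j (Suc K) t * v (Inr j)) =
        rstep C s (\<lambda>t. \<Sum>j<n_exits C. hit C j K t * v (Inr j))"
      by (simp add: Inl ev_sum ev_dnum_mult_right sum_distrib_left mult.assoc)
    also have "\<dots> \<le> rstep C s v"
      by (rule rstep_mono[OF C s Suc.IH])
    also have "\<dots> \<le> v t" using super[OF s] Inl by simp
    finally show ?thesis .
  next
    case (Inr i)
    then show ?thesis using Suc.prems
      by (auto simp: of_bool_def if_distribR if_distrib[of "\<lambda>x. x * _"] cong: if_cong)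
  qed
qed

text \<open>The constant 1 is a supersolution for probabilities only; as a dual number it fails at
  positions with mass 1 and positive reward. The induction therefore runs on first components
  instead of using \<open>hit_le_of_super\<close>.\<close>

lemma sum_dre_hit_le_1:
  assumes C: "is_romdp C" and t: "t \<in> targets C"
  shows "(\<Sum>j<n_exits C. dre (hit C j K t)) \<le> 1"
  using t
proof (induction K arbitrary: t)
  case 0
  then show ?case by (cases t) (auto simp: of_bool_def if_distrib[of dre] cong: if_cong)
next
  case (Suc K)
  show ?case
  proof (cases t)
    case (Inl s)
    then have s: "s \<in> positions C" using Suc.prems by simp
    have "(\<Sum>j<n_exits C. dre (hit C j (Suc K) t)) =
        ev C () s (\<lambda>t. \<Sum>j<n_exits C. dre (hit C j K t))"
      by (simp add: Inl ev_sum dre_ev)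
    also have "\<dots> \<le> ev C () s (\<lambda>_. 1)"
      by (rule ev_mono[OF C s Suc.IH])
    also have "\<dots> \<le> 1" using ev_one[OF C s, of "()"] by auto
    finally show ?thesis .
  qed (simp add: of_bool_def if_distrib[of dre] cong: if_cong)
qed

lemma dre_hit_le_1:
  assumes "is_romdp C" "t \<in> targets C" "j < n_exits C"
  shows "dre (hit C j K t) \<le> 1"
proof -
  have "dre (hit C j K t) \<le> (\<Sum>j<n_exits C. dre (hit C j K t))"
    using assms hit_step[OF assms(1,2)]
    by (intro member_le_sum) (auto simp: less_eq_dnum_def)
  then show ?thesis using sum_dre_hit_le_1[OF assms(1,2), of K] by linarith
qed

text \<open>The reward component is where recurrent positions could cause divergence.  With \<open>p\<close> the
  probability of reaching \<open>j\<close> and \<open>D k\<close> that of reaching it after more than \<open>k\<close> positions, some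
  \<open>n\<close> has \<open>D n \<le> p / 2\<close> (there are finitely many positions), so \<open>2 \<rho> (D 0 + \<dots> + D (n - 1))\<close>
  dominates the expected reward when \<open>\<rho>\<close> bounds the rewards.\<close>

lemma hit_bounded:
  assumes C: "is_romdp C" and j: "j < n_exits C"
  shows "\<exists>u. \<forall>K. \<forall>t\<in>targets C. hit C j K t \<le> u t"
proof -
  define q where "q K t = dre (hit C j K t)" for K t
  have q_inc: "q K t \<le> q (Suc K) t" and q_nn: "0 \<le> q K t" if "t \<in> targets C" for K t
    using hit_step[OF C that, of j K] by (auto simp: q_def less_eq_dnum_def)
  have q_le: "q K t \<le> 1" if "t \<in> targets C" for K t
    unfolding q_def by (rule dre_hit_le_1[OF C that j])
  have q_Suc: "q (Suc K) (Inl s) = ev C () s (q K)" for K s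
    by (simp add: q_def[abs_def] dre_ev)
  have "\<exists>L. (\<lambda>K. q K t) \<longlonglongrightarrow> L" if "t \<in> targets C" for t
    using incseq_convergent[OF incseq_SucI, of "\<lambda>K. q K t" 1] q_inc[OF that] q_le[OF that] by metis
  then obtain p where p: "\<And>t. t \<in> targets C \<Longrightarrow> (\<lambda>K. q K t) \<longlonglongrightarrow> p t"
    by metis
  have q_le_p: "q K t \<le> p t" if "t \<in> targets C" for K t
    using that p q_inc by (intro incseq_le) (auto intro: incseq_SucI)
  have p_step: "p (Inl s) = ev C () s p" if s: "s \<in> positions C" for s
  proof (rule LIMSEQ_unique)
    show "(\<lambda>K. q (Suc K) (Inl s)) \<longlonglongrightarrow> p (Inl s)"
      using s by (intro LIMSEQ_Suc p) simp
    show "(\<lambda>K. q (Suc K) (Inl s)) \<longlonglongrightarrow> ev C () s p"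
      unfolding q_Suc using p by (intro tendsto_ev)
  qed
  define D where "D K t = p t - q K t" for K t
  have D_Suc: "D (Suc K) (Inl s) = ev C () s (D K)" if "s \<in> positions C" for K s
    using p_step[OF that] by (simp add: D_def[abs_def] q_Suc ev_diff)
  \<comment> \<open>Convergence of \<open>D K t\<close> to 0 gives this only for
    \<open>p t > 0\<close>. If \<open>p t = 0\<close>, the bound holds at every stage because
    \<open>D K t\<close> is then at most 0.\<close>
  have "eventually (\<lambda>K. D K t \<le> p t / 2) sequentially" if t: "t \<in> targets C" for t
  proof (cases "p t = 0")
    case True
    then show ?thesis using q_nn[OF t] by (auto simp: D_def)
  next
    case False
    then have "0 < p t" using q_le_p[OF t, of 0] q_nn[OF t, of 0] by linarith
    moreover have "(\<lambda>K. D K t) \<longlonglongrightarrow> p t - p t"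
      unfolding D_def by (intro tendsto_intros p t)
    ultimately show ?thesis
      using order_tendstoD(2)[of "\<lambda>K. D K t" 0 sequentially "p t / 2"]
      by (auto elim: eventually_mono)
  qed
  then have "eventually (\<lambda>K. \<forall>t\<in>targets C. D K t \<le> p t / 2) sequentially"
    using is_romdpD(2)[OF C] by (auto intro: eventually_ball_finite)
  then obtain n where n: "\<And>t. t \<in> targets C \<Longrightarrow> D n t \<le> p t / 2"
    by (auto simp: eventually_sequentially)
  define \<rho> where "\<rho> = (\<Sum>s\<in>positions C. reward C s)"
  have \<rho>: "reward C s \<le> \<rho>" if "s \<in> positions C" for s
    unfolding \<rho>_def using that is_romdpD[OF C] by (auto intro!: member_le_sum)
  have \<rho>0: "0 \<le> \<rho>"
    unfolding \<rho>_def using is_romdpD[OF C] by (auto intro!: sum_nonneg)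
  define u where "u t = Dn (p t) (2 * \<rho> * (\<Sum>k<n. D k t))" for t
  have D_nn: "0 \<le> D K t" if "t \<in> targets C" for K t
    using q_le_p[OF that] by (simp add: D_def)
  have u_super: "rstep C s u \<le> u (Inl s)" if s: "s \<in> positions C" for s
  proof -
    have "ev C () s (\<lambda>t. dep (u t)) = 2 * \<rho> * (\<Sum>k<n. D (Suc k) (Inl s))"
      using ev_scaleR[of C "()" s "2 * \<rho>" "\<lambda>t. \<Sum>k<n. D k t"]
      by (simp add: u_def D_Suc[OF s] ev_sum)
    \<comment> \<open>One step of the chain shifts \<open>k\<close> to \<open>k + 1\<close>, so the
      sum telescopes to its old value minus \<open>D 0 - D n\<close>; this loss has to pay for the
      reward of the step.\<close>
    also have "(\<Sum>k<n. D (Suc k) (Inl s)) = (\<Sum>k<n. D k (Inl s)) + D n (Inl s) - D 0 (Inl s)"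
      using sum.lessThan_Suc_shift[of "\<lambda>k. D k (Inl s)" n] by simp
    also have "2 * \<rho> * \<dots> = dep (u (Inl s)) - 2 * \<rho> * (D 0 (Inl s) - D n (Inl s))"
      by (simp add: u_def algebra_simps)
    finally have ev_dep: "ev C () s (\<lambda>t. dep (u t)) =
      dep (u (Inl s)) - 2 * \<rho> * (D 0 (Inl s) - D n (Inl s))" .
    \<comment> \<open>At stage 0 a position has reached no exit, so
      \<open>D 0 (Inl s) = p (Inl s)\<close>, while \<open>D n\<close> is at most half of
      \<open>p\<close>. The factor 2 in \<open>u\<close> makes up for this half.\<close>
    have "p (Inl s) \<le> 2 * (D 0 (Inl s) - D n (Inl s))"
      using n[of "Inl s"] s by (simp add: D_def q_def)
    then have "\<rho> * p (Inl s) \<le> 2 * \<rho> * (D 0 (Inl s) - D n (Inl s))"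
      using mult_left_mono[OF _ \<rho>0] by (fastforce simp: algebra_simps)
    moreover have "reward C s * p (Inl s) \<le> \<rho> * p (Inl s)"
      using \<rho>[OF s] q_le_p[of "Inl s" 0] q_nn[of "Inl s" 0] s by (intro mult_right_mono) auto
    moreover have "ev C () s (\<lambda>t. dre (u t)) = p (Inl s)"
      by (simp add: u_def p_step[OF s])
    ultimately show ?thesis
      using ev_dep by (simp add: less_eq_dnum_def dre_ev dep_ev u_def)
  qed
  have u_ge: "hit C j 0 t \<le> u t" if "t \<in> targets C" for t
    using that \<rho>0 q_le_p[OF that, of 0] D_nn[OF that]
    by (auto simp: u_def less_eq_dnum_def q_def intro!: mult_nonneg_nonneg sum_nonneg)
  have "hit C j K t \<le> u t" if "t \<in> targets C" for K t
    using that
  proof (induction K arbitrary: t)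
    case 0
    then show ?case by (rule u_ge)
  next
    case (Suc K)
    show ?case
    proof (cases t)
      case (Inl s)
      then have s: "s \<in> positions C" using Suc.prems by simp
      have "rstep C s (hit C j K) \<le> rstep C s u"
        by (rule rstep_mono[OF C s Suc.IH])
      then show ?thesis using u_super[OF s] Inl by simp
    next
      case (Inr i)
      then show ?thesis using u_ge[OF Suc.prems] by simp
    qed
  qed
  then show ?thesis by blast
qed

section \<open>Path sums as limits of the iterates\<close>

text \<open>Every finite set of lists has bounded length, so the length-bounded parts of
  \<open>S\<close> are cofinal among its finite subsets. This turns the unordered sums in
  \<open>RPr\<close> and \<open>ERw\<close> into limits along the length.\<close>

lemma sum_by_length_tendsto_infsum:
  fixes f :: "'b list \<Rightarrow> real"
  assumes nn: "\<And>x. x \<in> S \<Longrightarrow> 0 \<le> f x"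
    and fin: "\<And>K. finite {x \<in> S. length x \<le> K}"
    and bd: "\<And>K. sum f {x \<in> S. length x \<le> K} \<le> B"
  shows "f summable_on S" "(\<lambda>K. sum f {x \<in> S. length x \<le> K}) \<longlonglongrightarrow> infsum f S"
proof -
  have ex: "\<exists>K. X \<subseteq> {x \<in> S. length x \<le> K}" if "finite X" "X \<subseteq> S" for X
    using that by (intro exI[of _ "Max (length ` X)"]) auto
  show summ: "f summable_on S"
  proof (rule nonneg_bdd_above_summable_on[OF nn])
    show "bdd_above (sum f ` {F. F \<subseteq> S \<and> finite F})"
    proof (rule bdd_aboveI2)
      fix X assume "X \<in> {F. F \<subseteq> S \<and> finite F}"
      then obtain K where "X \<subseteq> {x \<in> S. length x \<le> K}" using ex by blast
      then have "sum f X \<le> sum f {x \<in> S. length x \<le> K}"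
        using fin nn by (intro sum_mono2) auto
      then show "sum f X \<le> B" using bd order_trans by blast
    qed
  qed
  have "filterlim (\<lambda>K. {x \<in> S. length x \<le> K}) (finite_subsets_at_top S) sequentially"
    unfolding filterlim_finite_subsets_at_top
  proof (intro allI impI)
    fix X assume X: "finite X \<and> X \<subseteq> S"
    then obtain K where K: "X \<subseteq> {x \<in> S. length x \<le> K}" using ex by blast
    show "\<forall>\<^sub>F K in sequentially. finite {x \<in> S. length x \<le> K} \<and>
        X \<subseteq> {x \<in> S. length x \<le> K} \<and> {x \<in> S. length x \<le> K} \<subseteq> S"
      using K fin by (intro eventually_sequentiallyI[of K]) force
  qed
  moreover have "(sum f \<longlongrightarrow> infsum f S) (finite_subsets_at_top S)"
    using has_sum_infsum[OF summ] by (simp add: has_sum_def)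
  ultimately show "(\<lambda>K. sum f {x \<in> S. length x \<le> K}) \<longlonglongrightarrow> infsum f S"
    by (rule filterlim_compose[rotated])
qed

text \<open>\<open>paths C i j\<close> is \<open>tpaths C j (entr C i)\<close>; starting from a
  target instead of an entrance allows recursion on the first position.\<close>

definition tpaths :: "('q, unit) romdp \<Rightarrow> nat \<Rightarrow> 'q + nat \<Rightarrow> 'q list set" where
  "tpaths C j t = {ss. set ss \<subseteq> positions C \<and> hd (map Inl ss @ [Inr j]) = t}"

definition path_weight :: "('q, unit) romdp \<Rightarrow> nat \<Rightarrow> 'q list \<Rightarrow> dnum" where
  "path_weight C j ss = Dn (path_prob C j ss) (path_prob C j ss * path_reward C ss)"

definition reach :: "('q, unit) romdp \<Rightarrow> nat \<Rightarrow> 'q + nat \<Rightarrow> dnum" where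
  "reach C j t = Dn (\<Sum>\<^sub>\<infinity>ss\<in>tpaths C j t. path_prob C j ss)
     (\<Sum>\<^sub>\<infinity>ss\<in>tpaths C j t. path_prob C j ss * path_reward C ss)"

lemma mc_solution_eq_reach:
  "mc_solution C = mat (n_ents C) (n_exits C)
     (\<lambda>(i,j). (dre (reach C j (entr C i)), dep (reach C j (entr C i))))"
  unfolding mc_solution_def RPr_def ERw_def reach_def tpaths_def paths_def by simp

lemma path_weight_Nil [simp]: "path_weight C j [] = 1"
  by (simp add: path_weight_def path_prob_def path_reward_def one_dnum_def)

lemma path_prob_Cons: "path_prob C j (s # ss) =
    trans_prob C s () (hd (map Inl ss @ [Inr j])) * path_prob C j ss"
  unfolding path_prob_def by (simp add: prod.lessThan_Suc_shift hd_conv_nth del: prod.lessThan_Suc)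

lemma path_weight_Cons: "path_weight C j (s # ss) =
    Dn 1 (reward C s) * (trans_prob C s () (hd (map Inl ss @ [Inr j])) *\<^sub>R path_weight C j ss)"
proof -
  have "path_reward C (s # ss) = reward C s + path_reward C ss"
    unfolding path_reward_def by (simp add: sum.lessThan_Suc_shift del: sum.lessThan_Suc)
  then show ?thesis
    by (intro dnum_eqI) (simp_all add: path_weight_def path_prob_Cons algebra_simps)
qed

lemma finite_tpaths_length:
  assumes "finite (positions C)"
  shows "finite {ss \<in> tpaths C j t. length ss \<le> K}"
  by (rule finite_subset[OF _ finite_lists_length_le[OF assms, of K]]) (auto simp: tpaths_def)

lemma hd_target:
  "set ss \<subseteq> positions C \<Longrightarrow> j < n_exits C \<Longrightarrow> hd (map Inl ss @ [Inr j]) \<in> targets C"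
  by (cases ss) auto

lemma hit_eq_sum_paths:
  assumes C: "is_romdp C" and j: "j < n_exits C" and t: "t \<in> targets C"
  shows "hit C j K t = (\<Sum>ss | ss \<in> tpaths C j t \<and> length ss \<le> K. path_weight C j ss)"
  using t
proof (induction K arbitrary: t)
  case 0
  have "{ss \<in> tpaths C j t. length ss \<le> 0} = (if t = Inr j then {[]} else {})"
    by (auto simp: tpaths_def)
  then show ?case by simp
next
  case (Suc K)
  show ?case
  proof (cases t)
    case (Inr i)
    have "{ss \<in> tpaths C j (Inr i). length ss \<le> Suc K} = (if i = j then {[]} else {})"
      by (auto simp: tpaths_def hd_append hd_map split: if_splits)
    then show ?thesis by (simp add: Inr)
  next
    case (Inl s)
    then have s: "s \<in> positions C" using Suc.prems by simp
    let ?P = "\<lambda>t. {ss \<in> tpaths C j t. length ss \<le> K}"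
    \<comment> \<open>Dropping the first position leaves a path, one position shorter, from exactly
      one of the targets of the step.\<close>
    have "{ss \<in> tpaths C j t. length ss \<le> Suc K} = (#) s ` (\<Union>t\<in>targets C. ?P t)"
    proof -
      have "ss \<in> (#) s ` (\<Union>t\<in>targets C. ?P t)"
        if "set ss \<subseteq> positions C" "hd (map Inl ss @ [Inr j]) = Inl s" "length ss \<le> Suc K" for ss
        using that hd_target[OF _ j, of "tl ss"] by (cases ss) (auto simp: tpaths_def)
      then show ?thesis using s by (auto simp: tpaths_def Inl)
    qed
    then have "(\<Sum>ss | ss \<in> tpaths C j t \<and> length ss \<le> Suc K. path_weight C j ss) =
        (\<Sum>ss\<in>(\<Union>t\<in>targets C. ?P t). path_weight C j (s # ss))"
      by (simp add: sum.reindex)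
    also have "\<dots> = (\<Sum>t\<in>targets C. \<Sum>ss\<in>?P t. path_weight C j (s # ss))"
      using is_romdpD(1,2)[OF C] finite_tpaths_length
      by (intro sum.UNION_disjoint) (auto simp: tpaths_def)
    also have "\<dots> = (\<Sum>t\<in>targets C. \<Sum>ss\<in>?P t.
        Dn 1 (reward C s) * (trans_prob C s () t *\<^sub>R path_weight C j ss))"
      by (intro sum.cong) (auto simp: path_weight_Cons tpaths_def)
    also have "\<dots> = rstep C s (hit C j K)"
      unfolding ev_def using Suc.IH
      by (simp add: sum_distrib_left scaleR_sum_right)
    finally show ?thesis by (simp add: Inl)
  qed
qed

lemma path_prob_nonneg:
  assumes C: "is_romdp C" and j: "j < n_exits C" and "set ss \<subseteq> positions C"
  shows "0 \<le> path_prob C j ss"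
  using assms(3)
proof (induction ss)
  case (Cons s ss)
  then show ?case
    using hd_target[OF _ j, of ss] is_romdpD(4)[OF C, of s] by (auto simp: path_prob_Cons)
qed (simp add: path_prob_def)

lemma path_reward_nonneg:
  "is_romdp C \<Longrightarrow> set ss \<subseteq> positions C \<Longrightarrow> 0 \<le> path_reward C ss"
  unfolding path_reward_def by (intro sum_nonneg is_romdpD) (auto simp: subset_iff)

text \<open>The two components of the bound from \<open>hit_bounded\<close> bound the partial sums
  of the probabilities and of the rewarded probabilities. Summability is recorded separately, since
  a non-summable \<open>infsum\<close> is 0 by default and its vanishing would say nothing.\<close>

lemma
  assumes C: "is_romdp C" and j: "j < n_exits C" and t: "t \<in> targets C"
  shows path_prob_summable: "path_prob C j summable_on tpaths C j t"
    and hit_tendsto_reach: "dlim (\<lambda>K. hit C j K t) (reach C j t)"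
proof -
  obtain w where "\<forall>K. \<forall>t\<in>targets C. hit C j K t \<le> w t"
    using hit_bounded[OF C j] ..
  then have u: "\<And>K. hit C j K t \<le> w t" using t by simp
  have p_nn: "\<And>ss. ss \<in> tpaths C j t \<Longrightarrow> 0 \<le> path_prob C j ss"
    using path_prob_nonneg[OF C j] by (auto simp: tpaths_def)
  have r_nn: "\<And>ss. ss \<in> tpaths C j t \<Longrightarrow> 0 \<le> path_prob C j ss * path_reward C ss"
    using p_nn path_reward_nonneg[OF C] by (auto simp: tpaths_def)
  note fin = finite_tpaths_length[OF is_romdpD(1)[OF C]]
  note hit = hit_eq_sum_paths[OF C j t]
  have p_bd: "sum (path_prob C j) {ss \<in> tpaths C j t. length ss \<le> K} \<le> dre (w t)" for K
    using u[of K] hit[of K] by (simp add: less_eq_dnum_def path_weight_def)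
  have r_bd: "(\<Sum>ss | ss \<in> tpaths C j t \<and> length ss \<le> K. path_prob C j ss * path_reward C ss)
      \<le> dep (w t)" for K
    using u[of K] hit[of K] by (simp add: less_eq_dnum_def path_weight_def)
  show "path_prob C j summable_on tpaths C j t"
    by (rule sum_by_length_tendsto_infsum(1)[OF p_nn fin p_bd])
  show "dlim (\<lambda>K. hit C j K t) (reach C j t)"
    using sum_by_length_tendsto_infsum(2)[OF p_nn fin p_bd]
      sum_by_length_tendsto_infsum(2)[OF r_nn fin r_bd]
    by (simp add: dlim_def hit path_weight_def reach_def)
qed

lemma reach_nonneg:
  assumes "is_romdp C" "j < n_exits C" "t \<in> targets C"
  shows "0 \<le> reach C j t"
  by (rule dlim_ge[OF hit_tendsto_reach[OF assms]]) (use hit_step[OF assms(1,3)] in blast)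

lemma reach_Inr: "is_romdp C \<Longrightarrow> j < n_exits C \<Longrightarrow> i < n_exits C \<Longrightarrow> reach C j (Inr i) = of_bool (i = j)"
  using dlim_unique[OF hit_tendsto_reach[of C j "Inr i"], of "of_bool (i = j)"]
  by (simp add: dlim_const)

lemma reach_Inl:
  assumes C: "is_romdp C" and j: "j < n_exits C" and s: "s \<in> positions C"
  shows "reach C j (Inl s) = rstep C s (reach C j)"
proof (rule dlim_unique)
  show "dlim (\<lambda>K. hit C j (Suc K) (Inl s)) (reach C j (Inl s))"
    by (intro dlim_Suc hit_tendsto_reach C j) (simp add: s)
  have "dlim (\<lambda>K. rstep C s (hit C j K)) (rstep C s (reach C j))"
    by (intro dlim_mult dlim_const dlim_ev hit_tendsto_reach[OF C j])
  then show "dlim (\<lambda>K. hit C j (Suc K) (Inl s)) (rstep C s (reach C j))" by simp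
qed

lemma mc_solution_in_mc_hom:
  assumes C: "is_romdp C"
  shows "mc_solution C \<in> mc_hom (n_ents C) (n_exits C)"
proof -
  have nn: "0 \<le> reach C j (entr C i)" if "i < n_ents C" "j < n_exits C" for i j
    using reach_nonneg[OF C] is_romdpD(3)[OF C] that by blast
  have "(\<Sum>j<n_exits C. dre (reach C j t)) \<le> 1" if t: "t \<in> targets C" for t
  proof (rule LIMSEQ_le_const2)
    show "(\<lambda>K. \<Sum>j<n_exits C. dre (hit C j K t)) \<longlonglongrightarrow> (\<Sum>j<n_exits C. dre (reach C j t))"
      using hit_tendsto_reach[OF C _ t] by (intro tendsto_sum) (auto simp: dlim_def)
  qed (use sum_dre_hit_le_1[OF C t] in blast)
  moreover have "dep (reach C j t) = 0"
    if t: "t \<in> targets C" and j: "j < n_exits C" and 0: "dre (reach C j t) = 0" for t j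
  proof -
    \<comment> \<open>A summable family of nonnegative terms with sum 0 vanishes termwise, so the
      rewarded terms vanish as well.\<close>
    have "path_prob C j ss = 0" if "ss \<in> tpaths C j t" for ss
      using that 0 path_prob_nonneg[OF C j]
      by (intro nonneg_infsum_le_0D[OF _ path_prob_summable[OF C j t]])
        (auto simp: reach_def tpaths_def)
    then have "(\<Sum>\<^sub>\<infinity>ss\<in>tpaths C j t. path_prob C j ss * path_reward C ss) = 0"
      by (intro infsum_0) simp
    then show ?thesis by (simp add: reach_def)
  qed
  ultimately show ?thesis
    using nn is_romdpD(3)[OF C] by (auto simp: mc_hom_def mc_solution_eq_reach less_eq_dnum_def)
qed

section \<open>Least solutions with prescribed exit values\<close>

text \<open>For nonnegative \<open>c\<close>, the least nonnegative solution of the system with exit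
  values \<open>c\<close>, by \<open>val_Inr\<close>, \<open>val_Inl\<close> and
  \<open>val_least\<close>. Superposing the \<open>reach C j\<close> makes linearity in
  \<open>c\<close> immediate.\<close>

definition val :: "('q, unit) romdp \<Rightarrow> (nat \<Rightarrow> dnum) \<Rightarrow> 'q + nat \<Rightarrow> dnum" where
  "val C c t = (\<Sum>j<n_exits C. reach C j t * c j)"

lemma val_Inr: "is_romdp C \<Longrightarrow> i < n_exits C \<Longrightarrow> val C c (Inr i) = c i"
  unfolding val_def
  by (simp add: reach_Inr of_bool_def if_distribR if_distrib[of "\<lambda>x. x * _"] cong: if_cong)

lemma val_Inl:
  assumes "is_romdp C" "s \<in> positions C"
  shows "val C c (Inl s) = rstep C s (val C c)"
  unfolding val_def using assms
  by (simp add: reach_Inl ev_sum ev_dnum_mult_right sum_distrib_left mult.assoc)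

lemma val_mono:
  assumes "is_romdp C" "t \<in> targets C" "\<And>j. j < n_exits C \<Longrightarrow> c j \<le> d j"
  shows "val C c t \<le> val C d t"
  unfolding val_def using assms by (auto intro!: sum_mono mult_left_mono reach_nonneg)

lemma val_nonneg:
  assumes "is_romdp C" "t \<in> targets C" "\<And>j. j < n_exits C \<Longrightarrow> 0 \<le> c j"
  shows "0 \<le> val C c t"
  using val_mono[OF assms] by (simp add: val_def)

lemma val_cong: "(\<And>j. j < n_exits C \<Longrightarrow> c j = d j) \<Longrightarrow> val C c t = val C d t"
  unfolding val_def by simp

lemma reach_eq_val: "j < n_exits C \<Longrightarrow> reach C j t = val C (\<lambda>i. of_bool (i = j)) t"
  unfolding val_def by (simp add: of_bool_def if_distrib[of "\<lambda>x. _ * x"] cong: if_cong)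

text \<open>The limit of \<open>hit_le_of_super\<close>. All inequalities between solutions of
  composed, summed or traced chains come from this lemma, applied to a glued or restricted
  \<open>v\<close>.\<close>

lemma val_least:
  assumes C: "is_romdp C"
    and nn: "\<And>t. t \<in> targets C \<Longrightarrow> 0 \<le> v t"
    and super: "\<And>s. s \<in> positions C \<Longrightarrow> rstep C s v \<le> v (Inl s)"
    and t: "t \<in> targets C"
  shows "val C (\<lambda>j. v (Inr j)) t \<le> v t"
proof (rule dlim_le)
  show "dlim (\<lambda>K. \<Sum>j<n_exits C. hit C j K t * v (Inr j)) (val C (\<lambda>j. v (Inr j)) t)"
    unfolding val_def
    by (intro dlim_sum dlim_mult[OF hit_tendsto_reach[OF C _ t] dlim_const]) simp
qed (rule hit_le_of_super[OF assms])

lemma in_Plus_simps [simp]: "Inl x \<in> S <+> T \<longleftrightarrow> x \<in> S" "Inr y \<in> S <+> T \<longleftrightarrow> y \<in> T"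
  by auto

lemma sum_targets:
  "finite (positions A) \<Longrightarrow> (\<Sum>t\<in>targets A. f t) =
     (\<Sum>s\<in>positions A. f (Inl s)) + (\<Sum>j<n_exits A. f (Inr j))"
  unfolding targets_def by (simp add: sum.Plus comp_def)

lemma sum_targets_delta:
  fixes f :: "'q + nat \<Rightarrow> 'v::real_vector"
  shows "finite (targets A) \<Longrightarrow> (\<Sum>t\<in>targets A. of_bool (x = t) *\<^sub>R f t) = (if x \<in> targets A then f x else 0)"
  by (simp add: of_bool_def if_distribR if_distrib[of "\<lambda>x. x *\<^sub>R _"] cong: if_cong)

text \<open>Counting a position once per action merges the two clauses of unique access into one.\<close>

fun accesses :: "('q, 'a) romdp \<Rightarrow> nat + 'q \<times> 'a \<Rightarrow> nat \<Rightarrow> bool" where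
  "accesses A (Inl i) t \<longleftrightarrow> entr A i = Inr t"
| "accesses A (Inr (s, a)) t \<longleftrightarrow> trans_prob A s a (Inr t) > 0"

definition sources :: "('q, 'a) romdp \<Rightarrow> (nat + 'q \<times> 'a) set" where
  "sources A = {..<n_ents A} <+> positions A \<times> UNIV"

lemma sources_simps [simp]:
  "Inl i \<in> sources A \<longleftrightarrow> i < n_ents A" "Inr (s, a) \<in> sources A \<longleftrightarrow> s \<in> positions A"
  by (auto simp: sources_def)

lemma unique_access_iff:
  fixes A :: "('q, 'a) romdp"
  shows "unique_access A \<longleftrightarrow>
     (\<forall>t<n_exits A. \<forall>x\<in>sources A. \<forall>y\<in>sources A. accesses A x t \<longrightarrow> accesses A y t \<longrightarrow> x = y)"
    (is "_ \<longleftrightarrow> ?R")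
proof
  assume U: "unique_access A"
  show ?R
  proof (intro allI ballI impI)
    fix t x y
    assume t: "t < n_exits A" and x: "x \<in> sources A" "accesses A x t"
      and y: "y \<in> sources A" "accesses A y t"
    \<comment> \<open>\<open>f\<close> forgets the action: the first clause of unique access
      identifies the images under \<open>f\<close>, the second one the actions.\<close>
    define f :: "nat + 'q \<times> 'a \<Rightarrow> nat + 'q" where "f = map_sum id fst"
    have "t \<in> exits A (f z)" "f z \<in> {..<n_ents A} <+> positions A"
      if "z \<in> sources A" "accesses A z t" for z
      using that t by (cases z; force simp: f_def sources_def)+
    then have "f x = f y"
      using U x y unfolding unique_access_def by blast
    then show "x = y"
      using U x y t unfolding unique_access_def
      by (cases x; cases y) (auto simp: f_def)
  qed
next
  assume R: ?R
  have "x = y" if x: "x \<in> {..<n_ents A} <+> positions A" "t \<in> exits A x"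
    and y: "y \<in> {..<n_ents A} <+> positions A" "t \<in> exits A y" for x y t
  proof -
    have "\<exists>z\<in>sources A. accesses A z t \<and> map_sum id fst z = x \<and> t < n_exits A"
      if x: "x \<in> {..<n_ents A} <+> positions A" "t \<in> exits A x" for x
    proof (cases x)
      case (Inl i)
      then show ?thesis using that by (intro bexI[of _ "Inl i"]) auto
    next
      case (Inr s)
      then obtain a where "trans_prob A s a (Inr t) > 0" "t < n_exits A" "s \<in> positions A"
        using x by auto
      then show ?thesis using Inr by (intro bexI[of _ "Inr (s, a)"]) auto
    qed
    from this[OF x] this[OF y] show ?thesis using R by blast
  qed
  moreover have "a = b" if "s \<in> positions A" "t < n_exits A"
    "trans_prob A s a (Inr t) > 0" "trans_prob A s b (Inr t) > 0" for s a b t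
    using R[rule_format, of t "Inr (s, a)" "Inr (s, b)"] that by simp
  ultimately show "unique_access A"
    unfolding unique_access_def by blast
qed

lemma unique_accessD:
  assumes "is_romdp A" "t < n_exits A" "x \<in> sources A" "accesses A x t" "y \<in> sources A" "accesses A y t"
  shows "x = y"
  using assms is_romdpD(7) unique_access_iff by blast

text \<open>Stating the mass condition through \<open>ev\<close> lets it follow, for each operation,
  from the formula for \<open>ev\<close> of the result at the constant 1.\<close>

lemma is_romdpI:
  assumes "finite (positions A)"
    "\<And>i. i < n_ents A \<Longrightarrow> entr A i \<in> targets A"
    "\<And>s a t. s \<in> positions A \<Longrightarrow> t \<in> targets A \<Longrightarrow> 0 \<le> trans_prob A s a t"
    "\<And>s a. s \<in> positions A \<Longrightarrow> ev A a s (\<lambda>_. 1 :: real) \<in> {0, 1}"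
    "\<And>s. s \<in> positions A \<Longrightarrow> 0 \<le> reward A s"
    "\<And>t x y. t < n_exits A \<Longrightarrow> x \<in> sources A \<Longrightarrow> y \<in> sources A \<Longrightarrow>
       accesses A x t \<Longrightarrow> accesses A y t \<Longrightarrow> x = y"
  shows "is_romdp A"
  unfolding is_romdp_def unique_access_iff using assms by (auto simp: ev_def)

section \<open>Schedulers\<close>

lemma induced_mc_simps [simp]:
  "n_ents (induced_mc A \<tau>) = n_ents A" "n_exits (induced_mc A \<tau>) = n_exits A"
  "positions (induced_mc A \<tau>) = positions A" "entr (induced_mc A \<tau>) = entr A"
  "trans_prob (induced_mc A \<tau>) s u t = trans_prob A s (\<tau> s) t" "reward (induced_mc A \<tau>) = reward A"
  "targets (induced_mc A \<tau>) = targets A"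
  by (auto simp: induced_mc_def targets_def)

lemma is_romdp_induced_mc:
  assumes A: "is_romdp A"
  shows "is_romdp (induced_mc A \<tau>)"
proof (rule is_romdpI)
  fix t x y
  assume t: "t < n_exits (induced_mc A \<tau>)"
    and x: "x \<in> sources (induced_mc A \<tau>)" "accesses (induced_mc A \<tau>) x t"
    and y: "y \<in> sources (induced_mc A \<tau>)" "accesses (induced_mc A \<tau>) y t"
  \<comment> \<open>A position of the chain is read as the pair of the position and its scheduled
    action; injectivity of \<open>f\<close> brings unique access back to the chain.\<close>
  define f where "f = map_sum (id :: nat \<Rightarrow> nat) (\<lambda>(s, _::unit). (s, \<tau> s))"
  have f: "f z \<in> sources A \<and> accesses A (f z) t"
    if "z \<in> sources (induced_mc A \<tau>)" "accesses (induced_mc A \<tau>) z t" for z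
    using that by (cases z) (auto simp: f_def)
  have "f x = f y"
    using f[OF x] f[OF y] t by (intro unique_accessD[OF A, of t]) auto
  then show "x = y" by (cases x; cases y) (auto simp: f_def)
qed (use is_romdpD[OF A] in \<open>auto simp: ev_def\<close>)

section \<open>Sequential composition\<close>

lemma seq_simps [simp]:
  "n_ents (romdp_seq A B) = n_ents A" "n_exits (romdp_seq A B) = n_exits B"
  "positions (romdp_seq A B) = positions A <+> positions B"
  "trans_prob (romdp_seq A B) = seq_prob A B" "reward (romdp_seq A B) = case_sum (reward A) (reward B)"
  by (auto simp: romdp_seq_def)

text \<open>Where a target of \<open>A\<close> ends up in the composite. Entrances and transitions
  of \<open>A\<close> are both redirected by this one map.\<close>

definition seq_target :: "('r, 'a) romdp \<Rightarrow> 'q + nat \<Rightarrow> ('q + 'r) + nat" where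
  "seq_target B t = (case t of Inl s \<Rightarrow> Inl (Inl s) | Inr k \<Rightarrow> map_sum Inr id (entr B k))"

lemma entr_seq: "entr (romdp_seq A B) i = seq_target B (entr A i)"
  by (auto simp: romdp_seq_def seq_target_def)

lemma seq_target_in_targets:
  assumes "is_romdp B" "n_exits A = n_ents B" "t \<in> targets A"
  shows "seq_target B t \<in> targets (romdp_seq A B)"
proof (cases t)
  case (Inr k)
  then have "entr B k \<in> targets B" using assms is_romdpD(3) by fastforce
  then show ?thesis using Inr by (cases "entr B k") (auto simp: seq_target_def)
qed (use assms in \<open>auto simp: seq_target_def\<close>)

text \<open>The transition probabilities of the composite at a position of \<open>A\<close> are the
  image of those of \<open>A\<close> under \<open>seq_target\<close>, so expectations are pulled
  back along this map.\<close>

lemma ev_seq_Inl: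
  assumes A: "is_romdp A" and B: "is_romdp B" and AB: "n_exits A = n_ents B"
  shows "ev (romdp_seq A B) a (Inl s) v = ev A a s (\<lambda>t. v (seq_target B t))"
proof -
  note fin = is_romdpD(1)[OF A] is_romdpD(1,2)[OF B]
  have fin': "finite (positions (romdp_seq A B))" using fin by simp
  let ?w = "\<lambda>t. v (map_sum Inr id t)"
  let ?P = "\<lambda>i. trans_prob A s a (Inr i)"
  have "(\<Sum>s'\<in>positions B. (\<Sum>i<n_exits A. ?P i * of_bool (entr B i = Inl s')) *\<^sub>R ?w (Inl s')) +
      (\<Sum>j<n_exits B. (\<Sum>i<n_exits A. ?P i * of_bool (entr B i = Inr j)) *\<^sub>R ?w (Inr j)) =
      (\<Sum>t\<in>targets B. (\<Sum>i<n_exits A. ?P i * of_bool (entr B i = t)) *\<^sub>R ?w t)"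
    by (subst sum_targets[OF fin(2)]) simp
  also have "\<dots> = (\<Sum>i<n_exits A. ?P i *\<^sub>R (\<Sum>t\<in>targets B. of_bool (entr B i = t) *\<^sub>R ?w t))"
    by (simp add: scaleR_sum_left scaleR_sum_right sum.swap[of _ "targets B"]
        del: sum_mult_of_bool_eq sum_of_bool_mult_eq)
  also have "\<dots> = (\<Sum>i<n_exits A. ?P i *\<^sub>R ?w (entr B i))"
    using is_romdpD(3)[OF B] AB by (auto simp: sum_targets_delta[OF fin(3)] intro!: sum.cong)
  finally show ?thesis
    unfolding ev_def sum_targets[OF fin'] sum_targets[OF fin(1)]
    by (simp add: sum.Plus[OF fin(1,2)] comp_def seq_target_def add.assoc)
qed

lemma ev_seq_Inr:
  assumes "finite (positions A)" "finite (positions B)"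
  shows "ev (romdp_seq A B) a (Inr s) v = ev B a s (\<lambda>t. v (map_sum Inr id t))"
  unfolding ev_def using assms by (simp add: sum_targets sum.Plus comp_def)

lemma is_romdp_seq:
  assumes A: "is_romdp A" and B: "is_romdp B" and AB: "n_exits A = n_ents B"
  shows "is_romdp (romdp_seq A B)"
proof (rule is_romdpI)
  fix i assume "i < n_ents (romdp_seq A B)"
  then show "entr (romdp_seq A B) i \<in> targets (romdp_seq A B)"
    using is_romdpD(3)[OF A] by (simp add: entr_seq seq_target_in_targets[OF B AB])
next
  fix s a t assume "s \<in> positions (romdp_seq A B)" "t \<in> targets (romdp_seq A B)"
  then show "0 \<le> trans_prob (romdp_seq A B) s a t"
    using is_romdpD(4)[OF A] is_romdpD(4)[OF B]
    by (cases "(A, B, s, a, t)" rule: seq_prob.cases) (auto intro!: sum_nonneg)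
next
  fix s a assume s: "s \<in> positions (romdp_seq A B)"
  show "ev (romdp_seq A B) a s (\<lambda>_. 1::real) \<in> {0, 1}"
  proof (cases s)
    case (Inl s')
    then show ?thesis using s ev_one[OF A, of s' a] unfolding Inl ev_seq_Inl[OF A B AB] by auto
  next
    case (Inr s')
    then show ?thesis
      using s ev_one[OF B, of s' a] ev_seq_Inr[OF is_romdpD(1)[OF A] is_romdpD(1)[OF B], of a s' "\<lambda>_. 1::real"]
      by auto
  qed
next
  let ?S = "romdp_seq A B"
  fix t x y
  assume t: "t < n_exits ?S" and x: "x \<in> sources ?S" "accesses ?S x t"
    and y: "y \<in> sources ?S" "accesses ?S y t"
  define f :: "nat + 'a \<times> 'b \<Rightarrow> nat + ('a + 'c) \<times> 'b"
    where "f = map_sum id (\<lambda>(s, a). (Inl s, a))"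
  \<comment> \<open>A source accesses \<open>t\<close> either through a connecting wire
    \<open>k\<close> or from inside \<open>B\<close>. Unique access of \<open>B\<close> decides
    between the two and fixes \<open>k\<close>; unique access of \<open>A\<close> at
    \<open>k\<close> then fixes the source.\<close>
  have split: "(\<exists>z'\<in>sources A. \<exists>k<n_exits A. z = f z' \<and> accesses A z' k \<and> accesses B (Inl k) t) \<or>
      (\<exists>s a. z = Inr (Inr s, a) \<and> s \<in> positions B \<and> accesses B (Inr (s, a)) t)"
    if z: "z \<in> sources ?S" "accesses ?S z t" for z
  proof (cases z)
    case (Inl i)
    then have i: "i < n_ents A" "seq_target B (entr A i) = Inr t"
      using z by (auto simp: entr_seq)
    show ?thesis
    proof (cases "entr A i")
      case (Inr k)
      moreover have "k < n_exits A" using is_romdpD(3)[OF A i(1)] Inr by simp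
      moreover have "entr B k = Inr t" using i Inr by (cases "entr B k") (auto simp: seq_target_def)
      ultimately show ?thesis using i Inl by (intro disjI1 bexI[of _ "Inl i"]) (auto simp: f_def)
    qed (use i in \<open>auto simp: seq_target_def\<close>)
  next
    case (Inr sa)
    then obtain s a where sa: "z = Inr (s, a)" by (cases sa) auto
    show ?thesis
    proof (cases s)
      case s: (Inl s')
      then have "(\<Sum>i<n_exits A. trans_prob A s' a (Inr i) * of_bool (entr B i = Inr t)) > 0"
        using z sa by simp
      then obtain k where k: "k < n_exits A" "trans_prob A s' a (Inr k) * of_bool (entr B k = Inr t) > 0"
        by (metis (no_types, lifting) lessThan_iff not_le sum_nonpos)
      then have "trans_prob A s' a (Inr k) > 0" "entr B k = Inr t"
        by (auto simp: of_bool_def split: if_splits)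
      then show ?thesis using k sa s z
        by (intro disjI1 bexI[of _ "Inr (s', a)"] exI[of _ k]) (auto simp: f_def)
    next
      case (Inr s')
      then show ?thesis using z sa by auto
    qed
  qed
  have tB: "t < n_exits B" using t by simp
  show "x = y"
    using split[OF x] split[OF y]
  proof (elim disjE bexE exE conjE)
    fix x' k y' k'
    assume *: "x' \<in> sources A" "k < n_exits A" "x = f x'" "accesses A x' k" "accesses B (Inl k) t"
      "y' \<in> sources A" "k' < n_exits A" "y = f y'" "accesses A y' k'" "accesses B (Inl k') t"
    then have "k = k'"
      using unique_accessD[OF B tB, of "Inl k" "Inl k'"] AB by auto
    then show "x = y" using unique_accessD[OF A, of k x' y'] * by auto
  next
    fix k s a
    assume "k < n_exits A" "accesses B (Inl k) t" "s \<in> positions B" "accesses B (Inr (s, a)) t"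
    then show "x = y"
      using unique_accessD[OF B tB, of "Inl k" "Inr (s, a)"] AB by auto
  next
    fix k s a
    assume "k < n_exits A" "accesses B (Inl k) t" "s \<in> positions B" "accesses B (Inr (s, a)) t"
    then show "x = y"
      using unique_accessD[OF B tB, of "Inl k" "Inr (s, a)"] AB by auto
  next
    fix s a s' a'
    assume "x = Inr (Inr s, a)" "y = Inr (Inr s', a')" "s \<in> positions B" "s' \<in> positions B"
      "accesses B (Inr (s, a)) t" "accesses B (Inr (s', a')) t"
    then show "x = y"
      using unique_accessD[OF B tB, of "Inr (s, a)" "Inr (s', a')"] by auto
  qed
qed (use is_romdpD[OF A] is_romdpD[OF B] in auto)

text \<open>Upper bound: \<open>w\<close> glues the solution of \<open>A\<close> with exit values
  \<open>c\<close> to that of \<open>B\<close>; the pieces agree along \<open>seq_target\<close>, so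
  \<open>w\<close> solves the system of the composite. Lower bound: the solution of the composite
  restricts to supersolutions for \<open>B\<close> and for \<open>A\<close>. \<open>B\<close> is
  treated first because its values at the entrances are the exit values prescribed to
  \<open>A\<close>.\<close>

lemma reach_seq:
  fixes A :: "('q, unit) romdp" and B :: "('r, unit) romdp"
  assumes A: "is_romdp A" and B: "is_romdp B" and AB: "n_exits A = n_ents B"
    and j: "j < n_exits B" and t: "t \<in> targets A"
  shows "reach (romdp_seq A B) j (seq_target B t) = val A (\<lambda>k. reach B j (entr B k)) t"
proof -
  let ?S = "romdp_seq A B"
  have S: "is_romdp ?S" by (rule is_romdp_seq[OF A B AB])
  have jS: "j < n_exits ?S" using j by simp
  note evA = ev_seq_Inl[OF A B AB]
  note evB = ev_seq_Inr[OF is_romdpD(1)[OF A] is_romdpD(1)[OF B]]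
  define c where "c k = reach B j (entr B k)" for k
  define w where "w t = (case t of Inl (Inl s) \<Rightarrow> val A c (Inl s)
    | Inl (Inr s) \<Rightarrow> reach B j (Inl s) | Inr i \<Rightarrow> reach B j (Inr i))" for t
  have w_B: "w (map_sum Inr id t) = reach B j t" for t
    by (cases t) (auto simp: w_def)
  have w_A: "w (seq_target B t) = val A c t" if "t \<in> targets A" for t
    using that by (cases t) (auto simp: seq_target_def w_B val_Inr[OF A] c_def, simp add: w_def)
  have entrB: "entr B k \<in> targets B" if "k < n_exits A" for k
    using is_romdpD(3)[OF B] AB that by simp
  have c_nn: "0 \<le> c k" if "k < n_exits A" for k
    unfolding c_def by (rule reach_nonneg[OF B j entrB[OF that]])
  have le: "reach ?S j t \<le> w t" if t: "t \<in> targets ?S" for t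
  proof -
    have "val ?S (\<lambda>i. w (Inr i)) t \<le> w t"
    proof (rule val_least[OF S _ _ t])
      fix t assume "t \<in> targets ?S"
      then show "0 \<le> w t"
        using c_nn by (auto simp: w_def targets_def intro!: reach_nonneg[OF B j] val_nonneg[OF A])
    next
      fix s assume "s \<in> positions ?S"
      then have "s \<in> positions A <+> positions B" by simp
      then show "rstep ?S s w \<le> w (Inl s)"
      proof (elim PlusE)
        fix s' assume s: "s' \<in> positions A" "s = Inl s'"
        have "rstep ?S s w = rstep A s' (val A c)"
          unfolding s(2) evA by (simp add: w_A cong: ev_cong)
        then show ?thesis using val_Inl[OF A s(1), of c] s(2) by (simp add: w_def)
      next
        fix s' assume s: "s' \<in> positions B" "s = Inr s'"
        have "rstep ?S s w = rstep B s' (reach B j)"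
          unfolding s(2) evB by (simp add: w_B)
        then show ?thesis using reach_Inl[OF B j s(1)] s(2) by (simp add: w_def)
      qed
    qed
    moreover have "reach ?S j t = val ?S (\<lambda>i. w (Inr i)) t"
      unfolding reach_eq_val[OF jS] by (rule val_cong) (simp add: w_def reach_Inr[OF B j])
    ultimately show ?thesis by simp
  qed
  have inB: "map_sum Inr id t \<in> targets ?S" if "t \<in> targets B" for t
    using that by (cases t) auto
  have geB: "reach B j t \<le> reach ?S j (map_sum Inr id t)" if t: "t \<in> targets B" for t
  proof -
    have "val B (\<lambda>i. reach ?S j (map_sum Inr id (Inr i))) t \<le> reach ?S j (map_sum Inr id t)"
    proof (rule val_least[OF B _ _ t])
      fix t assume "t \<in> targets B"
      then show "0 \<le> reach ?S j (map_sum Inr id t)" by (intro reach_nonneg[OF S jS] inB)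
    next
      fix s assume s: "s \<in> positions B"
      then have "reach ?S j (Inl (Inr s)) = rstep ?S (Inr s) (reach ?S j)"
        by (intro reach_Inl[OF S jS]) simp
      then show "rstep B s (\<lambda>t. reach ?S j (map_sum Inr id t)) \<le> reach ?S j (map_sum Inr id (Inl s))"
        unfolding evB by simp
    qed
    moreover have "reach B j t = val B (\<lambda>i. reach ?S j (map_sum Inr id (Inr i))) t"
      unfolding reach_eq_val[OF j] by (rule val_cong) (simp add: reach_Inr[OF S jS])
    ultimately show ?thesis by simp
  qed
  have "val A (\<lambda>k. reach ?S j (seq_target B (Inr k))) t \<le> reach ?S j (seq_target B t)"
  proof (rule val_least[OF A _ _ t])
    fix t assume "t \<in> targets A"
    then show "0 \<le> reach ?S j (seq_target B t)"
      by (intro reach_nonneg[OF S jS] seq_target_in_targets[OF B AB])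
  next
    fix s assume s: "s \<in> positions A"
    then have "reach ?S j (Inl (Inl s)) = rstep ?S (Inl s) (reach ?S j)"
      by (intro reach_Inl[OF S jS]) simp
    then show "rstep A s (\<lambda>t. reach ?S j (seq_target B t)) \<le> reach ?S j (seq_target B (Inl s))"
      unfolding evA by (simp add: seq_target_def)
  qed
  moreover have "val A c t \<le> val A (\<lambda>k. reach ?S j (seq_target B (Inr k))) t"
    using geB[OF entrB] by (intro val_mono[OF A t]) (simp add: c_def seq_target_def)
  ultimately have "val A c t \<le> reach ?S j (seq_target B t)" by simp
  moreover have "reach ?S j (seq_target B t) \<le> val A c t"
    using le[OF seq_target_in_targets[OF B AB t]] w_A[OF t] by simp
  ultimately show ?thesis by (simp add: c_def[abs_def])
qed

lemma mc_solution_seq: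
  assumes A: "is_romdp A" and B: "is_romdp B" and AB: "n_exits A = n_ents B"
  shows "mc_solution (romdp_seq A B) = mc_comp (mc_solution A) (mc_solution B)"
proof (rule eq_matI)
  fix i j assume "i < dim_row (mc_comp (mc_solution A) (mc_solution B))"
    and "j < dim_col (mc_comp (mc_solution A) (mc_solution B))"
  then have i: "i < n_ents A" and j: "j < n_exits B"
    by (auto simp: mc_comp_def pair_mat_def mc_solution_eq_reach)
  show "mc_solution (romdp_seq A B) $$ (i, j) = mc_comp (mc_solution A) (mc_solution B) $$ (i, j)"
    using i j AB reach_seq[OF A B AB j is_romdpD(3)[OF A i]]
    by (simp add: mc_solution_eq_reach mc_comp_def pair_mat_def entr_seq val_def scalar_prod_def
        sum.distrib lessThan_atLeast0)
qed (auto simp: mc_comp_def pair_mat_def mc_solution_eq_reach)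

lemma induced_mc_seq:
  "induced_mc (romdp_seq A B) \<tau> = romdp_seq (induced_mc A (\<tau> \<circ> Inl)) (induced_mc B (\<tau> \<circ> Inr))"
proof -
  \<comment> \<open>The action stays a variable tied to \<open>s\<close> by an equation, so that the
    induction rule of \<open>seq_prob\<close> applies to general arguments.\<close>
  have "\<tau> s = a \<Longrightarrow> seq_prob A B s a t =
      seq_prob (induced_mc A (\<tau> \<circ> Inl)) (induced_mc B (\<tau> \<circ> Inr)) s u t" for s a t and u :: unit
    by (induction A B s a t rule: seq_prob.induct) auto
  then show ?thesis
    by (intro romdp.equality) (auto simp: fun_eq_iff romdp_seq_def induced_mc_def split: sum.split)
qed

text \<open>A memoryless scheduler on a disjoint union of positions is the same as an independent
  pair of schedulers, which is what elementwise composition of sets ranges over.\<close>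

lemma romdp_solution_seq:
  assumes A: "is_romdp A" and B: "is_romdp B" and AB: "n_exits A = n_ents B"
  shows "romdp_solution (romdp_seq A B) =
    {mc_comp f g | f g. f \<in> romdp_solution A \<and> g \<in> romdp_solution B}"
proof -
  have "mc_solution (induced_mc (romdp_seq A B) \<tau>) =
      mc_comp (mc_solution (induced_mc A (\<tau> \<circ> Inl))) (mc_solution (induced_mc B (\<tau> \<circ> Inr)))" for \<tau>
    unfolding induced_mc_seq using AB
    by (intro mc_solution_seq is_romdp_induced_mc A B) simp
  moreover have "\<exists>\<tau>. \<tau> \<circ> Inl = \<tau>\<^sub>1 \<and> \<tau> \<circ> Inr = \<tau>\<^sub>2" for \<tau>\<^sub>1 \<tau>\<^sub>2
    by (rule exI[of _ "case_sum \<tau>\<^sub>1 \<tau>\<^sub>2"]) auto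
  ultimately show ?thesis unfolding romdp_solution_def by (auto; metis)
qed

section \<open>Sums\<close>

lemma sum_simps [simp]:
  "n_ents (romdp_sum A B) = n_ents A + n_ents B" "n_exits (romdp_sum A B) = n_exits A + n_exits B"
  "positions (romdp_sum A B) = positions A <+> positions B"
  "trans_prob (romdp_sum A B) = sum_prob A B" "reward (romdp_sum A B) = case_sum (reward A) (reward B)"
  by (auto simp: romdp_sum_def)

lemma entr_sum: "entr (romdp_sum A B) i =
    (if i < n_ents A then map_sum Inl id (entr A i)
     else map_sum Inr (\<lambda>j. j + n_exits A) (entr B (i - n_ents A)))"
  by (simp add: romdp_sum_def)

lemma sum_lessThan_add:
  fixes f :: "nat \<Rightarrow> 'v::comm_monoid_add"
  shows "(\<Sum>j<m + n. f j) = (\<Sum>j<m. f j) + (\<Sum>j<n. f (j + m))"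
  by (induction n) (simp_all add: add.assoc[symmetric] add.commute[of m])

lemma ev_sum_Inl:
  assumes "finite (positions A)" "finite (positions B)"
  shows "ev (romdp_sum A B) a (Inl s) v = ev A a s (\<lambda>t. v (map_sum Inl id t))"
  unfolding ev_def using assms by (simp add: sum_targets sum.Plus comp_def sum_lessThan_add)

lemma ev_sum_Inr:
  assumes "finite (positions A)" "finite (positions B)"
  shows "ev (romdp_sum A B) a (Inr s) v = ev B a s (\<lambda>t. v (map_sum Inr (\<lambda>j. j + n_exits A) t))"
  unfolding ev_def using assms by (simp add: sum_targets sum.Plus comp_def sum_lessThan_add)

lemma is_romdp_sum:
  assumes A: "is_romdp A" and B: "is_romdp B"
  shows "is_romdp (romdp_sum A B)"
proof (rule is_romdpI)
  fix i assume i: "i < n_ents (romdp_sum A B)"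
  show "entr (romdp_sum A B) i \<in> targets (romdp_sum A B)"
  proof (cases "i < n_ents A")
    case True
    then show ?thesis using is_romdpD(3)[OF A, of i] by (cases "entr A i") (auto simp: entr_sum)
  next
    case False
    then show ?thesis using is_romdpD(3)[OF B, of "i - n_ents A"] i
      by (cases "entr B (i - n_ents A)") (auto simp: entr_sum)
  qed
next
  fix s a t assume "s \<in> positions (romdp_sum A B)" "t \<in> targets (romdp_sum A B)"
  then show "0 \<le> trans_prob (romdp_sum A B) s a t"
    using is_romdpD(4)[OF A] is_romdpD(4)[OF B]
    by (cases "(A, B, s, a, t)" rule: sum_prob.cases) auto
next
  fix s a assume s: "s \<in> positions (romdp_sum A B)"
  note fin = is_romdpD(1)[OF A] is_romdpD(1)[OF B]
  show "ev (romdp_sum A B) a s (\<lambda>_. 1::real) \<in> {0, 1}"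
  proof (cases s)
    case (Inl s')
    then show ?thesis using s ev_one[OF A, of s' a] unfolding Inl ev_sum_Inl[OF fin] by auto
  next
    case (Inr s')
    then show ?thesis using s ev_one[OF B, of s' a] unfolding Inr ev_sum_Inr[OF fin] by auto
  qed
next
  let ?S = "romdp_sum A B"
  fix t x y
  assume t: "t < n_exits ?S" and x: "x \<in> sources ?S" "accesses ?S x t"
    and y: "y \<in> sources ?S" "accesses ?S y t"
  define f :: "nat + 'a \<times> 'b \<Rightarrow> nat + ('a + 'c) \<times> 'b"
    where "f = map_sum id (\<lambda>(s, a). (Inl s, a))"
  define g :: "nat + 'c \<times> 'b \<Rightarrow> nat + ('a + 'c) \<times> 'b"
    where "g = map_sum (\<lambda>i. i + n_ents A) (\<lambda>(s, a). (Inr s, a))"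
  \<comment> \<open>The index \<open>t\<close> alone tells which summand a source accessing it
    belongs to, so the two cases never mix.\<close>
  have split: "if t < n_exits A then \<exists>z'\<in>sources A. z = f z' \<and> accesses A z' t
      else \<exists>z'\<in>sources B. z = g z' \<and> accesses B z' (t - n_exits A)"
    if z: "z \<in> sources ?S" "accesses ?S z t" for z
  proof (cases z)
    case (Inl i)
    show ?thesis
    proof (cases "i < n_ents A")
      case True
      then obtain k where "entr A i = Inr k" "k = t"
        using z Inl by (cases "entr A i") (auto simp: entr_sum)
      then show ?thesis using Inl True is_romdpD(3)[OF A, of i]
        by (auto simp: f_def intro!: bexI[of _ "Inl i"])
    next
      case False
      then obtain k where "entr B (i - n_ents A) = Inr k" "t = k + n_exits A"
        using z Inl by (cases "entr B (i - n_ents A)") (auto simp: entr_sum)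
      then show ?thesis using Inl False z
        by (auto simp: g_def intro!: bexI[of _ "Inl (i - n_ents A)"])
    qed
  next
    case (Inr sa)
    then obtain s a where sa: "z = Inr (s, a)" by (cases sa) auto
    show ?thesis
    proof (cases s)
      case (Inl s')
      then show ?thesis using z sa
        by (auto simp: f_def split: if_splits intro!: bexI[of _ "Inr (s', a)"])
    next
      case (Inr s')
      then show ?thesis using z sa
        by (auto simp: g_def split: if_splits intro!: bexI[of _ "Inr (s', a)"])
    qed
  qed
  show "x = y"
  proof (cases "t < n_exits A")
    case True
    then show ?thesis using split[OF x] split[OF y] unique_accessD[OF A True] by auto
  next
    case False
    then have "t - n_exits A < n_exits B" using t by auto
    then show ?thesis using False split[OF x] split[OF y] unique_accessD[OF B] by auto
  qed
qed (use is_romdpD[OF A] is_romdpD[OF B] in auto)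

text \<open>General exit values are needed because the indicator of an exit restricts to an
  indicator on one summand and to 0 on the other; the latter case yields the zero blocks of
  \<open>mc_sum\<close>.\<close>

lemma val_sum:
  fixes A :: "('q, unit) romdp" and B :: "('r, unit) romdp"
  assumes A: "is_romdp A" and B: "is_romdp B" and c: "\<And>j. 0 \<le> c j"
  shows "t \<in> targets A \<Longrightarrow> val (romdp_sum A B) c (map_sum Inl id t) = val A c t"
    and "t' \<in> targets B \<Longrightarrow> val (romdp_sum A B) c (map_sum Inr (\<lambda>j. j + n_exits A) t') =
      val B (\<lambda>j. c (j + n_exits A)) t'"
proof -
  let ?S = "romdp_sum A B"
  let ?f = "map_sum Inl id :: 'q + nat \<Rightarrow> ('q + 'r) + nat"
  let ?g = "map_sum Inr (\<lambda>j. j + n_exits A) :: 'r + nat \<Rightarrow> ('q + 'r) + nat"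
  let ?d = "\<lambda>j. c (j + n_exits A)"
  have S: "is_romdp ?S" by (rule is_romdp_sum[OF A B])
  note evA = ev_sum_Inl[OF is_romdpD(1)[OF A] is_romdpD(1)[OF B]]
  note evB = ev_sum_Inr[OF is_romdpD(1)[OF A] is_romdpD(1)[OF B]]
  have inS: "?f t \<in> targets ?S" if "t \<in> targets A" for t
    using that by (cases t) auto
  have inS': "?g t \<in> targets ?S" if "t \<in> targets B" for t
    using that by (cases t) auto
  define w where "w t = (case t of Inl (Inl s) \<Rightarrow> val A c (Inl s)
    | Inl (Inr s) \<Rightarrow> val B ?d (Inl s) | Inr i \<Rightarrow> c i)" for t
  have w_A: "w (?f t) = val A c t" if "t \<in> targets A" for t
    using that by (cases t) (auto simp: w_def val_Inr[OF A])
  have w_B: "w (?g t) = val B ?d t" if "t \<in> targets B" for t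
    using that by (cases t) (auto simp: w_def val_Inr[OF B])
  have le: "val ?S c t \<le> w t" if t: "t \<in> targets ?S" for t
  proof -
    have "val ?S (\<lambda>i. w (Inr i)) t \<le> w t"
    proof (rule val_least[OF S _ _ t])
      fix t assume "t \<in> targets ?S"
      then show "0 \<le> w t"
        using c by (auto simp: w_def targets_def intro!: val_nonneg[OF B] val_nonneg[OF A])
    next
      fix s assume "s \<in> positions ?S"
      then have "s \<in> positions A <+> positions B" by simp
      then show "rstep ?S s w \<le> w (Inl s)"
      proof (elim PlusE)
        fix s' assume s: "s' \<in> positions A" "s = Inl s'"
        have "rstep ?S s w = rstep A s' (val A c)"
          unfolding s(2) evA by (simp add: w_A cong: ev_cong)
        then show ?thesis using val_Inl[OF A s(1), of c] s(2) by (simp add: w_def)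
      next
        fix s' assume s: "s' \<in> positions B" "s = Inr s'"
        have "rstep ?S s w = rstep B s' (val B ?d)"
          unfolding s(2) evB by (simp add: w_B cong: ev_cong)
        then show ?thesis using val_Inl[OF B s(1), of ?d] s(2) by (simp add: w_def)
      qed
    qed
    then show ?thesis by (simp add: w_def)
  qed
  show "val ?S c (?f t) = val A c t" if t: "t \<in> targets A"
  proof (rule antisym)
    have "val A (\<lambda>i. val ?S c (?f (Inr i))) t \<le> val ?S c (?f t)"
    proof (rule val_least[OF A _ _ t])
      fix s assume s: "s \<in> positions A"
      then have "val ?S c (Inl (Inl s)) = rstep ?S (Inl s) (val ?S c)"
        by (intro val_Inl[OF S]) simp
      then show "rstep A s (\<lambda>t. val ?S c (?f t)) \<le> val ?S c (?f (Inl s))"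
        unfolding evA by simp
    qed (intro val_nonneg[OF S] inS c)
    moreover have "val A c t = val A (\<lambda>i. val ?S c (?f (Inr i))) t"
      by (rule val_cong) (simp add: val_Inr[OF S])
    ultimately show "val A c t \<le> val ?S c (?f t)" by simp
  qed (use le[OF inS[OF t]] w_A[OF t] in simp)
  show "val ?S c (?g t') = val B ?d t'" if t: "t' \<in> targets B"
  proof (rule antisym)
    have "val B (\<lambda>i. val ?S c (?g (Inr i))) t' \<le> val ?S c (?g t')"
    proof (rule val_least[OF B _ _ t])
      fix s assume s: "s \<in> positions B"
      then have "val ?S c (Inl (Inr s)) = rstep ?S (Inr s) (val ?S c)"
        by (intro val_Inl[OF S]) simp
      then show "rstep B s (\<lambda>t. val ?S c (?g t)) \<le> val ?S c (?g (Inl s))"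
        unfolding evB by simp
    qed (intro val_nonneg[OF S] inS' c)
    moreover have "val B ?d t' = val B (\<lambda>i. val ?S c (?g (Inr i))) t'"
      by (rule val_cong) (simp add: val_Inr[OF S])
    ultimately show "val B ?d t' \<le> val ?S c (?g t')" by simp
  qed (use le[OF inS'[OF t]] w_B[OF t] in simp)
qed

lemma mc_solution_sum:
  assumes A: "is_romdp A" and B: "is_romdp B"
  shows "mc_solution (romdp_sum A B) = mc_sum (mc_solution A) (mc_solution B)"
proof (rule eq_matI)
  let ?S = "romdp_sum A B"
  fix i j assume "i < dim_row (mc_sum (mc_solution A) (mc_solution B))"
    and "j < dim_col (mc_sum (mc_solution A) (mc_solution B))"
  then have i: "i < n_ents A + n_ents B" and j: "j < n_exits A + n_exits B"
    by (auto simp: mc_sum_def mc_solution_eq_reach)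
  let ?c = "\<lambda>i. of_bool (i = j) :: dnum"
  have zero: "val C (\<lambda>_. 0) t = 0" for C :: "('x, unit) romdp" and t
    by (simp add: val_def)
  have "reach ?S j (entr ?S i) = (if i < n_ents A
      then if j < n_exits A then reach A j (entr A i) else 0
      else if j < n_exits A then 0 else reach B (j - n_exits A) (entr B (i - n_ents A)))"
  proof (cases "i < n_ents A")
    case True
    then have "reach ?S j (entr ?S i) = val A ?c (entr A i)"
      using val_sum(1)[OF A B, of ?c "entr A i"] is_romdpD(3)[OF A] j
      by (simp add: reach_eq_val entr_sum)
    also have "\<dots> = (if j < n_exits A then reach A j (entr A i) else 0)"
    proof (cases "j < n_exits A")
      case False
      then have "val A ?c (entr A i) = val A (\<lambda>_. 0) (entr A i)"
        by (intro val_cong) auto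
      then show ?thesis using False zero by simp
    qed (simp add: reach_eq_val)
    finally show ?thesis using True by simp
  next
    case False
    let ?i = "i - n_ents A"
    have "reach ?S j (entr ?S i) = val B (\<lambda>k. ?c (k + n_exits A)) (entr B ?i)"
      using val_sum(2)[OF A B, of ?c "entr B ?i"] is_romdpD(3)[OF B, of ?i] i j False
      by (simp add: reach_eq_val entr_sum)
    also have "\<dots> = (if j < n_exits A then 0 else reach B (j - n_exits A) (entr B ?i))"
    proof (cases "j < n_exits A")
      case True
      then have "val B (\<lambda>k. ?c (k + n_exits A)) (entr B ?i) = val B (\<lambda>_. 0) (entr B ?i)"
        by (intro val_cong) auto
      then show ?thesis using True zero by simp
    next
      case F: False
      then have "reach B (j - n_exits A) (entr B ?i) = val B (\<lambda>k. ?c (k + n_exits A)) (entr B ?i)"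
        using j by (subst reach_eq_val) (auto intro!: val_cong arg_cong[of _ _ of_bool])
      then show ?thesis using F by simp
    qed
    finally show ?thesis using False by simp
  qed
  then show "mc_solution ?S $$ (i, j) = mc_sum (mc_solution A) (mc_solution B) $$ (i, j)"
    using i j by (auto simp: mc_solution_eq_reach mc_sum_def zero_prod_def)
qed (auto simp: mc_sum_def mc_solution_eq_reach)

lemma induced_mc_sum:
  "induced_mc (romdp_sum A B) \<tau> = romdp_sum (induced_mc A (\<tau> \<circ> Inl)) (induced_mc B (\<tau> \<circ> Inr))"
proof -
  have "\<tau> s = a \<Longrightarrow> sum_prob A B s a t =
      sum_prob (induced_mc A (\<tau> \<circ> Inl)) (induced_mc B (\<tau> \<circ> Inr)) s u t" for s a t and u :: unit
    by (induction A B s a t rule: sum_prob.induct) auto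
  then show ?thesis
    by (intro romdp.equality) (auto simp: fun_eq_iff romdp_sum_def induced_mc_def)
qed

lemma romdp_solution_sum:
  assumes A: "is_romdp A" and B: "is_romdp B"
  shows "romdp_solution (romdp_sum A B) =
    {mc_sum f g | f g. f \<in> romdp_solution A \<and> g \<in> romdp_solution B}"
proof -
  have "mc_solution (induced_mc (romdp_sum A B) \<tau>) =
      mc_sum (mc_solution (induced_mc A (\<tau> \<circ> Inl))) (mc_solution (induced_mc B (\<tau> \<circ> Inr)))" for \<tau>
    unfolding induced_mc_sum by (intro mc_solution_sum is_romdp_induced_mc A B)
  moreover have "\<exists>\<tau>. \<tau> \<circ> Inl = \<tau>\<^sub>1 \<and> \<tau> \<circ> Inr = \<tau>\<^sub>2" for \<tau>\<^sub>1 \<tau>\<^sub>2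
    by (rule exI[of _ "case_sum \<tau>\<^sub>1 \<tau>\<^sub>2"]) auto
  ultimately show ?thesis unfolding romdp_solution_def by (auto; metis)
qed

section \<open>Identities and swaps\<close>

lemma is_romdp_id: "is_romdp (romdp_id m)"
  by (rule is_romdpI) (auto simp: romdp_id_def sources_def)

lemma is_romdp_swap: "is_romdp (romdp_swap m n)"
  by (rule is_romdpI) (auto simp: romdp_swap_def sources_def split: if_splits)

lemma romdp_solution_id: "romdp_solution (romdp_id m) = {mc_id m}"
proof -
  have "mc_solution (induced_mc (romdp_id m) \<tau>) = mc_id m" for \<tau> :: "'a \<Rightarrow> 'b"
  proof (rule eq_matI)
    fix i j assume "i < dim_row (mc_id m)" "j < dim_col (mc_id m)"
    then show "mc_solution (induced_mc (romdp_id m) \<tau>) $$ (i, j) = mc_id m $$ (i, j)"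
      using reach_Inr[OF is_romdp_induced_mc[OF is_romdp_id], of j m \<tau> i]
      by (simp add: mc_solution_eq_reach mc_id_def romdp_id_def)
  qed (simp_all add: mc_solution_eq_reach mc_id_def romdp_id_def)
  then show ?thesis unfolding romdp_solution_def by auto
qed

lemma romdp_solution_swap: "romdp_solution (romdp_swap m n) = {mc_swap m n}"
proof -
  have "mc_solution (induced_mc (romdp_swap m n) \<tau>) = mc_swap m n" for \<tau> :: "'a \<Rightarrow> 'b"
  proof (rule eq_matI)
    fix i j assume *: "i < dim_row (mc_swap m n)" "j < dim_col (mc_swap m n)"
    let ?k = "if i < m then i + n else i - m"
    have "reach (induced_mc (romdp_swap m n) \<tau>) j (Inr ?k) = of_bool (?k = j)"
      using * by (intro reach_Inr is_romdp_induced_mc is_romdp_swap)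
        (auto simp: romdp_swap_def mc_swap_def)
    then show "mc_solution (induced_mc (romdp_swap m n) \<tau>) $$ (i, j) = mc_swap m n $$ (i, j)"
      using * by (auto simp: mc_solution_eq_reach mc_swap_def romdp_swap_def)
  qed (simp_all add: mc_solution_eq_reach mc_swap_def romdp_swap_def)
  then show ?thesis unfolding romdp_solution_def by auto
qed

section \<open>Traces\<close>

lemma trace_simps [simp]:
  "n_ents (romdp_trace l A) = n_ents A - l" "n_exits (romdp_trace l A) = n_exits A - l"
  "positions (romdp_trace l A) = positions A" "reward (romdp_trace l A) = reward A"
  "entr (romdp_trace l A) = trace_entr l A"
  by (auto simp: romdp_trace_def)

text \<open>Embeds the targets of the trace into those of \<open>A\<close>. By
  \<open>exit_shift_cases\<close>, what is not in its range is a fed-back exit below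
  \<open>l\<close>.\<close>

abbreviation exit_shift :: "nat \<Rightarrow> 'q + nat \<Rightarrow> 'q + nat" where
  "exit_shift l \<equiv> map_sum id (\<lambda>j. j + l)"

lemma trans_prob_trace: "trans_prob (romdp_trace l A) q a t = trans_prob A q a (exit_shift l t) +
    (\<Sum>i\<in>trace_prec l A (exit_shift l t). trans_prob A q a (Inr i))"
  by (simp add: romdp_trace_def Let_def)

lemma exit_shift_neq [simp]: "k < l \<Longrightarrow> exit_shift l t \<noteq> Inr k" "k < l \<Longrightarrow> Inr k \<noteq> exit_shift l t"
  by (cases t; simp)+

lemma exit_shift_in_targets: "l \<le> n_exits A \<Longrightarrow> exit_shift l t \<in> targets A \<longleftrightarrow> t \<in> targets (romdp_trace l A)"
  by (cases t) auto

lemma exit_shift_cases: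
  obtains k where "T = Inr k" "k < l" | t where "T = exit_shift l t"
proof (cases T)
  case (Inl s)
  then show thesis using that(2)[of "Inl s"] by simp
next
  case (Inr k)
  then show thesis using that(1)[of k] that(2)[of "Inr (k - l)"] by (cases "k < l") auto
qed

lemma exit_shift_inj: "exit_shift l t = exit_shift l t' \<Longrightarrow> t = t'"
  by (cases t; cases t') auto

section \<open>Following the fed-back wires\<close>

text \<open>One pass through the feedback. The source may be any entrance, also one at or above
  \<open>l\<close>, so that both \<open>trace_entr\<close> and \<open>trace_prec\<close> are
  described by reachability in this relation.\<close>

definition feed :: "nat \<Rightarrow> ('q, 'a) romdp \<Rightarrow> (nat \<times> nat) set" where
  "feed l A = {(k, k'). entr A k = Inr k' \<and> k' < l}"

definition leads :: "nat \<Rightarrow> ('q, 'a) romdp \<Rightarrow> nat \<Rightarrow> 'q + nat \<Rightarrow> bool" where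
  "leads l A x t \<longleftrightarrow> (\<exists>k. (x, k) \<in> (feed l A)\<^sup>* \<and> entr A k = exit_shift l t)"

lemma leads_step:
  "leads l A x t \<longleftrightarrow> entr A x = exit_shift l t \<or> (\<exists>k<l. entr A x = Inr k \<and> leads l A k t)"
proof
  assume "leads l A x t"
  then obtain k where k: "(x, k) \<in> (feed l A)\<^sup>*" "entr A k = exit_shift l t"
    by (auto simp: leads_def)
  from k(1) show "entr A x = exit_shift l t \<or> (\<exists>k<l. entr A x = Inr k \<and> leads l A k t)"
    by (cases rule: converse_rtranclE) (use k in \<open>auto simp: feed_def leads_def\<close>)
next
  assume "entr A x = exit_shift l t \<or> (\<exists>k<l. entr A x = Inr k \<and> leads l A k t)"
  then show "leads l A x t"
  proof
    assume "\<exists>k<l. entr A x = Inr k \<and> leads l A k t"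
    then obtain k k' where "(x, k) \<in> feed l A" "(k, k') \<in> (feed l A)\<^sup>*" "entr A k' = exit_shift l t"
      by (auto simp: leads_def feed_def)
    then show ?thesis by (auto simp: leads_def intro: converse_rtrancl_into_rtrancl)
  qed (auto simp: leads_def)
qed

lemma feed_end:
  assumes "(k, k') \<in> (feed l A)\<^sup>*" "entr A k = exit_shift l t"
  shows "k = k'"
  using assms by (cases rule: converse_rtranclE) (auto simp: feed_def)

text \<open>\<open>feed\<close> is a partial function, so of two entrances reachable from
  \<open>x\<close> one is reachable from the other, and an entrance wired into the range of
  \<open>exit_shift l\<close> has no successor.\<close>

lemma leads_unique:
  assumes "leads l A x t" "leads l A x t'"
  shows "t = t'"
proof -
  obtain k k' where k: "(x, k) \<in> (feed l A)\<^sup>*" "entr A k = exit_shift l t"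
    and k': "(x, k') \<in> (feed l A)\<^sup>*" "entr A k' = exit_shift l t'"
    using assms by (auto simp: leads_def)
  have "single_valued (feed l A)" by (auto simp: single_valued_def feed_def)
  then have "(k, k') \<in> (feed l A)\<^sup>* \<or> (k', k) \<in> (feed l A)\<^sup>*"
    using k k' by (intro single_valued_confluent)
  then have "k = k'" using feed_end k(2) k'(2) by metis
  then show ?thesis using k k' by (metis exit_shift_inj)
qed

text \<open>Unique access makes the map sending an entrance to the exit it is wired to injective, so
  a sequence that is fed back forever would run through a cycle containing its starting point.\<close>

lemma leads_exists:
  assumes A: "is_romdp A" and l: "l \<le> n_ents A" "l \<le> n_exits A" and x: "x < n_ents A"
    and x_start: "x < l \<Longrightarrow> \<forall>e<n_ents A. entr A e \<noteq> Inr x"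
  shows "\<exists>t\<in>targets (romdp_trace l A). leads l A x t"
proof -
  let ?S = "{k. (x, k) \<in> (feed l A)\<^sup>*}"
  have S_sub: "k = x \<or> k < l" if "k \<in> ?S" for k
    using that by (auto elim!: rtranclE simp: feed_def)
  have S_ents: "k < n_ents A" if "k \<in> ?S" for k
    using S_sub[OF that] x l by auto
  have fin: "finite ?S"
    by (rule finite_subset[of _ "insert x {..<l}"]) (use S_sub in auto)
  have "\<exists>k\<in>?S. \<forall>k'<l. entr A k \<noteq> Inr k'"
  proof (rule ccontr)
    assume "\<not> ?thesis"
    then obtain f where f: "\<And>k. k \<in> ?S \<Longrightarrow> entr A k = Inr (f k) \<and> f k < l" by metis
    have "f ` ?S \<subseteq> ?S"
      using f by (auto simp: feed_def intro: rtrancl_into_rtrancl)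
    moreover have "inj_on f ?S"
    proof (rule inj_onI)
      fix k k' assume k: "k \<in> ?S" "k' \<in> ?S" "f k = f k'"
      then have "Inl k = (Inl k' :: nat + 'a \<times> 'b)"
        using f[OF k(1)] f[OF k(2)] S_ents[OF k(1)] S_ents[OF k(2)] l
        by (intro unique_accessD[OF A, of "f k"]) auto
      then show "k = k'" by simp
    qed
    ultimately have "f ` ?S = ?S" using fin by (simp add: endo_inj_surj)
    then obtain k where "k \<in> ?S" "f k = x" by force
    \<comment> \<open>\<open>x\<close> cannot be a value of \<open>f\<close>: these lie below
      \<open>l\<close>, and if \<open>x < l\<close>, then \<open>x_start\<close> excludes every
      entrance wired to \<open>x\<close>.\<close>
    then show False using f[of k] x_start S_ents[of k] by auto
  qed
  then obtain k where k: "k \<in> ?S" "\<forall>k'<l. entr A k \<noteq> Inr k'" by blast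
  obtain t where t: "entr A k = exit_shift l t"
    using k(2) by (cases "entr A k" rule: exit_shift_cases[of _ l]) auto
  then have "t \<in> targets (romdp_trace l A)"
    using is_romdpD(3)[OF A S_ents[OF k(1)]] exit_shift_in_targets[OF l(2), of t] by simp
  then show ?thesis using k t by (auto simp: leads_def)
qed

text \<open>The condition starts at index 1 because the initial entrance may lie at or above
  \<open>l\<close>.\<close>

lemma trace_seq_of_feed:
  assumes "(x, k) \<in> (feed l A)\<^sup>*"
  shows "\<exists>n. trace_seq A x n = Inr k \<and> (\<forall>j. 1 \<le> j \<and> j \<le> n \<longrightarrow> trace_seq A x j \<in> Inr ` {..<l})"
  using assms
proof (induction rule: rtrancl_induct)
  case base
  then show ?case by (intro exI[of _ 0]) auto
next
  case (step k k')
  then obtain n where n: "trace_seq A x n = Inr k"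
    "\<forall>j. 1 \<le> j \<and> j \<le> n \<longrightarrow> trace_seq A x j \<in> Inr ` {..<l}" by blast
  then show ?case using step(2)
    by (intro exI[of _ "Suc n"]) (auto simp: feed_def le_Suc_eq)
qed

lemma feed_of_trace_seq:
  assumes "\<forall>j<n. trace_seq A x j \<in> Inr ` {..<l}" "j < n"
  shows "\<exists>k. trace_seq A x j = Inr k \<and> (x, k) \<in> (feed l A)\<^sup>*"
  using assms(2)
proof (induction j)
  case (Suc j)
  then obtain k where k: "trace_seq A x j = Inr k" "(x, k) \<in> (feed l A)\<^sup>*" by auto
  obtain k' where "trace_seq A x (Suc j) = Inr k'" "k' < l" using assms(1) Suc.prems by blast
  moreover from this have "(k, k') \<in> feed l A" using k by (simp add: feed_def)
  ultimately show ?case using k by (blast intro: rtrancl_into_rtrancl)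
qed simp

lemma trace_prec_exit_shift: "trace_prec l A (exit_shift l t) = {i. i < l \<and> leads l A i t}"
proof -
  have "leads l A i t" if i: "i < l" "trace_seq A i n = exit_shift l t"
    and inner: "\<forall>j<n. trace_seq A i j \<in> Inr ` {..<l}" for i n
  \<comment> \<open>\<open>n = 0\<close> is impossible: the start \<open>Inr i\<close> with
    \<open>i < l\<close> is not in the range of \<open>exit_shift l\<close>.\<close>
  proof (cases n)
    case (Suc n')
    then obtain k where "trace_seq A i n' = Inr k" "(i, k) \<in> (feed l A)\<^sup>*"
      using feed_of_trace_seq[OF inner, of n'] by auto
    then show ?thesis using i Suc by (auto simp: leads_def)
  qed (use i in auto)
  moreover have "\<exists>n. trace_seq A i n = exit_shift l t \<and> (\<forall>j<n. trace_seq A i j \<in> Inr ` {..<l})"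
    if i: "i < l" "leads l A i t" for i
  proof -
    obtain k where k: "(i, k) \<in> (feed l A)\<^sup>*" "entr A k = exit_shift l t"
      using i(2) by (auto simp: leads_def)
    then obtain n where n: "trace_seq A i n = Inr k"
      "\<forall>j. 1 \<le> j \<and> j \<le> n \<longrightarrow> trace_seq A i j \<in> Inr ` {..<l}"
      using trace_seq_of_feed by blast
    have "trace_seq A i j \<in> Inr ` {..<l}" if "j \<le> n" for j
      using n(2) that i(1) by (cases "j = 0") auto
    then show ?thesis using n k by (intro exI[of _ "Suc n"]) auto
  qed
  ultimately show ?thesis unfolding trace_prec_def by blast
qed

lemma trace_entr_eq:
  assumes "leads l A (i + l) t"
  shows "trace_entr l A i = t"
proof -
  obtain k where k: "(i + l, k) \<in> (feed l A)\<^sup>*" "entr A k = exit_shift l t"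
    using assms by (auto simp: leads_def)
  then obtain n where n: "trace_seq A (i + l) n = Inr k"
    "\<forall>j. 1 \<le> j \<and> j \<le> n \<longrightarrow> trace_seq A (i + l) j \<in> Inr ` {..<l}"
    using trace_seq_of_feed by blast
  have "(LEAST k. k \<ge> 1 \<and> trace_seq A (i + l) k \<notin> Inr ` {..<l}) = Suc n"
  proof (rule Least_equality)
    show "Suc n \<ge> 1 \<and> trace_seq A (i + l) (Suc n) \<notin> Inr ` {..<l}" using n k by auto
  next
    fix m assume "m \<ge> 1 \<and> trace_seq A (i + l) m \<notin> Inr ` {..<l}"
    then show "Suc n \<le> m" using n(2) by (meson not_less_eq_eq)
  qed
  then show ?thesis
    using n k by (cases t) (simp_all add: trace_entr_def)
qed

text \<open>An entrance leads to at most one target, so the sum has at most one nonzero term; it is \<open>0\<close>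
  on wires that are fed back forever.\<close>

definition lead_val :: "nat \<Rightarrow> ('q, 'a) romdp \<Rightarrow> ('q + nat \<Rightarrow> 'v::real_vector) \<Rightarrow> nat \<Rightarrow> 'v" where
  "lead_val l A v x = (\<Sum>t\<in>targets (romdp_trace l A). of_bool (leads l A x t) *\<^sub>R v t)"

text \<open>Extends values on the targets of the trace to the targets of \<open>A\<close>, so that a
  step of the trace becomes a step of \<open>A\<close> (\<open>ev_trace\<close>).\<close>

definition follow :: "nat \<Rightarrow> ('q, 'a) romdp \<Rightarrow> ('q + nat \<Rightarrow> 'v::real_vector) \<Rightarrow> 'q + nat \<Rightarrow> 'v" where
  "follow l A v t = (case t of Inl s \<Rightarrow> v (Inl s)
     | Inr j \<Rightarrow> if j < l then lead_val l A v j else v (Inr (j - l)))"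

lemma follow_simps [simp]:
  "follow l A v (Inl s) = v (Inl s)" "k < l \<Longrightarrow> follow l A v (Inr k) = lead_val l A v k"
  "\<not> k < l \<Longrightarrow> follow l A v (Inr k) = v (Inr (k - l))"
  by (auto simp: follow_def)

lemma follow_exit_shift [simp]: "follow l A v (exit_shift l t) = v t"
  by (cases t) auto

lemma finite_targets_trace: "is_romdp A \<Longrightarrow> finite (targets (romdp_trace l A))"
  using is_romdpD(1)[of A] by (auto simp: targets_def)

lemma lead_val_eq:
  assumes "is_romdp A" "leads l A x t" "t \<in> targets (romdp_trace l A)"
  shows "lead_val l A v x = v t"
proof -
  have "leads l A x t' \<longleftrightarrow> t = t'" for t'
    using assms(2) leads_unique by blast
  then show ?thesis
    unfolding lead_val_def
    using sum_targets_delta[OF finite_targets_trace[OF assms(1)], of t v l] assms(3)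
    by simp
qed

lemma lead_val_eq_0: "(\<And>t. t \<in> targets (romdp_trace l A) \<Longrightarrow> \<not> leads l A x t) \<Longrightarrow> lead_val l A v x = 0"
  unfolding lead_val_def by simp

lemma follow_entr:
  assumes A: "is_romdp A" and l: "l \<le> n_exits A" and x: "x < n_ents A"
  shows "follow l A v (entr A x) = lead_val l A v x"
proof (cases "entr A x" rule: exit_shift_cases[of _ l])
  case (1 k)
  then have "leads l A x = leads l A k" using leads_step[of l A x] by (auto simp: fun_eq_iff)
  then show ?thesis using 1 by (simp add: lead_val_def)
next
  case (2 t)
  then have "t \<in> targets (romdp_trace l A)"
    using is_romdpD(3)[OF A x] exit_shift_in_targets[OF l] by metis
  moreover have "leads l A x t" using 2 leads_step by metis
  ultimately show ?thesis using 2 lead_val_eq[OF A, of l x t v] by simp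
qed

text \<open>Exchanging the sum over targets with the sum over \<open>trace_prec\<close> groups the
  terms by fed-back exit \<open>i\<close>, and the factor of \<open>trans_prob A s a (Inr i)\<close>
  becomes \<open>lead_val l A v i\<close>.\<close>

lemma ev_trace:
  assumes A: "is_romdp A" and l: "l \<le> n_exits A"
  shows "ev (romdp_trace l A) a s v = ev A a s (follow l A v)"
proof -
  let ?T = "targets (romdp_trace l A)" and ?P = "trans_prob A s a"
  note fin = is_romdpD(1)[OF A]
  have finT: "finite (positions (romdp_trace l A))" using fin by simp
  have "(\<Sum>i\<in>trace_prec l A (exit_shift l t). ?P (Inr i)) =
      (\<Sum>i<l. ?P (Inr i) * of_bool (leads l A i t))" for t
    by (simp add: trace_prec_exit_shift lessThan_def Collect_conj_eq)
  then have "(\<Sum>t\<in>?T. (\<Sum>i\<in>trace_prec l A (exit_shift l t). ?P (Inr i)) *\<^sub>R v t) =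
      (\<Sum>t\<in>?T. (\<Sum>i<l. ?P (Inr i) * of_bool (leads l A i t)) *\<^sub>R v t)"
    by simp
  also have "\<dots> = (\<Sum>i<l. ?P (Inr i) *\<^sub>R lead_val l A v i)"
    by (simp add: lead_val_def scaleR_sum_left scaleR_sum_right sum.swap[of _ ?T]
        del: sum_mult_of_bool_eq sum_of_bool_mult_eq)
  finally have "ev (romdp_trace l A) a s v =
      (\<Sum>t\<in>?T. ?P (exit_shift l t) *\<^sub>R v t) + (\<Sum>i<l. ?P (Inr i) *\<^sub>R lead_val l A v i)"
    by (simp add: ev_def trans_prob_trace scaleR_add_left sum.distrib)
  also have "(\<Sum>t\<in>?T. ?P (exit_shift l t) *\<^sub>R v t) =
      (\<Sum>s\<in>positions A. ?P (Inl s) *\<^sub>R v (Inl s)) + (\<Sum>j<n_exits A - l. ?P (Inr (j + l)) *\<^sub>R v (Inr j))"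
    unfolding sum_targets[OF finT] by simp
  also have "\<dots> + (\<Sum>i<l. ?P (Inr i) *\<^sub>R lead_val l A v i) = ev A a s (follow l A v)"
    unfolding ev_def sum_targets[OF fin]
    using sum_lessThan_add[of "\<lambda>j. ?P (Inr j) *\<^sub>R follow l A v (Inr j)" l "n_exits A - l"] l
    by (simp add: algebra_simps)
  finally show ?thesis .
qed

lemma is_romdp_trace:
  fixes A :: "('q, 'a) romdp"
  assumes A: "is_romdp A" and l: "l \<le> n_ents A" "l \<le> n_exits A"
  shows "is_romdp (romdp_trace l A)"
proof (rule is_romdpI)
  fix i assume "i < n_ents (romdp_trace l A)"
  then have "i + l < n_ents A" by simp
  then obtain t where "t \<in> targets (romdp_trace l A)" "leads l A (i + l) t"
    using leads_exists[OF A l, of "i + l"] by auto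
  then show "entr (romdp_trace l A) i \<in> targets (romdp_trace l A)"
    by (simp add: trace_entr_eq)
next
  fix s a t assume "s \<in> positions (romdp_trace l A)" "t \<in> targets (romdp_trace l A)"
  then show "0 \<le> trans_prob (romdp_trace l A) s a t"
    unfolding trans_prob_trace
    using exit_shift_in_targets[OF l(2), of t] l(2)
    by (intro add_nonneg_nonneg sum_nonneg is_romdpD(4)[OF A]) (auto simp: trace_prec_exit_shift)
next
  fix s a assume "s \<in> positions (romdp_trace l A)"
  then have s: "s \<in> positions A" by simp
  \<comment> \<open>No mass is lost: a fed-back exit accessed by a position is wired to no entrance,
    so \<open>leads_exists\<close> applies and its wire ends at a target. Where the probability is
    0, both sides are 0.\<close>
  have "trans_prob A s a t *\<^sub>R follow l A (\<lambda>_. 1::real) t = trans_prob A s a t *\<^sub>R 1"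
    if t: "t \<in> targets A" for t
  proof (cases "\<exists>k<l. t = Inr k \<and> trans_prob A s a t \<noteq> 0")
    case True
    then obtain k where k: "k < l" "t = Inr k" "trans_prob A s a (Inr k) > 0"
      using is_romdpD(4)[OF A s t, of a] by auto
    have "entr A e \<noteq> Inr k" if "e < n_ents A" for e
      using unique_accessD[OF A, of k "Inl e" "Inr (s, a)"] that k s l by auto
    then obtain t' where "t' \<in> targets (romdp_trace l A)" "leads l A k t'"
      using leads_exists[OF A l, of k] k l by auto
    then show ?thesis using k lead_val_eq[OF A, of l k t' "\<lambda>_. 1::real"] by simp
  qed (cases t rule: exit_shift_cases[of _ l]; force)
  then have "ev A a s (follow l A (\<lambda>_. 1::real)) = ev A a s (\<lambda>_. 1)"
    unfolding ev_def by (rule sum.cong[OF refl])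
  then show "ev (romdp_trace l A) a s (\<lambda>_. 1::real) \<in> {0, 1}"
    using ev_one[OF A s, of a] by (simp add: ev_trace[OF A l(2)])
next
  let ?S = "romdp_trace l A"
  fix t x y
  assume t: "t < n_exits ?S" and x: "x \<in> sources ?S" "accesses ?S x t"
    and y: "y \<in> sources ?S" "accesses ?S y t"
  \<comment> \<open>Walks the wires backwards from the exit \<open>t + l\<close>. By unique access
    at most one entrance is wired to a given exit, so this walk is deterministic.\<close>
  define bwd where "bwd = {(k', k). k < l \<and> entr A k = Inr k'}"
  have entr_exit: "k' < n_exits A" if "entr A k = Inr k'" "k < l" for k k'
    using is_romdpD(3)[OF A, of k] that l by auto
  have sv: "single_valued bwd"
  proof (rule single_valuedI)
    fix a b c assume "(a, b) \<in> bwd" "(a, c) \<in> bwd"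
    then show "b = c"
      using unique_accessD[OF A entr_exit, of b a "Inl b" "Inl c"] l by (auto simp: bwd_def)
  qed
  have bwd: "(t + l, k) \<in> bwd\<^sup>*" if "leads l A k (Inr t)" "k < l" for k
  proof -
    obtain k' where k': "(k, k') \<in> (feed l A)\<^sup>*" "entr A k' = Inr (t + l)"
      using \<open>leads l A k (Inr t)\<close> by (auto simp: leads_def)
    from k'(1) have "(k', k) \<in> bwd\<^sup>* \<and> k' < l"
    proof (induction rule: rtrancl_induct)
      case (step k1 k2)
      then have "(k2, k1) \<in> bwd" "k2 < l" by (auto simp: bwd_def feed_def)
      then show ?case using step.IH by (auto intro: converse_rtrancl_into_rtrancl)
    qed (simp add: that)
    moreover from this have "(t + l, k') \<in> bwd" using k' by (simp add: bwd_def)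
    ultimately show ?thesis by (auto intro: converse_rtrancl_into_rtrancl)
  qed
  define f :: "nat + 'q \<times> 'a \<Rightarrow> nat + 'q \<times> 'a" where "f = map_sum (\<lambda>i. i + l) id"
  have split: "\<exists>k<n_exits A. f z \<in> sources A \<and> accesses A (f z) k \<and> (t + l, k) \<in> bwd\<^sup>*"
    if z: "z \<in> sources ?S" "accesses ?S z t" for z
  proof (cases z)
    case (Inl i)
    then have i: "i + l < n_ents A" "trace_entr l A i = Inr t" using z by auto
    have "leads l A (i + l) (Inr t)"
      using leads_exists[OF A l i(1)] trace_entr_eq[of l A i] i(2) by auto
    then consider "entr A (i + l) = Inr (t + l)"
      | k where "k < l" "entr A (i + l) = Inr k" "leads l A k (Inr t)"
      using leads_step[of l A "i + l" "Inr t"] by auto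
    then show ?thesis
    proof cases
      case 1
      then show ?thesis using i Inl t by (intro exI[of _ "t + l"]) (auto simp: f_def)
    next
      case (2 k)
      then show ?thesis using i Inl l bwd by (intro exI[of _ k]) (auto simp: f_def)
    qed
  next
    case (Inr sa)
    then obtain s a where sa: "z = Inr (s, a)" by (cases sa) auto
    then have s: "s \<in> positions A" using z by simp
    have "trans_prob A s a (Inr (t + l)) +
        (\<Sum>i | i < l \<and> leads l A i (Inr t). trans_prob A s a (Inr i)) > 0"
      using z sa trace_prec_exit_shift[of l A "Inr t"] by (simp add: trans_prob_trace)
    then consider "trans_prob A s a (Inr (t + l)) > 0"
      | "(\<Sum>i | i < l \<and> leads l A i (Inr t). trans_prob A s a (Inr i)) > 0"
      by linarith
    then show ?thesis
    proof cases
      case 1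
      then show ?thesis using s sa t by (intro exI[of _ "t + l"]) (auto simp: f_def)
    next
      case 2
      then obtain k where "k < l" "leads l A k (Inr t)" "trans_prob A s a (Inr k) > 0"
        by (metis (mono_tags, lifting) mem_Collect_eq not_le sum_nonpos)
      then show ?thesis using s sa l bwd by (intro exI[of _ k]) (auto simp: f_def)
    qed
  qed
  obtain k where k: "k < n_exits A" "f x \<in> sources A" "accesses A (f x) k" "(t + l, k) \<in> bwd\<^sup>*"
    using split[OF x] by blast
  obtain k' where k': "k' < n_exits A" "f y \<in> sources A" "accesses A (f y) k'" "(t + l, k') \<in> bwd\<^sup>*"
    using split[OF y] by blast
  \<comment> \<open>Entrances in the range of \<open>f\<close> are at least \<open>l\<close>, while
    a further backward step would make the unique source an entrance below \<open>l\<close>. Hence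
    the exit accessed by \<open>f z\<close> is the end of the walk, the same for \<open>x\<close>
    and \<open>y\<close>.\<close>
  have start: "k1 = k2" if "(k1, k2) \<in> bwd\<^sup>*" "k1 < n_exits A" "f z \<in> sources A" "accesses A (f z) k1" for k1 k2 z
    using that(1)
  proof (cases rule: converse_rtranclE)
    case (step e)
    then have e: "e < l" "entr A e = Inr k1" by (auto simp: bwd_def)
    then have "f z = Inl e"
      using unique_accessD[OF A that(2-4), of "Inl e"] l by auto
    then show ?thesis using e by (cases z) (auto simp: f_def)
  qed simp
  have "k = k'"
    using single_valued_confluent[OF sv k(4) k'(4)] start[of k k' x] start[of k' k y] k k' by auto
  then have "f x = f y" using unique_accessD[OF A k(1-3) k'(2)] k'(3) by simp
  then show "x = y" by (cases x; cases y) (auto simp: f_def)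
qed (use is_romdpD[OF A] in auto)

section \<open>The linear system of a trace\<close>

lemma lead_val_mono:
  assumes "\<And>t. t \<in> targets (romdp_trace l A) \<Longrightarrow> v t \<le> (w t :: dnum)"
  shows "lead_val l A v x \<le> lead_val l A w x"
  unfolding lead_val_def using assms by (intro sum_mono scaleR_mono_dnum) auto

lemma lead_val_nonneg:
  assumes "\<And>t. t \<in> targets (romdp_trace l A) \<Longrightarrow> 0 \<le> (v t :: dnum)"
  shows "0 \<le> lead_val l A v x"
  unfolding lead_val_def using assms by (intro sum_nonneg scaleR_nonneg_dnum) auto

definition ext_exits :: "nat \<Rightarrow> (nat \<Rightarrow> dnum) \<Rightarrow> (nat \<Rightarrow> dnum) \<Rightarrow> nat \<Rightarrow> dnum" where
  "ext_exits l y c k = (if k < l then y k else c (k - l))"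

lemma ext_exits_simps [simp]:
  "k < l \<Longrightarrow> ext_exits l y c k = y k" "ext_exits l y c (k + l) = c k"
  by (auto simp: ext_exits_def)

text \<open>By \<open>super\<close>, replacing the value of a fed-back exit by that of the target of
  its wire only lowers it. A step of the trace is therefore bounded by a step of \<open>A\<close>,
  and the solution of \<open>A\<close> restricts to a supersolution for the trace.\<close>

lemma val_trace_le:
  assumes A: "is_romdp A" and l: "l \<le> n_ents A" "l \<le> n_exits A"
    and c: "\<And>j. 0 \<le> c j" and y: "\<And>k. k < l \<Longrightarrow> 0 \<le> y k"
    and super: "\<And>k. k < l \<Longrightarrow> lead_val l A (\<lambda>t. val A (ext_exits l y c) (exit_shift l t)) k \<le> y k"
    and t: "t \<in> targets (romdp_trace l A)"
  shows "val (romdp_trace l A) c t \<le> val A (ext_exits l y c) (exit_shift l t)"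
proof -
  let ?T = "romdp_trace l A"
  define g where "g = val A (ext_exits l y c)"
  have T: "is_romdp ?T" by (rule is_romdp_trace[OF A l])
  have g_Inr: "g (Inr k) = ext_exits l y c k" if "k < n_exits A" for k
    unfolding g_def by (rule val_Inr[OF A that])
  have g_nn: "0 \<le> g t" if "t \<in> targets A" for t
    unfolding g_def using c y by (intro val_nonneg[OF A that]) (simp add: ext_exits_def)
  have "val ?T (\<lambda>j. g (exit_shift l (Inr j))) t \<le> g (exit_shift l t)"
  proof (rule val_least[OF T _ _ t])
    fix t assume "t \<in> targets ?T"
    then show "0 \<le> g (exit_shift l t)" using g_nn exit_shift_in_targets[OF l(2)] by blast
  next
    fix s assume "s \<in> positions ?T"
    then have s: "s \<in> positions A" by simp
    have "follow l A (\<lambda>t. g (exit_shift l t)) t \<le> g t" if t: "t \<in> targets A" for t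
    proof (cases t rule: exit_shift_cases[of _ l])
      case (1 k)
      then show ?thesis using super[of k] g_Inr[of k] l by (simp add: g_def)
    qed simp
    then have "rstep A s (follow l A (\<lambda>t. g (exit_shift l t))) \<le> rstep A s g"
      by (intro rstep_mono[OF A s])
    also have "\<dots> = g (Inl s)" unfolding g_def by (rule val_Inl[OF A s, symmetric])
    finally show "rstep ?T s (\<lambda>t. g (exit_shift l t)) \<le> g (exit_shift l (Inl s))"
      by (simp add: ev_trace[OF A l(2)])
  qed
  moreover have "val ?T c t = val ?T (\<lambda>j. g (exit_shift l (Inr j))) t"
    by (rule val_cong) (simp add: g_Inr)
  ultimately show ?thesis by (simp add: g_def)
qed

text \<open>The extension \<open>follow l A v\<close> satisfies the equations of \<open>A\<close>,
  so it dominates the least solution with its exit values. This inequality is in turn the hypothesis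
  \<open>super\<close> of \<open>val_trace_le\<close>, which gives the converse.\<close>

lemma val_trace_unfold:
  assumes A: "is_romdp A" and l: "l \<le> n_ents A" "l \<le> n_exits A" and c: "\<And>j. 0 \<le> c j"
    and t: "t \<in> targets A"
  defines "v \<equiv> val (romdp_trace l A) c"
  shows "val A (ext_exits l (lead_val l A v) c) t = follow l A v t"
proof -
  let ?T = "romdp_trace l A"
  have T: "is_romdp ?T" by (rule is_romdp_trace[OF A l])
  define u where "u = follow l A v"
  define d where "d = ext_exits l (lead_val l A v) c"
  have v_nn: "0 \<le> v t" if "t \<in> targets ?T" for t
    unfolding v_def by (intro val_nonneg[OF T that] c)
  have u_Inr: "u (Inr k) = d k" if "k < n_exits A" for k
    using that by (cases "k < l") (auto simp: u_def d_def ext_exits_def v_def val_Inr[OF T])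
  have le: "val A d t \<le> u t" if t: "t \<in> targets A" for t
  proof -
    have "val A (\<lambda>k. u (Inr k)) t \<le> u t"
    proof (rule val_least[OF A _ _ t])
      fix t assume t: "t \<in> targets A"
      show "0 \<le> u t"
      proof (cases t rule: exit_shift_cases[of _ l])
        case (1 k)
        then show ?thesis using lead_val_nonneg[OF v_nn] by (simp add: u_def)
      next
        case (2 t')
        then show ?thesis using v_nn exit_shift_in_targets[OF l(2), of t'] t by (simp add: u_def)
      qed
    next
      fix s assume s: "s \<in> positions A"
      then have "rstep A s u = v (Inl s)"
        unfolding v_def u_def using val_Inl[OF T, of s c] by (simp add: ev_trace[OF A l(2)])
      then show "rstep A s u \<le> u (Inl s)" by (simp add: u_def)
    qed
    moreover have "val A (\<lambda>k. u (Inr k)) t = val A d t" by (rule val_cong) (rule u_Inr)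
    ultimately show ?thesis by simp
  qed
  have "u t \<le> val A d t"
  proof (cases t rule: exit_shift_cases[of _ l])
    case (1 k)
    then have "k < n_exits A" using l by simp
    then show ?thesis using 1 u_Inr[of k] by (simp add: val_Inr[OF A])
  next
    case (2 t')
    then have t': "t' \<in> targets ?T" using t exit_shift_in_targets[OF l(2)] by metis
    have "v t' \<le> val A d (exit_shift l t')"
      unfolding v_def d_def
    proof (rule val_trace_le[OF A l c _ _ t'])
      fix k assume "k < l"
      show "0 \<le> lead_val l A (val ?T c) k"
        using lead_val_nonneg[OF v_nn] by (simp add: v_def)
      show "lead_val l A (\<lambda>t. val A (ext_exits l (lead_val l A (val ?T c)) c) (exit_shift l t)) k
          \<le> lead_val l A (val ?T c) k"
      proof (rule lead_val_mono)
        fix t assume "t \<in> targets ?T"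
        then have "val A d (exit_shift l t) \<le> u (exit_shift l t)"
          using le exit_shift_in_targets[OF l(2)] by blast
        then show "val A (ext_exits l (lead_val l A (val ?T c)) c) (exit_shift l t) \<le> val ?T c t"
          by (simp add: d_def u_def v_def)
      qed
    qed
    then show ?thesis using 2 by (simp add: u_def)
  qed
  then show ?thesis using le[OF t] by (simp add: u_def d_def)
qed

text \<open>The hypothesis compares a wire with its next stop, \<open>val_trace_le\<close> with its
  final target. \<open>chain\<close> bridges the gap: along \<open>feed\<close> the values can only
  decrease.\<close>

lemma lead_val_trace_least:
  assumes A: "is_romdp A" and l: "l \<le> n_ents A" "l \<le> n_exits A" and c: "\<And>j. 0 \<le> c j"
    and y: "\<And>k. k < l \<Longrightarrow> 0 \<le> y k"
    and super: "\<And>k. k < l \<Longrightarrow> val A (ext_exits l y c) (entr A k) \<le> y k"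
    and k: "k < l"
  shows "lead_val l A (val (romdp_trace l A) c) k \<le> y k"
proof -
  let ?T = "romdp_trace l A"
  define g where "g = val A (ext_exits l y c)"
  have g_Inr: "g (Inr k) = y k" if "k < l" for k
    using that l unfolding g_def by (simp add: val_Inr[OF A])
  have chain: "g (Inr k') \<le> g (Inr k) \<and> k' < l" if "(k, k') \<in> (feed l A)\<^sup>*" "k < l" for k k'
    using that(1)
  proof (induction rule: rtrancl_induct)
    case (step k1 k2)
    then have "g (Inr k2) \<le> g (Inr k1)" "k2 < l"
      using super[of k1] g_Inr[of k1] by (auto simp: feed_def g_def)
    then show ?case using step.IH by auto
  qed (use that in simp)
  have lead: "lead_val l A (\<lambda>t. g (exit_shift l t)) k \<le> y k" if k: "k < l" for k
  proof (cases "\<exists>t\<in>targets ?T. leads l A k t")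
    case True
    then obtain t k' where t: "t \<in> targets ?T" "leads l A k t"
      and k': "(k, k') \<in> (feed l A)\<^sup>*" "entr A k' = exit_shift l t"
      by (auto simp: leads_def)
    have "g (exit_shift l t) \<le> g (Inr k)"
      using chain[OF k'(1) k] super[of k'] g_Inr[of k'] k'(2)
      by (auto simp: g_def intro: order_trans)
    then show ?thesis
      using lead_val_eq[OF A t(2,1), of "\<lambda>t. g (exit_shift l t)"] g_Inr[OF k] by simp
  next
    case False
    \<comment> \<open>On a wire fed back forever the value is 0, so nonnegativity of
      \<open>y\<close> is enough.\<close>
    then have "lead_val l A (\<lambda>t. g (exit_shift l t)) k = 0" by (intro lead_val_eq_0) blast
    then show ?thesis using y[OF k] by simp
  qed
  have "lead_val l A (val ?T c) k \<le> lead_val l A (\<lambda>t. g (exit_shift l t)) k"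
    unfolding g_def
    by (intro lead_val_mono val_trace_le[OF A l c y]) (use lead in \<open>simp_all add: g_def\<close>)
  then show ?thesis using lead[OF k] by simp
qed

section \<open>The series for the trace\<close>

text \<open>The partial sums increase and stay below any nonnegative solution, so they converge, and
  the limit is again a solution. Leastness of \<open>y\<close> identifies the two; the equation
  alone would not, as \<open>z = L z\<close> may have nonzero solutions.\<close>

lemma dlim_neumann:
  fixes H :: "nat \<Rightarrow> nat \<Rightarrow> dnum" and l :: nat
  defines "L \<equiv> \<lambda>z k. \<Sum>k'<l. H k k' * z k'"
  assumes H: "\<And>k k'. k < l \<Longrightarrow> k' < l \<Longrightarrow> 0 \<le> H k k'" and b: "\<And>k. k < l \<Longrightarrow> 0 \<le> b k"
    and fix_y: "\<And>k. k < l \<Longrightarrow> y k = b k + L y k" and y: "\<And>k. k < l \<Longrightarrow> 0 \<le> y k"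
    and least: "\<And>z k. (\<And>k. k < l \<Longrightarrow> 0 \<le> z k) \<Longrightarrow> (\<And>k. k < l \<Longrightarrow> b k + L z k \<le> z k) \<Longrightarrow>
      k < l \<Longrightarrow> y k \<le> z k"
    and k: "k < l"
  shows "dlim (\<lambda>K. \<Sum>d<K. (L ^^ d) b k) (y k)"
proof -
  define Y where "Y K k = (\<Sum>d<K. (L ^^ d) b k)" for K k
  have Y_Suc: "Y (Suc K) k = b k + L (Y K) k" for K k
  proof -
    have "Y (Suc K) k = b k + (\<Sum>d<K. L ((L ^^ d) b) k)"
      by (simp add: Y_def sum.lessThan_Suc_shift del: sum.lessThan_Suc)
    also have "(\<Sum>d<K. L ((L ^^ d) b) k) = L (Y K) k"
      by (simp add: L_def Y_def sum_distrib_left sum.swap[of _ "{..<K}"])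
    finally show ?thesis .
  qed
  have L_mono: "L z k \<le> L z' k" if "k < l" "\<And>k. k < l \<Longrightarrow> z k \<le> z' k" for z z' k
    unfolding L_def using that H by (intro sum_mono mult_left_mono) auto
  have Z_nn: "0 \<le> (L ^^ d) b k" if "k < l" for d k
    using that
  proof (induction d arbitrary: k)
    case (Suc d)
    then show ?case using H by (auto simp: L_def intro!: sum_nonneg mult_nonneg_nonneg)
  qed (simp add: b)
  have Y_nn: "0 \<le> Y K k" if "k < l" for K k
    unfolding Y_def using Z_nn[OF that] by (intro sum_nonneg)
  have Y_le: "Y K k \<le> y k" if "k < l" for K k
    using that
  proof (induction K arbitrary: k)
    case (Suc K)
    then show ?case using L_mono[OF Suc.prems Suc.IH] fix_y[OF Suc.prems] by (simp add: Y_Suc)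
  qed (simp add: Y_def y)
  have "\<exists>L. dlim (\<lambda>K. Y K k) L" if "k < l" for k
    using Y_le[OF that] Z_nn[OF that]
    by (intro dlim_bounded_monotone[of _ "y k"] incseq_SucI) (auto simp: Y_def)
  then obtain Z where Z: "\<And>k. k < l \<Longrightarrow> dlim (\<lambda>K. Y K k) (Z k)" by metis
  have "Z k = b k + L Z k" if "k < l" for k
  proof (rule dlim_unique)
    show "dlim (\<lambda>K. Y (Suc K) k) (Z k)" by (intro dlim_Suc Z that)
    show "dlim (\<lambda>K. Y (Suc K) k) (b k + L Z k)"
      unfolding Y_Suc L_def using Z by (intro dlim_add dlim_sum dlim_mult dlim_const) auto
  qed
  then have "y k \<le> Z k"
    using least[of Z k] k dlim_ge[OF Z Y_nn] by simp
  moreover have "Z k \<le> y k" using dlim_le[OF Z[OF k] Y_le[OF k]] .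
  ultimately have "Z k = y k" by simp
  then show ?thesis using Z[OF k] by (simp add: Y_def)
qed

text \<open>The wire values \<open>y\<close> are the least solution of \<open>y = b + L y\<close>,
  by \<open>val_trace_unfold\<close> and \<open>lead_val_trace_least\<close>, so
  \<open>dlim_neumann\<close> expands them. Entering from outside adds one application of
  \<open>L\<close>, evaluated at the entrance \<open>l + i\<close>.\<close>

lemma reach_trace_series:
  fixes A :: "('q, unit) romdp"
  assumes A: "is_romdp A" and l: "l \<le> n_ents A" "l \<le> n_exits A"
    and i: "i < n_ents A - l" and j: "j < n_exits A - l"
  defines "H \<equiv> \<lambda>i j. reach A j (entr A i)"
  defines "L \<equiv> \<lambda>z k. \<Sum>k'<l. H k k' * z k'"
  shows "dlim (\<lambda>K. H (l + i) (l + j) + (\<Sum>d<K. L ((L ^^ d) (\<lambda>k. H k (l + j))) (l + i)))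
    (reach (romdp_trace l A) j (trace_entr l A i))"
proof -
  let ?T = "romdp_trace l A"
  have T: "is_romdp ?T" by (rule is_romdp_trace[OF A l])
  define c where "c k = (of_bool (k = j) :: dnum)" for k
  define v where "v = val ?T c"
  define y where "y = lead_val l A v"
  let ?b = "\<lambda>k. H k (l + j)"
  have c: "0 \<le> c k" for k by (simp add: c_def)
  \<comment> \<open>Splitting the exits of \<open>A\<close> at \<open>l\<close> makes the dependence
    on the wire values affine; the indicator \<open>c\<close> selects the column
    \<open>l + j\<close>.\<close>
  have val_ext: "val A (ext_exits l z c) (entr A x) = ?b x + L z x" for z x
  proof -
    have "val A (ext_exits l z c) (entr A x) =
        (\<Sum>k<l + (n_exits A - l). H x k * ext_exits l z c k)"
      using l by (simp add: val_def H_def)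
    also have "\<dots> = L z x + (\<Sum>k<n_exits A - l. H x (k + l) * c k)"
      unfolding sum_lessThan_add by (simp add: L_def)
    also have "(\<Sum>k<n_exits A - l. H x (k + l) * c k) = H x (j + l)"
      using j by (simp add: c_def of_bool_def if_distrib[of "\<lambda>x. _ * x"] cong: if_cong)
    finally show ?thesis by (simp add: add.commute)
  qed
  \<comment> \<open>For \<open>x < l\<close> this is the equation for \<open>y\<close>; for
    \<open>x = l + i\<close> it gives the value at an entrance of the trace.\<close>
  have unfold: "?b x + L y x = lead_val l A v x" if "x < n_ents A" for x
    using val_trace_unfold[where c = c, OF A l c is_romdpD(3)[OF A that]] follow_entr[OF A l(2) that, of v]
    by (simp add: val_ext[symmetric] y_def v_def)
  have H_nn: "0 \<le> H i j" if "i < n_ents A" "j < n_exits A" for i j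
    unfolding H_def using that by (intro reach_nonneg[OF A] is_romdpD(3)[OF A])
  have "dlim (\<lambda>K. \<Sum>d<K. (L ^^ d) ?b k) (y k)" if "k < l" for k
    unfolding L_def
  proof (rule dlim_neumann)
    fix k assume k: "k < l"
    show "y k = ?b k + (\<Sum>k'<l. H k k' * y k')"
      using unfold[of k] k l by (simp add: y_def L_def)
    show "0 \<le> y k"
      unfolding y_def v_def using c by (intro lead_val_nonneg val_nonneg[OF T])
  next
    fix z k assume "\<And>k. k < l \<Longrightarrow> 0 \<le> z k" "\<And>k. k < l \<Longrightarrow> ?b k + (\<Sum>k'<l. H k k' * z k') \<le> z k" "k < l"
    then show "y k \<le> z k"
      unfolding y_def v_def using lead_val_trace_least[where c = c, OF A l c, of z k] val_ext
      by (simp add: L_def)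
  qed (use H_nn l j that in auto)
  then have "dlim (\<lambda>K. ?b (l + i) + (\<Sum>k<l. H (l + i) k * (\<Sum>d<K. (L ^^ d) ?b k)))
      (?b (l + i) + (\<Sum>k<l. H (l + i) k * y k))"
    by (intro dlim_add dlim_sum dlim_mult dlim_const) auto
  moreover have "(\<Sum>k<l. H (l + i) k * (\<Sum>d<K. (L ^^ d) ?b k)) = (\<Sum>d<K. L ((L ^^ d) ?b) (l + i))" for K
    by (simp add: L_def sum_distrib_left sum.swap[of _ "{..<K}"])
  moreover have "?b (l + i) + (\<Sum>k<l. H (l + i) k * y k) = reach ?T j (trace_entr l A i)"
  proof -
    have x: "l + i < n_ents A" using i by simp
    obtain t where t: "t \<in> targets ?T" "leads l A (i + l) t"
      using leads_exists[OF A l, of "i + l"] x by (auto simp: add.commute)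
    have "?b (l + i) + L y (l + i) = v t"
      using unfold[OF x] lead_val_eq[OF A t(2,1), of v] by (simp add: add.commute)
    then show ?thesis
      using trace_entr_eq[OF t(2)] reach_eq_val[of j ?T t] j
      by (simp add: L_def v_def c_def[abs_def])
  qed
  ultimately show ?thesis by simp
qed

section \<open>The series in matrix form\<close>

text \<open>An encoding \<open>F\<close> that intertwines \<open>L\<close> with multiplication by
  \<open>B\<close> intertwines their powers. Powers of the block matrix thus never have to be
  computed.\<close>

lemma pow_mat_mult_funpow:
  assumes "B \<in> carrier_mat N N" "\<And>z. F z \<in> carrier_mat N n" "\<And>z. B * F z = F (L z)"
  shows "B ^\<^sub>m d * F z = F ((L ^^ d) z)"
proof (induction d arbitrary: z)
  case 0
  then show ?case using assms(1,2) by (simp add: left_mult_one_mat[OF assms(2)])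
next
  case (Suc d)
  have "B ^\<^sub>m Suc d * F z = B ^\<^sub>m d * (B * F z)"
    using assms(1,2) by (simp add: assoc_mult_mat[of _ N N _ N _ n])
  then show ?case using Suc assms(3) by (simp add: funpow_swap1)
qed

lemma sum_atLeast0_lessThan_double:
  fixes f :: "nat \<Rightarrow> 'v::comm_monoid_add"
  shows "(\<Sum>k = 0..<l + l. f k) = (\<Sum>k<l. f k) + (\<Sum>k<l. f (k + l))"
  using sum_lessThan_add[of f l l] by (simp add: lessThan_atLeast0)

lemma mc_solution_trace:
  assumes A: "is_romdp A" and l: "l \<le> n_ents A" "l \<le> n_exits A"
  shows "mc_solution (romdp_trace l A) = mc_trace l (mc_solution A)"
proof -
  define m n where "m = n_ents A - l" and "n = n_exits A - l"
  define H where "H i j = reach A j (entr A i)" for i j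
  define L where "L z k = (\<Sum>k'<l. H k k' * z k')" for z k
  \<comment> \<open>\<open>L\<close> acts on a single column of values, \<open>L2\<close> on every
    column of a matrix of dual numbers.\<close>
  define L2 where "L2 z k j = L (\<lambda>k'. z k' j) k" for z :: "nat \<Rightarrow> nat \<Rightarrow> dnum" and k j
  have L2_pow: "(L2 ^^ d) z k j = (L ^^ d) (\<lambda>k'. z k' j) k" for d z k j
    by (induction d arbitrary: k) (simp_all add: L2_def)
  define P R where "P = p_mat (mc_solution A)" and "R = r_mat (mc_solution A)"
  have P: "P $$ (i, j) = dre (H i j)" and R: "R $$ (i, j) = dep (H i j)"
    if "i < m + l" "j < n + l" for i j
    using that l by (auto simp: P_def R_def H_def mc_solution_eq_reach m_def n_def)
  define Ap where "Ap = submat P l 0 m l"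
  define Bp where "Bp = submat P 0 0 l l"
  define Cp where "Cp = submat P 0 l l n"
  define Ar where "Ar = submat R l 0 m l"
  define Br where "Br = submat R 0 0 l l"
  define Cr where "Cr = submat R 0 l l n"
  note sub_defs = Ap_def Bp_def Cp_def Ar_def Br_def Cr_def submat_def
  define A2 where "A2 = four_block_mat Ap Ar (0\<^sub>m 0 l) (0\<^sub>m 0 l)"
  define B2 where "B2 = four_block_mat Bp Br (0\<^sub>m l l) Bp"
  define C2 where "C2 = Cr @\<^sub>r Cp"
  define F1 where "F1 z = mat l n (\<lambda>(k, j). dre (z k j))" for z
  \<comment> \<open>Rewards are stacked above probabilities, as in \<open>C2\<close>. On such a
    stack \<open>B2\<close> gives \<open>Bp\<close> times the rewards plus \<open>Br\<close> times
    the probabilities above, and \<open>Bp\<close> times the probabilities below: the product of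
    dual numbers.\<close>
  define F2 where "F2 z = mat (l + l) n (\<lambda>(k, j). if k < l then dep (z k j) else dre (z (k - l) j))" for z
  define z0 where "z0 k j = H k (l + j)" for k j
  have F1: "F1 z \<in> carrier_mat l n" for z by (simp add: F1_def)
  have F2: "F2 z \<in> carrier_mat (l + l) n" for z by (simp add: F2_def)
  have Bp: "Bp \<in> carrier_mat l l" by (simp add: sub_defs)
  have B2: "B2 \<in> carrier_mat (l + l) (l + l)" by (simp add: B2_def sub_defs)
  have Ap: "Ap \<in> carrier_mat m l" by (simp add: sub_defs)
  have A2: "A2 \<in> carrier_mat m (l + l)"
    unfolding A2_def using four_block_carrier_mat[of Ap m l "0\<^sub>m 0 l" 0 l] Ap by simp
  have B1F: "Bp * F1 z = F1 (L2 z)" for z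
    by (rule eq_matI)
      (auto simp: F1_def sub_defs scalar_prod_def P L2_def L_def lessThan_atLeast0)
  have B2F: "B2 * F2 z = F2 (L2 z)" for z
    by (rule eq_matI)
      (auto simp: F2_def B2_def sub_defs scalar_prod_def P R L2_def L_def
        sum_atLeast0_lessThan_double sum.distrib)
  have C1: "Cp = F1 z0"
    by (rule eq_matI) (auto simp: F1_def sub_defs P z0_def)
  have C2: "C2 = F2 z0"
    by (rule eq_matI) (auto simp: F2_def C2_def append_rows_def sub_defs P R z0_def)
  have p: "(Ap * Bp ^\<^sub>m d * Cp) $$ (i, j) = dre (L ((L ^^ d) (\<lambda>k. H k (l + j))) (l + i))"
    if "i < m" "j < n" for d i j
  proof -
    have "Ap * Bp ^\<^sub>m d * Cp = Ap * F1 ((L2 ^^ d) z0)"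
      unfolding C1 assoc_mult_mat[OF Ap pow_carrier_mat[OF Bp] F1]
        pow_mat_mult_funpow[where F = F1 and L = L2, OF Bp F1 B1F] ..
    then show ?thesis using that
      by (simp add: F1_def sub_defs scalar_prod_def P L2_pow z0_def L_def lessThan_atLeast0)
  qed
  have r: "(A2 * B2 ^\<^sub>m d * C2) $$ (i, j) = dep (L ((L ^^ d) (\<lambda>k. H k (l + j))) (l + i))"
    if "i < m" "j < n" for d i j
  proof -
    have "A2 * B2 ^\<^sub>m d * C2 = A2 * F2 ((L2 ^^ d) z0)"
      unfolding C2 assoc_mult_mat[OF A2 pow_carrier_mat[OF B2] F2]
        pow_mat_mult_funpow[where F = F2 and L = L2, OF B2 F2 B2F] ..
    then have "(A2 * B2 ^\<^sub>m d * C2) $$ (i, j) =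
        (\<Sum>k = 0..<l + l. A2 $$ (i, k) * F2 ((L2 ^^ d) z0) $$ (k, j))"
      using that A2 F2 by (simp add: scalar_prod_def carrier_matD[OF F2])
    also have "\<dots> = dep (L ((L ^^ d) (\<lambda>k. H k (l + j))) (l + i))"
      using that unfolding sum_atLeast0_lessThan_double
      by (simp add: F2_def A2_def sub_defs P R L2_pow z0_def L_def sum.distrib)
    finally show ?thesis .
  qed
  have dims: "dim_row (mc_solution A) - l = m" "dim_col (mc_solution A) - l = n"
    by (auto simp: mc_solution_eq_reach m_def n_def)
  have trace: "mc_trace l (mc_solution A) = mat m n (\<lambda>(i,j).
      (P $$ (l + i, l + j) + (\<Sum>d. (Ap * Bp ^\<^sub>m d * Cp) $$ (i,j)),
       R $$ (l + i, l + j) + (\<Sum>d. (A2 * B2 ^\<^sub>m d * C2) $$ (i,j))))"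
    unfolding mc_trace_def Let_def dims A2_def B2_def C2_def Ap_def Bp_def Cp_def Ar_def Br_def
      Cr_def P_def R_def by simp
  show ?thesis
    unfolding trace
  proof (rule eq_matI)
    fix i j
    assume "i < dim_row (mat m n (\<lambda>(i,j).
      (P $$ (l + i, l + j) + (\<Sum>d. (Ap * Bp ^\<^sub>m d * Cp) $$ (i,j)),
       R $$ (l + i, l + j) + (\<Sum>d. (A2 * B2 ^\<^sub>m d * C2) $$ (i,j)))))"
      and "j < dim_col (mat m n (\<lambda>(i,j).
      (P $$ (l + i, l + j) + (\<Sum>d. (Ap * Bp ^\<^sub>m d * Cp) $$ (i,j)),
       R $$ (l + i, l + j) + (\<Sum>d. (A2 * B2 ^\<^sub>m d * C2) $$ (i,j)))))"
    then have ij: "i < m" "j < n" by auto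
    let ?Z = "\<lambda>d. L ((L ^^ d) (\<lambda>k. H k (l + j))) (l + i)"
    let ?r = "reach (romdp_trace l A) j (trace_entr l A i)"
    have "dlim (\<lambda>K. H (l + i) (l + j) + (\<Sum>d<K. ?Z d)) ?r"
      using reach_trace_series[OF A l, of i j] ij
      unfolding H_def[abs_def] L_def[abs_def] m_def n_def by simp
    then have lim: "(\<lambda>K. dre (H (l + i) (l + j)) + (\<Sum>d<K. dre (?Z d))) \<longlonglongrightarrow> dre ?r"
      "(\<lambda>K. dep (H (l + i) (l + j)) + (\<Sum>d<K. dep (?Z d))) \<longlonglongrightarrow> dep ?r"
      by (simp_all add: dlim_def)
    have suminf: "x + suminf f = s" if "(\<lambda>K. x + (\<Sum>d<K. f d)) \<longlonglongrightarrow> s" for f x and s :: real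
    proof -
      have "(\<lambda>K. \<Sum>d<K. f d) \<longlonglongrightarrow> s - x"
        using tendsto_diff[OF that tendsto_const[of x]] by simp
      then have "f sums (s - x)" by (simp add: sums_def)
      then show ?thesis by (simp add: sums_unique[symmetric])
    qed
    show "mc_solution (romdp_trace l A) $$ (i, j) = mat m n (\<lambda>(i,j).
      (P $$ (l + i, l + j) + (\<Sum>d. (Ap * Bp ^\<^sub>m d * Cp) $$ (i,j)),
       R $$ (l + i, l + j) + (\<Sum>d. (A2 * B2 ^\<^sub>m d * C2) $$ (i,j)))) $$ (i, j)"
      using ij suminf[OF lim(1)] suminf[OF lim(2)]
      by (simp add: mc_solution_eq_reach p r P R m_def[symmetric] n_def[symmetric])
  qed (simp_all add: mc_solution_eq_reach m_def n_def)
qed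

lemma induced_mc_trace: "induced_mc (romdp_trace l A) \<tau> = romdp_trace l (induced_mc A \<tau>)"
proof -
  have "trace_seq (induced_mc A \<tau>) i k = trace_seq A i k" for i k
    by (induction k) (auto split: sum.split)
  then show ?thesis
    by (intro romdp.equality)
      (auto simp: fun_eq_iff romdp_trace_def induced_mc_def trace_entr_def trace_prec_def Let_def)
qed

lemma romdp_solution_trace:
  assumes A: "is_romdp A" and l: "l \<le> n_ents A" "l \<le> n_exits A"
  shows "romdp_solution (romdp_trace l A) = mc_trace l ` romdp_solution A"
  using mc_solution_trace[OF is_romdp_induced_mc[OF A]] l
  by (auto simp: romdp_solution_def induced_mc_trace)

section \<open>Isomorphisms\<close>

text \<open>Names the bijection hidden in \<open>romdp_iso\<close>, so that it can act on paths and
  schedulers.\<close>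

definition iso_via :: "('q \<Rightarrow> 'r) \<Rightarrow> ('q, 'a) romdp \<Rightarrow> ('r, 'a) romdp \<Rightarrow> bool" where
  "iso_via \<eta> A B \<longleftrightarrow> n_ents A = n_ents B \<and> n_exits A = n_exits B \<and>
     bij_betw \<eta> (positions A) (positions B) \<and>
     (\<forall>i < n_ents A. entr B i = map_sum \<eta> id (entr A i)) \<and>
     (\<forall>s \<in> positions A. \<forall>a. \<forall>t \<in> targets A.
        trans_prob B (\<eta> s) a (map_sum \<eta> id t) = trans_prob A s a t) \<and>
     (\<forall>s \<in> positions A. reward B (\<eta> s) = reward A s)"

lemma romdp_iso_iff: "romdp_iso A B \<longleftrightarrow> (\<exists>\<eta>. iso_via \<eta> A B)"
  by (auto simp: romdp_iso_def iso_via_def)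

lemma iso_viaD:
  assumes "iso_via \<eta> A B"
  shows "n_ents B = n_ents A" "n_exits B = n_exits A" "positions B = \<eta> ` positions A"
    "inj_on \<eta> (positions A)" "inj_on (map_sum \<eta> id) (targets A)"
    "targets B = map_sum \<eta> id ` targets A"
    "\<And>i. i < n_ents A \<Longrightarrow> entr B i = map_sum \<eta> id (entr A i)"
    "\<And>s a t. s \<in> positions A \<Longrightarrow> t \<in> targets A \<Longrightarrow>
      trans_prob B (\<eta> s) a (map_sum \<eta> id t) = trans_prob A s a t"
    "\<And>s. s \<in> positions A \<Longrightarrow> reward B (\<eta> s) = reward A s"
proof -
  show pos: "positions B = \<eta> ` positions A" and inj: "inj_on \<eta> (positions A)"
    and ex: "n_exits B = n_exits A"
    using assms by (auto simp: iso_via_def bij_betw_def)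
  show "inj_on (map_sum \<eta> id) (targets A)"
    by (intro inj_onI) (auto simp: targets_def dest: inj_onD[OF inj])
  show "targets B = map_sum \<eta> id ` targets A"
    unfolding targets_def pos ex by (force simp: image_iff)
qed (use assms in \<open>auto simp: iso_via_def\<close>)

lemma is_romdp_iso_via:
  fixes A :: "('q, 'a) romdp" and B :: "('r, 'a) romdp"
  assumes iso: "iso_via \<eta> A B" and A: "is_romdp A"
  shows "is_romdp B"
proof (rule is_romdpI)
  note B = iso_viaD[OF iso]
  show "finite (positions B)" using is_romdpD(1)[OF A] B(3) by simp
  show "entr B i \<in> targets B" if "i < n_ents B" for i
    using that is_romdpD(3)[OF A, of i] B by auto
  show "0 \<le> trans_prob B s a t" if "s \<in> positions B" "t \<in> targets B" for s a t
    using that is_romdpD(4)[OF A] B by auto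
  show "ev B a s (\<lambda>_. 1::real) \<in> {0, 1}" if s: "s \<in> positions B" for s a
  proof -
    obtain s' where s': "s' \<in> positions A" "s = \<eta> s'" using s B(3) by auto
    have "ev B a s (\<lambda>_. 1::real) = ev A a s' (\<lambda>_. 1)"
      unfolding ev_def B(6) using s' B(5,8) by (simp add: sum.reindex)
    then show ?thesis using ev_one[OF A s'(1), of a] by simp
  qed
  show "0 \<le> reward B s" if "s \<in> positions B" for s
    using that is_romdpD(6)[OF A] B by auto
  show "x = y" if t: "t < n_exits B" and x: "x \<in> sources B" "accesses B x t"
    and y: "y \<in> sources B" "accesses B y t" for t x y
  proof -
    define f :: "nat + 'q \<times> 'a \<Rightarrow> nat + 'r \<times> 'a" where "f = map_sum id (map_prod \<eta> id)"
    have "\<exists>z'\<in>sources A. z = f z' \<and> accesses A z' t"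
      if z: "z \<in> sources B" "accesses B z t" for z
    proof (cases z)
      case (Inl i)
      then have i: "i < n_ents A" "map_sum \<eta> id (entr A i) = Inr t" using z B by auto
      then have "entr A i = Inr t" by (cases "entr A i") auto
      then show ?thesis using Inl i by (intro bexI[of _ "Inl i"]) (auto simp: f_def)
    next
      case (Inr sa)
      then obtain s a where sa: "z = Inr (\<eta> s, a)" "s \<in> positions A"
        using z B(3) by (cases sa) auto
      then have "trans_prob A s a (Inr t) > 0"
        using z t B(2) B(8)[of s "Inr t" a] by simp
      then show ?thesis using sa by (intro bexI[of _ "Inr (s, a)"]) (auto simp: f_def)
    qed
    from this[OF x] this[OF y] show ?thesis
      using unique_accessD[OF A, of t] t B(2) by metis
  qed
qed

lemma iso_via_induced_mc:
  assumes "iso_via \<eta> A B" "\<And>s. s \<in> positions A \<Longrightarrow> \<sigma> (\<eta> s) = \<tau> s"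
  shows "iso_via \<eta> (induced_mc A \<tau>) (induced_mc B \<sigma>)"
  using assms by (auto simp: iso_via_def)

lemma path_prob_map:
  assumes iso: "iso_via \<eta> C D" and j: "j < n_exits C" and "set ss \<subseteq> positions C"
  shows "path_prob D j (map \<eta> ss) = path_prob C j ss"
  using assms(3)
proof (induction ss)
  case (Cons s ss)
  have hd: "hd (map Inl (map \<eta> ss) @ [Inr j]) = map_sum \<eta> id (hd (map Inl ss @ [Inr j]))"
    by (cases ss) auto
  show ?case
    using Cons iso_viaD(8)[OF iso, of s "hd (map Inl ss @ [Inr j])"] hd_target[OF _ j, of ss]
    by (simp add: path_prob_Cons hd del: map_map)
qed (simp add: path_prob_def)

text \<open>Applying \<eta> to every position is a bijection between the paths that keeps
  probability and reward, so the path sums agree term by term.\<close>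

lemma reach_iso_via:
  assumes iso: "iso_via \<eta> C D" and j: "j < n_exits C" and t: "t \<in> targets C"
  shows "reach D j (map_sum \<eta> id t) = reach C j t"
proof -
  note D = iso_viaD[OF iso]
  have hd: "hd (map Inl (map \<eta> ss) @ [Inr j]) = map_sum \<eta> id (hd (map Inl ss @ [Inr j]))" for ss
    by (cases ss) auto
  have bij: "bij_betw (map \<eta>) (tpaths C j t) (tpaths D j (map_sum \<eta> id t))"
  proof (rule bij_betw_imageI)
    show "inj_on (map \<eta>) (tpaths C j t)"
      by (rule inj_on_mapI, rule inj_on_subset[OF D(4)]) (auto simp: tpaths_def)
    show "map \<eta> ` tpaths C j t = tpaths D j (map_sum \<eta> id t)"
    proof (intro equalityI subsetI)
      fix ss assume "ss \<in> tpaths D j (map_sum \<eta> id t)"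
      then have ss: "set ss \<subseteq> \<eta> ` positions C" "hd (map Inl ss @ [Inr j]) = map_sum \<eta> id t"
        by (auto simp: tpaths_def D(3))
      then have "ss \<in> map \<eta> ` lists (positions C)"
        unfolding lists_image[symmetric] by (auto simp: lists_eq_set)
      then obtain ss' where ss': "ss = map \<eta> ss'" "set ss' \<subseteq> positions C"
        by (auto simp: lists_eq_set)
      then have "hd (map Inl ss' @ [Inr j]) = t"
        using ss(2) D(5) t hd_target[OF ss'(2) j] unfolding ss'(1) hd inj_on_def by blast
      then show "ss \<in> map \<eta> ` tpaths C j t" using ss' by (auto simp: tpaths_def)
    next
      fix ss assume "ss \<in> map \<eta> ` tpaths C j t"
      then obtain ss' where ss': "ss = map \<eta> ss'" "set ss' \<subseteq> positions C"
        "hd (map Inl ss' @ [Inr j]) = t"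
        by (auto simp: tpaths_def)
      then show "ss \<in> tpaths D j (map_sum \<eta> id t)"
        using hd[of ss'] by (auto simp: tpaths_def D(3))
    qed
  qed
  have prob: "path_prob D j (map \<eta> ss) = path_prob C j ss" if "ss \<in> tpaths C j t" for ss
    using path_prob_map[OF iso j, of ss] that by (auto simp: tpaths_def)
  have rew: "path_reward D (map \<eta> ss) = path_reward C ss" if "ss \<in> tpaths C j t" for ss
  proof -
    have "ss ! k \<in> positions C" if "k < length ss" for k
      using \<open>ss \<in> tpaths C j t\<close> that by (auto simp: tpaths_def)
    then show ?thesis by (simp add: path_reward_def D(9))
  qed
  show ?thesis
    unfolding reach_def infsum_reindex_bij_betw[OF bij, symmetric]
    by (simp add: prob rew cong: infsum_cong)
qed

lemma mc_solution_iso_via: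
  assumes C: "is_romdp C" and iso: "iso_via \<eta> C D"
  shows "mc_solution C = mc_solution D"
  using iso_viaD[OF iso] reach_iso_via[OF iso] is_romdpD(3)[OF C]
  by (auto simp: mc_solution_eq_reach intro!: eq_matI)

text \<open>Schedulers are transported both ways: from \<open>B\<close> to \<open>A\<close> by
  composing with \<eta>, from \<open>A\<close> to \<open>B\<close> by composing with its inverse on
  the positions.\<close>

lemma romdp_solution_iso:
  assumes A: "is_romdp A" and iso: "romdp_iso A B"
  shows "romdp_solution B = romdp_solution A"
proof -
  obtain \<eta> where \<eta>: "iso_via \<eta> A B" using iso romdp_iso_iff by blast
  have eq: "mc_solution (induced_mc A \<tau>) = mc_solution (induced_mc B \<sigma>)"
    if "\<And>s. s \<in> positions A \<Longrightarrow> \<sigma> (\<eta> s) = \<tau> s" for \<sigma> \<tau>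
    by (rule mc_solution_iso_via[OF is_romdp_induced_mc[OF A] iso_via_induced_mc[OF \<eta>]])
      (rule that)
  have "mc_solution (induced_mc A \<tau>) = mc_solution (induced_mc B (\<tau> \<circ> inv_into (positions A) \<eta>))" for \<tau>
    by (rule eq) (simp add: iso_viaD(4)[OF \<eta>])
  moreover have "mc_solution (induced_mc A (\<sigma> \<circ> \<eta>)) = mc_solution (induced_mc B \<sigma>)" for \<sigma>
    by (rule eq) simp
  ultimately show ?thesis unfolding romdp_solution_def by (auto; metis)
qed

section \<open>Representatives with natural numbers as positions\<close>

text \<open>Composition and sum produce positions in a sum type, while an arrow contains only roMDPs
  on natural numbers. A relabelled copy has to exist, since \<open>solR\<close> of an empty class
  would be empty.\<close>

lemma iso_class_nonempty:
  fixes A :: "('q, 'a) romdp"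
  assumes A: "is_romdp A"
  shows "iso_class A \<noteq> {}"
proof -
  obtain h :: "'q \<Rightarrow> nat" where h: "inj_on h (positions A)"
    using finite_imp_inj_to_nat_seg[OF is_romdpD(1)[OF A]] by blast
  define g where "g = inv_into (positions A) h"
  have g: "g (h s) = s" if "s \<in> positions A" for s
    using h that by (simp add: g_def)
  define B where "B = \<lparr> n_ents = n_ents A, n_exits = n_exits A, positions = h ` positions A,
    entr = (\<lambda>i. map_sum h id (entr A i)),
    trans_prob = (\<lambda>s a t. trans_prob A (g s) a (map_sum g id t)), reward = (\<lambda>s. reward A (g s)) \<rparr>"
  have "map_sum g id (map_sum h id t) = t" if "t \<in> targets A" for t
    using that by (cases t) (auto simp: g)
  then have iso: "iso_via h A B"
    using h g by (simp add: iso_via_def B_def bij_betw_def)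
  then have "is_romdp B" using A is_romdp_iso_via by blast
  then have "B \<in> iso_class A" using iso by (auto simp: iso_class_def romdp_iso_iff)
  then show ?thesis by blast
qed

lemma solR_iso_class:
  assumes "is_romdp A"
  shows "solR (iso_class A) = romdp_solution A"
  using iso_class_nonempty[OF assms] romdp_solution_iso[OF assms]
  by (auto simp: solR_def iso_class_def)

section \<open>The solution functor\<close>

text \<open>The operations of \<open>roMDP\<close> preserve this weak typing judgement even on sets of roMDPs that
  are not isomorphism classes, and it is all that compositionality needs.\<close>

definition typed :: "nat \<Rightarrow> nat \<Rightarrow> 'a romdp_arrow \<Rightarrow> bool" where
  "typed m n X \<longleftrightarrow> (\<forall>A\<in>X. is_romdp A \<and> n_ents A = m \<and> n_exits A = n)"

lemma typedD:
  assumes "typed m n X" "A \<in> X"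
  shows "is_romdp A" "n_ents A = m" "n_exits A = n"
  using assms by (auto simp: typed_def)

lemma typed_iso_class: "n_ents A = m \<Longrightarrow> n_exits A = n \<Longrightarrow> typed m n (iso_class A)"
  by (auto simp: typed_def iso_class_def romdp_iso_def)

lemma typed_hom: "X \<in> hom roMDP m n \<Longrightarrow> typed m n X"
  by (auto simp: roMDP_def typed_iso_class)

lemma typed_UN: "(\<And>A. A \<in> X \<Longrightarrow> typed m n (F A)) \<Longrightarrow> typed m n (\<Union>A\<in>X. F A)"
  by (auto simp: typed_def)

lemma solR_UN: "solR (\<Union>A\<in>X. F A) = (\<Union>A\<in>X. solR (F A))"
  by (auto simp: solR_def)

lemma typed_roMDP:
  "typed m m (ident roMDP m)"
  "typed (m + n) (n + m) (swp roMDP m n)"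
  "typed m k X \<Longrightarrow> typed k n Y \<Longrightarrow> typed m n (cmp roMDP X Y)"
  "typed m n X \<Longrightarrow> typed k l' Y \<Longrightarrow> typed (m + k) (n + l') (tens roMDP X Y)"
  "typed (l + m) (l + n) X \<Longrightarrow> typed m n (tr roMDP l X)"
  unfolding roMDP_def tsmc.simps
  by (intro typed_UN typed_iso_class; simp add: romdp_id_def romdp_swap_def typed_def)+

lemma solR_subset:
  assumes X: "typed m n X"
  shows "solR X \<subseteq> mc_hom m n"
proof -
  have "mc_solution (induced_mc A \<tau>) \<in> mc_hom m n" if "A \<in> X" for A \<tau>
    using mc_solution_in_mc_hom[OF is_romdp_induced_mc, of A \<tau>] typedD[OF X that] by simp
  then show ?thesis by (auto simp: solR_def romdp_solution_def)
qed

lemma solR_ident: "solR (ident roMDP m) = ident semR m"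
  by (simp add: roMDP_def semR_def solR_iso_class is_romdp_id romdp_solution_id)

lemma solR_swp: "solR (swp roMDP m n) = swp semR m n"
  by (simp add: roMDP_def semR_def solR_iso_class is_romdp_swap romdp_solution_swap)

lemma solR_cmp:
  assumes X: "typed m k X" and Y: "typed k n Y"
  shows "solR (cmp roMDP X Y) = cmp semR (solR X) (solR Y)"
proof -
  have "solR (iso_class (romdp_seq A B)) = cmp semR (romdp_solution A) (romdp_solution B)"
    if "A \<in> X" "B \<in> Y" for A B
    using typedD[OF X that(1)] typedD[OF Y that(2)]
    by (simp add: solR_iso_class is_romdp_seq romdp_solution_seq semR_def)
  then have "solR (cmp roMDP X Y) = (\<Union>A\<in>X. \<Union>B\<in>Y. cmp semR (romdp_solution A) (romdp_solution B))"
    by (simp add: roMDP_def solR_UN)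
  also have "\<dots> = cmp semR (solR X) (solR Y)"
    by (auto simp: semR_def solR_def)
  finally show ?thesis .
qed

lemma solR_tens:
  assumes X: "typed m n X" and Y: "typed k l Y"
  shows "solR (tens roMDP X Y) = tens semR (solR X) (solR Y)"
proof -
  have "solR (iso_class (romdp_sum A B)) = tens semR (romdp_solution A) (romdp_solution B)"
    if "A \<in> X" "B \<in> Y" for A B
    using typedD[OF X that(1)] typedD[OF Y that(2)]
    by (simp add: solR_iso_class is_romdp_sum romdp_solution_sum semR_def)
  then have "solR (tens roMDP X Y) = (\<Union>A\<in>X. \<Union>B\<in>Y. tens semR (romdp_solution A) (romdp_solution B))"
    by (simp add: roMDP_def solR_UN)
  also have "\<dots> = tens semR (solR X) (solR Y)"
    by (auto simp: semR_def solR_def)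
  finally show ?thesis .
qed

lemma solR_tr:
  assumes X: "typed (l + m) (l + n) X"
  shows "solR (tr roMDP l X) = tr semR l (solR X)"
proof -
  have "solR (iso_class (romdp_trace l A)) = tr semR l (romdp_solution A)" if "A \<in> X" for A
    using typedD[OF X that]
    by (simp add: solR_iso_class is_romdp_trace romdp_solution_trace semR_def)
  then have "solR (tr roMDP l X) = (\<Union>A\<in>X. tr semR l (romdp_solution A))"
    by (simp add: roMDP_def solR_UN)
  also have "\<dots> = tr semR l (solR X)"
    by (auto simp: semR_def solR_def)
  finally show ?thesis .
qed

text \<open>Typing the five factors lets preservation of \<open>cmp\<close>, \<open>tens\<close> and
  \<open>tr\<close> be applied one after another. Associativity of addition enters where
  neighbouring factors bracket their objects differently.\<close>

lemma solR_int_comp: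
  assumes f: "typed (m + l') (l + m') f" and g: "typed (l + n') (n + l') g"
  shows "solR (int_comp roMDP (m, m') (l, l') (n, n') f g) =
    int_comp semR (m, m') (l, l') (n, n') (solR f) (solR g)"
proof -
  let ?C = "roMDP :: 'a romdp_arrow tsmc"
  let ?c1 = "tens ?C (swp ?C l' m) (ident ?C n')" and ?c2 = "tens ?C f (ident ?C n')"
    and ?c3 = "tens ?C (ident ?C l) (swp ?C m' n')" and ?c4 = "tens ?C g (ident ?C m')"
    and ?c5 = "tens ?C (swp ?C n l') (ident ?C m')"
  note t = typed_roMDP
  have t1: "typed (l' + m + n') (m + l' + n') ?c1" by (intro t)
  have t2: "typed (m + l' + n') (l + m' + n') ?c2" by (intro t f)
  have t3: "typed (l + m' + n') (l + n' + m') ?c3"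
    using t(4)[OF t(1)[of l] t(2)[of m' n']] by (simp add: add.assoc)
  have t4: "typed (l + n' + m') (n + l' + m') ?c4" by (intro t g)
  have t5: "typed (n + l' + m') (l' + n + m') ?c5" by (intro t)
  note t45 = t(3)[OF t4 t5]
  note t345 = t(3)[OF t3 t45]
  note t2345 = t(3)[OF t2 t345]
  have t12345: "typed (l' + (m + n')) (l' + (n + m'))
      (cmp ?C ?c1 (cmp ?C ?c2 (cmp ?C ?c3 (cmp ?C ?c4 ?c5))))"
    using t(3)[OF t1 t2345] by (simp add: add.assoc)
  have "solR (tr ?C l' (cmp ?C ?c1 (cmp ?C ?c2 (cmp ?C ?c3 (cmp ?C ?c4 ?c5))))) =
      tr semR l' (cmp semR (solR ?c1) (cmp semR (solR ?c2) (cmp semR (solR ?c3)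
        (cmp semR (solR ?c4) (solR ?c5)))))"
    by (simp add: solR_tr[OF t12345] solR_cmp[OF t1 t2345] solR_cmp[OF t2 t345]
        solR_cmp[OF t3 t45] solR_cmp[OF t4 t5])
  then show ?thesis
    by (simp add: solR_tens[OF t(2) t(1)] solR_tens[OF t(1) t(2)] solR_tens[OF f t(1)]
        solR_tens[OF g t(1)] solR_ident solR_swp)
qed

lemma solR_int_tens:
  assumes f: "typed (m + n') (n + m') f" and g: "typed (k + l') (l + k') g"
  shows "solR (int_tens roMDP (m, m') (n, n') (k, k') (l, l') f g) =
    int_tens semR (m, m') (n, n') (k, k') (l, l') (solR f) (solR g)"
proof -
  let ?C = "roMDP :: 'a romdp_arrow tsmc"
  let ?c1 = "tens ?C (tens ?C (ident ?C m) (swp ?C k n')) (ident ?C l')" and ?c2 = "tens ?C f g"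
    and ?c3 = "tens ?C (tens ?C (ident ?C n) (swp ?C m' l)) (ident ?C k')"
  note t = typed_roMDP
  have t1: "typed (m + (k + n') + l') (m + n' + (k + l')) ?c1"
    using t(4)[OF t(4)[OF t(1)[of m] t(2)[of k n']] t(1)[of l']] by (simp add: add.assoc)
  have t2: "typed (m + n' + (k + l')) (n + m' + (l + k')) ?c2" by (intro t f g)
  have t3: "typed (n + m' + (l + k')) (n + (l + m') + k') ?c3"
    using t(4)[OF t(4)[OF t(1)[of n] t(2)[of m' l]] t(1)[of k']] by (simp add: add.assoc)
  have "solR (cmp ?C ?c1 (cmp ?C ?c2 ?c3)) = cmp semR (solR ?c1) (cmp semR (solR ?c2) (solR ?c3))"
    by (simp add: solR_cmp[OF t1 t(3)[OF t2 t3]] solR_cmp[OF t2 t3])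
  then show ?thesis
    by (simp add: solR_tens[OF f g] solR_tens[OF t(4)[OF t(1) t(2)] t(1)] solR_tens[OF t(1) t(2)]
        solR_ident solR_swp)
qed

text \<open>Objects are kept fixed, and all arrows of the Int structure are terms in identities,
  swaps, composition, tensor and trace; units and counits are single swaps. Preservation of these
  operations by \<open>solR\<close>, together with \<open>solR_subset\<close> for the targets of
  arrows, gives all clauses.\<close>

theorem theorem6:
  shows "compact_closed_functor (oMDP :: (nat \<times> nat, ('a::finite) romdp_arrow) compact_closed) Sem Sol \<and>
    (\<forall>X Y Z. \<forall>A \<in> cc_hom (oMDP :: (nat \<times> nat, 'a romdp_arrow) compact_closed) X Y.
       \<forall>B \<in> cc_hom oMDP Y Z.
         farr Sol X Z (cc_comp oMDP X Y Z A B) =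
         cc_comp Sem X Y Z (farr Sol X Y A) (farr Sol Y Z B)) \<and>
    (\<forall>X Y X' Y'. \<forall>A' \<in> cc_hom (oMDP :: (nat \<times> nat, 'a romdp_arrow) compact_closed) X Y.
       \<forall>B' \<in> cc_hom oMDP X' Y'.
         farr Sol (cc_tens_obj oMDP X X') (cc_tens_obj oMDP Y Y') (cc_tens oMDP X Y X' Y' A' B') =
         cc_tens Sem X Y X' Y' (farr Sol X Y A') (farr Sol X' Y' B'))"
proof -
  have farr: "farr (Sol :: (_, 'a romdp_arrow, _, _) functor_data) X Y f = solR f" for X Y f
    by (simp add: Sol_def Int_functor_def)
  have fobj: "fobj (Sol :: (_, 'a romdp_arrow, _, _) functor_data) X = X" for X
    by (simp add: Sol_def Int_functor_def)
  have hom: "typed (fst X + snd Y) (fst Y + snd X) f"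
    if "f \<in> cc_hom (oMDP :: (_, 'a romdp_arrow) compact_closed) X Y" for X Y f
    using that by (intro typed_hom) (auto simp: oMDP_def Int_cat_def split: prod.splits)
  have into: "solR f \<in> cc_hom Sem X Y"
    if "f \<in> cc_hom (oMDP :: (_, 'a romdp_arrow) compact_closed) X Y" for X Y f
    using solR_subset[OF hom[OF that]]
    by (auto simp: Sem_def Int_cat_def semR_def split: prod.splits)
  have comp: "solR (cc_comp oMDP X Y Z f g) = cc_comp Sem X Y Z (solR f) (solR g)"
    if "f \<in> cc_hom (oMDP :: (_, 'a romdp_arrow) compact_closed) X Y" "g \<in> cc_hom oMDP Y Z"
    for X Y Z f g
    using hom[OF that(1)] hom[OF that(2)]
    by (cases X; cases Y; cases Z)
      (simp add: oMDP_def Sem_def Int_cat_def solR_int_comp del: int_comp.simps)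
  have tens: "solR (cc_tens oMDP X Y X' Y' f g) = cc_tens Sem X Y X' Y' (solR f) (solR g)"
    if "f \<in> cc_hom (oMDP :: (_, 'a romdp_arrow) compact_closed) X Y" "g \<in> cc_hom oMDP X' Y'"
    for X Y X' Y' f g
    using hom[OF that(1)] hom[OF that(2)]
    by (cases X; cases Y; cases X'; cases Y')
      (simp add: oMDP_def Sem_def Int_cat_def solR_int_tens del: int_tens.simps)
  have sym: "solR (cc_sym (oMDP :: (_, 'a romdp_arrow) compact_closed) X Y) = cc_sym Sem X Y" for X Y
    by (cases X; cases Y) (simp add: oMDP_def Sem_def Int_cat_def solR_swp
        solR_tens[OF typed_roMDP(2) typed_roMDP(2)])
  show ?thesis
    unfolding compact_closed_functor_def farr fobj using into comp tens sym
    by (auto simp: oMDP_def Sem_def Int_cat_def solR_ident solR_swp split: prod.splits)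
qed

end
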